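(* Let $S$ be a compact connected Riemann surface and let $f:S\to \mathbb{Q}_3$ be an isotropic curve with constant bending $\kappa$. Then $f$ is of regular type (i.e. $\kappa\neq 1,-16/9$), $\mathbf r(\kappa)$ belongs to $|[\dot{\mathbb{Q}}]|$, and $f$ is dominated by the isotropic $W$-curve $f_q$, where $q$ is the unique element of $\mathbf r(\kappa)$ strictly greater than $1$.
   Context: The map $\mathbf r$. $\dot{\mathbb{C}}=\mathbb{C}\setminus\{0\}$, $\dot{\mathbb{Q}}$ is the set of nonzero rationals, $\mathcal D_4$ is the group of transformations of $\dot{\mathbb{C}}$ generated by $z\mapsto1/z$ and $z\mapsto-z$, $|[z]|\in\dot{\mathbb{C}}/\mathcal D_4$ is the class (orbit) of $z$, and $|[\dot{\mathbb{Q}}]|$ is the projection of $\dot{\mathbb{Q}}$ to $\dot{\mathbb{C}}/\mathcal D_4$. For $\kappa\in\mathbb{C}\setminus\{1,-16/9\}$ choose $c$ with $c^2=\kappa$ and put $\mathbf r(\kappa)=\big|\big[\sqrt{(5c-4\sqrt{c^2-1})(5c+4\sqrt{c^2-1})^{-1}}\,\big]\big|$, which is independent of the choices of $c$ and of the square roots. Isotropic $W$-curves. Let $q=m/n>1$ be rational, $m,n$ coprime positive integers, and $\varepsilon_q\in\{0,1\}$, $\varepsilon_q\equiv m+n\pmod 2$. Put $$\mathtt v_q(z)=(m-n)\mathbf e_1-(m+n)z^{(1+\varepsilon_q)m}\mathbf e_3-2i\sqrt{mn}\,z^{\frac{(m+n)(1+\varepsilon_q)}{2}}\mathbf e_4,$$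 $$\mathtt w_q(z)=(m-n)\mathbf e_2-2i\sqrt{mn}\,z^{\frac{(m+n)(1+\varepsilon_q)}{2}}\mathbf e_3+(m+n)z^{n(1+\varepsilon_q)}\mathbf e_4 .$$ The isotropic $W$-curve with parameter $q$ is $f_q:\mathbb{C}\cup\{\infty\}\to\mathbb{Q}_3$, $f_q(z)=[\mathtt v_q(z)\wedge\mathtt w_q(z)]$, $f_q(\infty)=[\mathbf e_3\wedge\mathbf e_4]$. Domination: $f:S\to\mathbb{Q}_3$ is dominated by $g:S'\to\mathbb{Q}_3$ if there exist a holomorphic map $h:S\to S'$ and $X\in\mathrm{Sp}(2,\mathbb{C})$ with $f=X\cdot g\circ h$. Symplectic group. $(\mathbf e_1,\dots,\mathbf e_4)$ is the natural basis of $\mathbb{C}^4$, $\omega=dz^1\wedge dz^3+dz^2\wedge dz^4$, $\mathrm{Sp}(2,\mathbb{C})$ is the group of linear automorphisms of $(\mathbb{C}^4,\omega)$. For $A\in\mathrm{Sp}(2,\mathbb{C})$, $A_j=A\mathbf e_j$. $\varphi=(\varphi^i_j)=A^{-1}dA$ is the Maurer–Cartan form ($i$ = row, $j$ = column). $\mathbf a_r^s$ is the $2\times2$ matrix with $1$ in the $(r,s)$ place and $0$ elsewhere; $(\mathbf a_1,\mathbf a_2)$ is the natural basis of $\mathbb{C}^2$. Isotropic curves. $\mathbb{Q}_3$ is the complex 3-fold of Lagrangian 2-planes of $(\mathbb{C}^4,\omega)$; the plane spanned by $\mathbf x,\mathbf y$ is written $[\mathbf x\wedge\mathbf y]$. Its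 canonical conformal structure is represented, for a local holomorphic section $A$ of $A\mapsto[A_1\wedge A_2]$, by $\varphi^3_1\varphi^4_2-(\varphi^4_1)^2$. An isotropic curve is a nonconstant holomorphic map $f:S\to\mathbb{Q}_3$ from a connected Riemann surface, null for this conformal structure and with image not contained in a null ray $\{P : [\xi]\subset P\}$, $[\xi]\in\mathbb{CP}^3$. If locally $f=[\mathbf u_1\wedge\mathbf u_2]$, the symmetric matrix $\dot{\mathbf m}=(\omega(\mathbf u_i,\mathbf u_j'))$ has zero determinant; the Legendre associate $f^\sharp:S\to\mathbb{CP}^3$ is the holomorphic map which, where $\dot{\mathbf m}\neq0$, is the line spanned by $x_1\mathbf u_1+x_2\mathbf u_2$ with $0\ne(x_1,x_2)\in\ker\dot{\mathbf m}$ (extended holomorphically). $|\Delta_f|,|\Delta_{f^\sharp}|$ are the sets of critical points of $f,f^\sharp$, and $S_\star=S\setminus(|\Delta_f|\cup|\Delta_{f^\sharp}|)$. Projective structures. $\mathrm{SL}(2,\mathbb{C})_1$ is the group of upper triangular unimodular $2\times2$ matrices. A projective structure on a Riemann surface is a holomorphic principal $\mathrm{SL}(2,\mathbb{C})_1$-bundle $P$ with a holomorphic $\mathfrak{sl}(2,\mathbb{C})$-valued Cartan connection $\eta$. A chart $(U,z)$ is adapted to $(P,\eta)$ if there is a section $\mathfrak p:U\to P$ with $\mathfrak p^*(\eta)=\mathbf a_2^1dz$; such charts form an atlas. A meromorphic projective structure on $S$ is a projective structure on $S\setminus D$, $D$ discrete, such that near each $p_0\in D$ there is a section over a punctured neighborhood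 pulling $\eta$ back to a form meromorphic at $p_0$. The operator $\mathfrak d$ from meromorphic quartic to meromorphic quadratic differentials is defined by $\mathfrak d(0)=0$ and, in any adapted chart, $\mathfrak d(Z\,dz^4)=\big(\tfrac12\tfrac{Z''}{Z}-\tfrac{9}{16}\tfrac{Z'^2}{Z^2}\big)dz^2$ (independent of the adapted chart; the result is meromorphic on all of $S$). Quartic differential and bending. Let $\mathtt F:\mathrm S^3(\mathbb{C}^2)\to\mathbb{C}^4$ be the linear isomorphism with $\mathtt F(\mathbf a_1^3)=\mathbf e_1$, $\mathtt F(\mathbf a_1^2\mathbf a_2)=-\sqrt[3]{2/9}\,\mathbf e_2$, $\mathtt F(\mathbf a_1\mathbf a_2^2)=\sqrt[3]{1/6}\,\mathbf e_4$, $\mathtt F(\mathbf a_2^3)=\mathbf e_3$ (symmetric products), $\mathtt S:\mathrm{SL}(2,\mathbb{C})\to\mathrm{Sp}(2,\mathbb{C})$ the representation on $\mathrm S^3(\mathbb{C}^2)$ conjugated by $\mathtt F$, and $\mathrm H_1=\mathtt S(\mathrm{SL}(2,\mathbb{C})_1)$. For an isotropic curve $f$ there is a unique reduction $\pi:\mathcal F\to S_\star$, with group $\mathrm H_1\cong \mathrm{SL}(2,\mathbb{C})_1$, of the bundle $\{(p,A)\in S_\star\times \mathrm{Sp}(2,\mathbb{C}): f(p)=[A_1\wedge A_2]\}$ on which $\varphi^3_1=\varphi^4_1=\varphi^2_1-\varphi^4_2=\varphi^1_1-3\varphi^2_2=4\varphi^1_2-3\varphi^2_4=\varphi^1_4=0$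 and $\varphi^4_2\neq0$. The quartic differential $\delta$ of $f$ is the meromorphic quartic differential on $S$ with $\pi^*(\delta)=\varphi^1_3(\varphi^4_2)^3$, and the projective structure of $f$ is the meromorphic projective structure $(\mathcal F,\eta)$ with $\eta=\varphi^2_2(\mathbf a_1^1-\mathbf a_2^2)-6^{-1/3}\varphi^4_2\mathbf a_2^1-(3/32)^{1/3}\varphi^2_4\mathbf a_1^2$. $f$ is of general type if $\delta\not\equiv0$; then its (conformal) bending is the meromorphic function $\mathfrak d(\delta)^2/\delta$, with $\mathfrak d$ the operator of the projective structure of $f$. "Constant bending $\kappa$" means that $f$ is of general type and this function is the constant $\kappa\in\mathbb{C}$. Such a curve is of regular type if $\kappa\ne1,-16/9$ and of exceptional type otherwise. *)

theory Defs
  imports "HOL-Complex_Analysis.Complex_Analysis"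
begin

section \<open>Riemann surfaces\<close>

text \<open>
  A Riemann surface is a Hausdorff topology together with a maximal holomorphic atlas.
  A chart is a pair \<open>(U, z)\<close>; only the values of \<open>z\<close> on \<open>U\<close> matter. Because the atlas is
  maximal, it contains every restriction of a chart to an open subset of its domain, so that
  ``locally near \<open>p\<close>'' can be expressed by ``on some chart whose domain contains \<open>p\<close>''.
  Second countability is not required: it is automatic for compact surfaces, and for
  connected ones by Rado's theorem.
\<close>

type_synonym 'a chart = "'a set \<times> ('a \<Rightarrow> complex)"

definition complex_chart :: "'a topology \<Rightarrow> 'a chart \<Rightarrow> bool" where
  "complex_chart X c \<longleftrightarrow> (case c of (U, z) \<Rightarrow>
     openin X U \<and> open (z ` U) \<and>
     homeomorphic_map (subtopology X U) (top_of_set (z ` U)) z)"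

definition transition :: "'a chart \<Rightarrow> 'a chart \<Rightarrow> complex \<Rightarrow> complex" where
  "transition c d = (case (c, d) of ((U, z), (V, w)) \<Rightarrow> z \<circ> inv_into V w)"

definition compatible :: "'a chart \<Rightarrow> 'a chart \<Rightarrow> bool" where
  "compatible c d \<longleftrightarrow> (case (c, d) of ((U, z), (V, w)) \<Rightarrow>
     transition c d holomorphic_on w ` (U \<inter> V) \<and>
     transition d c holomorphic_on z ` (U \<inter> V))"

definition riemann_surface :: "'a topology \<Rightarrow> 'a chart set \<Rightarrow> bool" where
  "riemann_surface X \<A> \<longleftrightarrow>
     Hausdorff_space X \<and>
     (\<Union>(U, z)\<in>\<A>. U) = topspace X \<and>
     \<A> = {c. complex_chart X c \<and> (\<forall>d\<in>\<A>. compatible c d)}"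

definition holomorphic_map ::
  "'a topology \<Rightarrow> 'a chart set \<Rightarrow> 'b chart set \<Rightarrow> ('a \<Rightarrow> 'b) \<Rightarrow> bool" where
  "holomorphic_map X \<A> \<B> h \<longleftrightarrow>
     (\<forall>p\<in>topspace X. \<exists>(U, z)\<in>\<A>. \<exists>(V, w)\<in>\<B>.
        p \<in> U \<and> h ` U \<subseteq> V \<and> (w \<circ> h \<circ> inv_into U z) holomorphic_on z ` U)"

text \<open>The Riemann sphere; \<open>None\<close> is the point at infinity.\<close>

definition sphere :: "complex option topology" where
  "sphere = Alexandroff_compactification euclidean"

definition sphere_charts :: "complex option chart set" where
  "sphere_charts =
     {(range Some, the),
      (UNIV - {Some 0}, \<lambda>p. case p of None \<Rightarrow> 0 | Some z \<Rightarrow> inverse z)}"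

definition sphere_atlas :: "complex option chart set" where
  "sphere_atlas = {c. complex_chart sphere c \<and> (\<forall>d\<in>sphere_charts. compatible c d)}"


section \<open>Meromorphic differentials\<close>

text \<open>
  A meromorphic differential of degree \<open>n\<close> is the family of its coefficients \<open>\<delta> (U, z)\<close>,
  functions on \<open>z ` U\<close> with \<open>\<delta> (U, z) dz\<^sup>n\<close> independent of the chart. As everywhere in the
  library, the values of a meromorphic function on a sparse set are irrelevant.
\<close>

type_synonym 'a differential = "'a chart \<Rightarrow> complex \<Rightarrow> complex"

definition meromorphic_differential ::
  "'a chart set \<Rightarrow> nat \<Rightarrow> 'a differential \<Rightarrow> bool" where
  "meromorphic_differential \<A> n \<delta> \<longleftrightarrow>
     (\<forall>(U, z)\<in>\<A>. \<delta> (U, z) meromorphic_on z ` U) \<and>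
     (\<forall>(U, z)\<in>\<A>. \<forall>(V, w)\<in>\<A>. \<forall>\<^sub>\<approx>x\<in>w ` (U \<inter> V).
        \<delta> (V, w) x = \<delta> (U, z) (transition (U, z) (V, w) x)
                       * deriv (transition (U, z) (V, w)) x ^ n)"

definition zero_differential :: "'a chart set \<Rightarrow> 'a differential \<Rightarrow> bool" where
  "zero_differential \<A> \<delta> \<longleftrightarrow> (\<forall>(U, z)\<in>\<A>. \<forall>\<^sub>\<approx>x\<in>z ` U. \<delta> (U, z) x = 0)"


section \<open>The symplectic group\<close>

abbreviation e :: "4 \<Rightarrow> complex^4" where
  "e i \<equiv> axis i 1"

definition \<omega> :: "complex^4 \<Rightarrow> complex^4 \<Rightarrow> complex" where
  "\<omega> x y = (x$1 * y$3 - x$3 * y$1) + (x$2 * y$4 - x$4 * y$2)"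

definition Sp2 :: "(complex^4^4) set" where
  "Sp2 = {A. invertible A \<and> (\<forall>x y. \<omega> (A *v x) (A *v y) = \<omega> x y)}"

definition vec_holomorphic_on :: "(complex \<Rightarrow> complex^4) \<Rightarrow> complex set \<Rightarrow> bool" where
  "vec_holomorphic_on u D \<longleftrightarrow> (\<forall>i. (\<lambda>x. u x $ i) holomorphic_on D)"

definition vec_deriv :: "(complex \<Rightarrow> complex^4) \<Rightarrow> complex \<Rightarrow> complex^4" where
  "vec_deriv u x = (\<chi> i. deriv (\<lambda>y. u y $ i) x)"

definition mat_holomorphic_on :: "(complex \<Rightarrow> complex^4^4) \<Rightarrow> complex set \<Rightarrow> bool" where
  "mat_holomorphic_on A D \<longleftrightarrow> (\<forall>i j. (\<lambda>x. A x $ i $ j) holomorphic_on D)"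

definition mat_deriv :: "(complex \<Rightarrow> complex^4^4) \<Rightarrow> complex \<Rightarrow> complex^4^4" where
  "mat_deriv A x = (\<chi> i j. deriv (\<lambda>y. A y $ i $ j) x)"

text \<open>
  \<open>maurer_cartan A i j\<close> is the coefficient of \<open>dx\<close> in the pull-back by \<open>A\<close> of the component
  in row \<open>i\<close> and column \<open>j\<close> of the Maurer--Cartan form.
\<close>

definition maurer_cartan ::
  "(complex \<Rightarrow> complex^4^4) \<Rightarrow> 4 \<Rightarrow> 4 \<Rightarrow> complex \<Rightarrow> complex" where
  "maurer_cartan A i j x = (matrix_inv (A x) ** mat_deriv A x) $ i $ j"


section \<open>Curves in the Lagrangian Grassmannian and in projective space\<close>

text \<open>Linear subspaces are complex subspaces, i.e. subspaces for the scalar action \<open>(*s)\<close>.\<close>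

definition Q3 :: "(complex^4) set set" where
  "Q3 = {P. vec.subspace P \<and> vec.dim P = 2 \<and> (\<forall>x\<in>P. \<forall>y\<in>P. \<omega> x y = 0)}"

definition CP3 :: "(complex^4) set set" where
  "CP3 = {L. vec.subspace L \<and> vec.dim L = 1}"

text \<open>
  A holomorphic frame over \<open>(U, z)\<close> of a map \<open>f\<close> into the Grassmannian of \<open>k\<close>-planes
  (\<open>k = 2\<close> for \<open>Q3\<close>, \<open>k = 1\<close> for \<open>CP3\<close>): \<open>f = [u 0 \<and> \<dots> \<and> u (k - 1)]\<close>.
  The vectors are linearly independent since they span a space of dimension \<open>k\<close>.
\<close>

definition frame ::
  "nat \<Rightarrow> ('a \<Rightarrow> (complex^4) set) \<Rightarrow> 'a chart \<Rightarrow> (nat \<Rightarrow> complex \<Rightarrow> complex^4) \<Rightarrow> bool" where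
  "frame k f c u \<longleftrightarrow> (case c of (U, z) \<Rightarrow>
     (\<forall>i<k. vec_holomorphic_on (u i) (z ` U)) \<and>
     (\<forall>p\<in>U. vec.dim (f p) = k \<and> f p = vec.span ((\<lambda>i. u i (z p)) ` {..<k})))"

definition holomorphic_into ::
  "(complex^4) set set \<Rightarrow> nat \<Rightarrow> 'a topology \<Rightarrow> 'a chart set \<Rightarrow> ('a \<Rightarrow> (complex^4) set) \<Rightarrow> bool" where
  "holomorphic_into Y k X \<A> f \<longleftrightarrow>
     (\<forall>p\<in>topspace X. f p \<in> Y \<and> (\<exists>(U, z)\<in>\<A>. p \<in> U \<and> (\<exists>u. frame k f (U, z) u)))"

text \<open>
  The differential at \<open>p\<close> of a map into the Grassmannian is the linear map
  \<open>f p \<rightarrow> \<complex>\<^sup>4 / f p\<close> sending \<open>u i\<close> to the class of its derivative.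
\<close>

definition critical_point ::
  "nat \<Rightarrow> 'a chart set \<Rightarrow> ('a \<Rightarrow> (complex^4) set) \<Rightarrow> 'a \<Rightarrow> bool" where
  "critical_point k \<A> f p \<longleftrightarrow>
     (\<exists>(U, z)\<in>\<A>. p \<in> U \<and> (\<exists>u. frame k f (U, z) u \<and> (\<forall>i<k. vec_deriv (u i) (z p) \<in> f p)))"

text \<open>The plane \<open>[A\<^sub>1 \<and> A\<^sub>2]\<close> spanned by the first two columns.\<close>

definition plane_of :: "complex^4^4 \<Rightarrow> (complex^4) set" where
  "plane_of A = vec.span {A *v e 1, A *v e 2}"

definition sp_lift ::
  "('a \<Rightarrow> (complex^4) set) \<Rightarrow> 'a chart \<Rightarrow> (complex \<Rightarrow> complex^4^4) \<Rightarrow> bool" where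
  "sp_lift f c A \<longleftrightarrow> (case c of (U, z) \<Rightarrow>
     mat_holomorphic_on A (z ` U) \<and>
     (\<forall>p\<in>U. A (z p) \<in> Sp2 \<and> f p = plane_of (A (z p))))"

definition null_curve :: "'a chart set \<Rightarrow> ('a \<Rightarrow> (complex^4) set) \<Rightarrow> bool" where
  "null_curve \<A> f \<longleftrightarrow>
     (\<forall>(U, z)\<in>\<A>. \<forall>A. sp_lift f (U, z) A \<longrightarrow>
        (\<forall>x\<in>z ` U. maurer_cartan A 3 1 x * maurer_cartan A 4 2 x - (maurer_cartan A 4 1 x)^2 = 0))"

definition isotropic_curve ::
  "'a topology \<Rightarrow> 'a chart set \<Rightarrow> ('a \<Rightarrow> (complex^4) set) \<Rightarrow> bool" where
  "isotropic_curve X \<A> f \<longleftrightarrow>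
     riemann_surface X \<A> \<and> connected_space X \<and>
     holomorphic_into Q3 2 X \<A> f \<and>
     (\<exists>p\<in>topspace X. \<exists>q\<in>topspace X. f p \<noteq> f q) \<and>
     null_curve \<A> f \<and>
     \<not> (\<exists>\<xi>. \<xi> \<noteq> 0 \<and> (\<forall>p\<in>topspace X. \<xi> \<in> f p))"

definition mdot ::
  "(nat \<Rightarrow> complex \<Rightarrow> complex^4) \<Rightarrow> complex \<Rightarrow> nat \<Rightarrow> nat \<Rightarrow> complex" where
  "mdot u x i j = \<omega> (u i x) (vec_deriv (u j) x)"

definition legendre_associate ::
  "'a topology \<Rightarrow> 'a chart set \<Rightarrow> ('a \<Rightarrow> (complex^4) set) \<Rightarrow> ('a \<Rightarrow> (complex^4) set) \<Rightarrow> bool" where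
  "legendre_associate X \<A> f g \<longleftrightarrow>
     holomorphic_into CP3 1 X \<A> g \<and>
     (\<forall>(U, z)\<in>\<A>. \<forall>u. frame 2 f (U, z) u \<longrightarrow>
        (\<forall>p\<in>U. (\<exists>i<2. \<exists>j<2. mdot u (z p) i j \<noteq> 0) \<longrightarrow>
           (\<forall>x :: nat \<Rightarrow> complex. (x 0, x 1) \<noteq> (0, 0) \<longrightarrow>
              (\<forall>i<2. mdot u (z p) i 0 * x 0 + mdot u (z p) i 1 * x 1 = 0) \<longrightarrow>
              g p = vec.span {x 0 *s u 0 (z p) + x 1 *s u 1 (z p)})))"

text \<open>The regular part \<open>S\<^sub>\<star>\<close>, for a curve \<open>f\<close> with Legendre associate \<open>g\<close>.\<close>

definition S_star ::
  "'a topology \<Rightarrow> 'a chart set \<Rightarrow> ('a \<Rightarrow> (complex^4) set) \<Rightarrow> ('a \<Rightarrow> (complex^4) set) \<Rightarrow> 'a set" where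
  "S_star X \<A> f g =
     topspace X - ({p. critical_point 2 \<A> f p} \<union> {p. critical_point 1 \<A> g p})"


section \<open>The canonical reduction\<close>

definition cbrt :: "real \<Rightarrow> complex" where
  "cbrt r = complex_of_real (root 3 r)"

definition SL2_1 :: "(complex^2^2) set" where
  "SL2_1 = {g. det g = 1 \<and> g$2$1 = 0}"

text \<open>
  \<open>S\<^sup>3(\<complex>\<^sup>2)\<close> is realized as the space of polynomials of degree at most 3 in one variable:
  the symmetric product \<open>a\<^sub>1\<^sup>3\<^sup>-\<^sup>j a\<^sub>2\<^sup>j\<close> corresponds to \<open>monom 1 j\<close> (homogeneous cubic forms in
  \<open>a\<^sub>1, a\<^sub>2\<close>, dehomogenized by \<open>a\<^sub>1 = 1\<close>), and the vector \<open>v \<in> \<complex>\<^sup>2\<close> to \<open>[:v$1, v$2:]\<close>.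
\<close>

definition Sym3 :: "complex poly set" where
  "Sym3 = {p. degree p \<le> 3}"

definition sym3_act :: "complex^2^2 \<Rightarrow> complex poly \<Rightarrow> complex poly" where
  "sym3_act g p =
     (\<Sum>j\<le>3. smult (coeff p j) ([:g$1$1, g$2$1:] ^ (3 - j) * [:g$1$2, g$2$2:] ^ j))"

definition F_iso :: "complex poly \<Rightarrow> complex^4" where
  "F_iso p = coeff p 0 *s e 1 - (coeff p 1 * cbrt (2/9)) *s e 2
             + (coeff p 2 * cbrt (1/6)) *s e 4 + coeff p 3 *s e 3"

definition S_rep :: "complex^2^2 \<Rightarrow> complex^4^4" where
  "S_rep g = matrix (F_iso \<circ> sym3_act g \<circ> inv_into Sym3 F_iso)"

definition H1 :: "(complex^4^4) set" where
  "H1 = S_rep ` SL2_1"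

text \<open>
  A holomorphic local section over \<open>(U, z)\<close> of a subset \<open>R\<close> of the trivial bundle with
  fibre \<open>Sp2\<close>, \<open>p \<mapsto> (p, A (z p))\<close>.
\<close>

definition local_section ::
  "('a \<times> (complex^4^4)) set \<Rightarrow> 'a chart \<Rightarrow> (complex \<Rightarrow> complex^4^4) \<Rightarrow> bool" where
  "local_section R c A \<longleftrightarrow> (case c of (U, z) \<Rightarrow>
     mat_holomorphic_on A (z ` U) \<and> (\<forall>p\<in>U. (p, A (z p)) \<in> R))"

definition H1_reduction ::
  "'a chart set \<Rightarrow> 'a set \<Rightarrow> ('a \<Rightarrow> (complex^4) set) \<Rightarrow> ('a \<times> (complex^4^4)) set \<Rightarrow> bool" where
  "H1_reduction \<A> M f R \<longleftrightarrow>
     R \<subseteq> {(p, A). p \<in> M \<and> A \<in> Sp2 \<and> f p = plane_of A} \<and>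
     (\<forall>p\<in>M. \<exists>A. {B. (p, B) \<in> R} = (\<lambda>h. A ** h) ` H1) \<and>
     (\<forall>p\<in>M. \<exists>(U, z)\<in>\<A>. p \<in> U \<and> (\<exists>A. local_section R (U, z) A))"

text \<open>
  The forms below are those defining the canonical reduction. They all vanish on the Lie
  algebra of \<open>H1\<close>, hence on the vertical vectors of the reduction, so that conditions on
  their restrictions to \<open>R\<close> can be tested on pull-backs by local sections; the same applies
  to the quartic differential.
\<close>

definition canonical_reduction ::
  "'a topology \<Rightarrow> 'a chart set \<Rightarrow> ('a \<Rightarrow> (complex^4) set) \<Rightarrow> ('a \<times> (complex^4^4)) set \<Rightarrow> bool" where
  "canonical_reduction X \<A> f R \<longleftrightarrow>
     (\<exists>g. legendre_associate X \<A> f g \<and>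
          H1_reduction \<A> (S_star X \<A> f g) f R) \<and>
     (\<forall>(U, z)\<in>\<A>. \<forall>A. local_section R (U, z) A \<longrightarrow> (\<forall>x\<in>z ` U.
        let \<phi> = (\<lambda>i j. maurer_cartan A i j x) in
          \<phi> 3 1 = 0 \<and> \<phi> 4 1 = 0 \<and> \<phi> 2 1 - \<phi> 4 2 = 0 \<and> \<phi> 1 1 - 3 * \<phi> 2 2 = 0 \<and>
          4 * \<phi> 1 2 - 3 * \<phi> 2 4 = 0 \<and> \<phi> 1 4 = 0 \<and> \<phi> 4 2 \<noteq> 0))"

definition quartic_differential ::
  "'a chart set \<Rightarrow> ('a \<times> (complex^4^4)) set \<Rightarrow> 'a differential \<Rightarrow> bool" where
  "quartic_differential \<A> R \<delta> \<longleftrightarrow>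
     meromorphic_differential \<A> 4 \<delta> \<and>
     (\<forall>(U, z)\<in>\<A>. \<forall>A. local_section R (U, z) A \<longrightarrow>
        (\<forall>x\<in>z ` U. \<delta> (U, z) x = maurer_cartan A 1 3 x * (maurer_cartan A 4 2 x)^3))"


section \<open>Projective structure and bending\<close>

text \<open>
  \<open>mat_unit r s\<close> is the matrix unit with 1 in the place \<open>(r, s)\<close>. The form \<open>\<eta>\<close> is the Cartan
  connection on the reduction; \<open>eta_coeff A x\<close> is the coefficient of \<open>dx\<close> in its pull-back by
  the section \<open>A\<close>.
\<close>

definition mat_unit :: "2 \<Rightarrow> 2 \<Rightarrow> complex^2^2" where
  "mat_unit r s = (\<chi> i j. if i = r \<and> j = s then 1 else 0)"

definition eta_coeff :: "(complex \<Rightarrow> complex^4^4) \<Rightarrow> complex \<Rightarrow> complex^2^2" where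
  "eta_coeff A x = (\<chi> i j.
       maurer_cartan A 2 2 x * (mat_unit 1 1 - mat_unit 2 2)$i$j
     - inverse (cbrt 6) * maurer_cartan A 4 2 x * mat_unit 2 1$i$j
     - cbrt (3/32) * maurer_cartan A 2 4 x * mat_unit 1 2$i$j)"

text \<open>
  A holomorphic principal bundle with Cartan connection enters only through its local
  holomorphic sections over charts (\<open>sec c s\<close>: \<open>s\<close> is such a section over \<open>c\<close>) and the
  coefficient \<open>conn s\<close> of the pull-back of the connection by \<open>s\<close>.
\<close>

definition adapted_chart ::
  "('a chart \<Rightarrow> 's \<Rightarrow> bool) \<Rightarrow> ('s \<Rightarrow> complex \<Rightarrow> complex^2^2) \<Rightarrow> 'a chart \<Rightarrow> bool" where
  "adapted_chart sec conn c \<longleftrightarrow> (case c of (U, z) \<Rightarrow>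
     \<exists>s. sec (U, z) s \<and> (\<forall>x\<in>z ` U. conn s x = mat_unit 2 1))"

text \<open>\<open>frak_d \<A> sec conn \<delta> Q\<close> states that \<open>Q\<close> is the meromorphic quadratic differential \<open>\<dd>(\<delta>)\<close>.\<close>

definition frak_d ::
  "'a chart set \<Rightarrow> ('a chart \<Rightarrow> 's \<Rightarrow> bool) \<Rightarrow> ('s \<Rightarrow> complex \<Rightarrow> complex^2^2) \<Rightarrow>
   'a differential \<Rightarrow> 'a differential \<Rightarrow> bool" where
  "frak_d \<A> sec conn \<delta> Q \<longleftrightarrow>
     meromorphic_differential \<A> 2 Q \<and>
     (if zero_differential \<A> \<delta> then zero_differential \<A> Q
      else \<forall>(U, z)\<in>\<A>. adapted_chart sec conn (U, z) \<longrightarrow>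
        (let Z = \<delta> (U, z) in \<forall>\<^sub>\<approx>x\<in>z ` U.
           Q (U, z) x = (1/2) * (deriv (deriv Z) x / Z x) - (9/16) * ((deriv Z x)^2 / (Z x)^2)))"

definition constant_bending ::
  "'a topology \<Rightarrow> 'a chart set \<Rightarrow> ('a \<Rightarrow> (complex^4) set) \<Rightarrow> complex \<Rightarrow> bool" where
  "constant_bending X \<A> f \<kappa> \<longleftrightarrow>
     (\<exists>R \<delta> Q. canonical_reduction X \<A> f R \<and>
        quartic_differential \<A> R \<delta> \<and> \<not> zero_differential \<A> \<delta> \<and>
        frak_d \<A> (local_section R) eta_coeff \<delta> Q \<and>
        (\<forall>(U, z)\<in>\<A>. \<forall>\<^sub>\<approx>x\<in>z ` U. (Q (U, z) x)^2 / \<delta> (U, z) x = \<kappa>))"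

definition regular_type :: "complex \<Rightarrow> bool" where
  "regular_type \<kappa> \<longleftrightarrow> \<kappa> \<noteq> 1 \<and> \<kappa> \<noteq> - 16/9"


section \<open>The map r\<close>

text \<open>Both generators are involutions, so the monoid they generate is a group.\<close>

inductive_set D4 :: "(complex \<Rightarrow> complex) set" where
  "id \<in> D4"
| "g \<in> D4 \<Longrightarrow> inverse \<circ> g \<in> D4"
| "g \<in> D4 \<Longrightarrow> uminus \<circ> g \<in> D4"

definition D4_class :: "complex \<Rightarrow> complex set" where
  "D4_class z = (\<lambda>g. g z) ` D4"

definition Qdot_classes :: "complex set set" where
  "Qdot_classes = D4_class ` {z. z \<in> \<rat> \<and> z \<noteq> 0}"

definition r_map :: "complex \<Rightarrow> complex set" where
  "r_map \<kappa> = (let c = csqrt \<kappa>; d = csqrt (c^2 - 1)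
     in D4_class (csqrt ((5 * c - 4 * d) * inverse (5 * c + 4 * d))))"


section \<open>Isotropic W-curves and domination\<close>

text \<open>
  For a rational \<open>q > 1\<close>, \<open>quotient_of q\<close> is the pair \<open>(m, n)\<close> of coprime positive integers
  with \<open>q = m / n\<close>. The exponent \<open>(m + n) (1 + \<epsilon>) / 2\<close> is an integer, so \<open>div\<close> is exact.
\<close>

definition v_vec :: "nat \<Rightarrow> nat \<Rightarrow> nat \<Rightarrow> complex \<Rightarrow> complex^4" where
  "v_vec m n \<epsilon> z =
     (of_nat m - of_nat n) *s e 1
     - ((of_nat m + of_nat n) * z ^ ((1 + \<epsilon>) * m)) *s e 3
     - (2 * \<i> * of_real (sqrt (real (m * n))) * z ^ ((m + n) * (1 + \<epsilon>) div 2)) *s e 4"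

definition w_vec :: "nat \<Rightarrow> nat \<Rightarrow> nat \<Rightarrow> complex \<Rightarrow> complex^4" where
  "w_vec m n \<epsilon> z =
     (of_nat m - of_nat n) *s e 2
     - (2 * \<i> * of_real (sqrt (real (m * n))) * z ^ ((m + n) * (1 + \<epsilon>) div 2)) *s e 3
     + ((of_nat m + of_nat n) * z ^ (n * (1 + \<epsilon>))) *s e 4"

definition W_curve :: "rat \<Rightarrow> complex option \<Rightarrow> (complex^4) set" where
  "W_curve q p =
     (let m = nat (fst (quotient_of q)); n = nat (snd (quotient_of q)); \<epsilon> = (m + n) mod 2
      in case p of
           None \<Rightarrow> vec.span {e 3, e 4}
         | Some z \<Rightarrow> vec.span {v_vec m n \<epsilon> z, w_vec m n \<epsilon> z})"

definition dominated ::
  "'a topology \<Rightarrow> 'a chart set \<Rightarrow> ('a \<Rightarrow> (complex^4) set) \<Rightarrow>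
   'b chart set \<Rightarrow> ('b \<Rightarrow> (complex^4) set) \<Rightarrow> bool" where
  "dominated X \<A> f \<B> g \<longleftrightarrow>
     (\<exists>h M. holomorphic_map X \<A> \<B> h \<and> M \<in> Sp2 \<and>
        (\<forall>p\<in>topspace X. f p = (\<lambda>v. M *v v) ` g (h p)))"

end

theory Submission
  imports Defs
begin

text \<open>
  An adapted section of the canonical reduction consists of a vector function \<open>y\<close> solving
  \<open>y'''' + Z y = 0\<close> and of its derivatives, up to constant factors and order. Constant bending means
  that, in a parameter \<open>\<zeta>\<close> with \<open>\<delta>\<close> proportional to \<open>d\<zeta>\<^sup>4\<close> and after rescaling \<open>y\<close>, this equation has
  constant coefficients, with characteristic polynomial \<open>x\<^sup>4 + 10 p x\<^sup>2 + 9 p\<^sup>2 + 1\<close> and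
  \<open>\<kappa> = 16 p\<^sup>2\<close>. Let \<open>\<plusminus>l\<close>, \<open>\<plusminus>k\<close> be its roots. The exponentials \<open>exp ((l \<plusminus> k) \<zeta>)\<close> are quotients of
  Plucker coordinates of \<open>f\<close>, and therefore extend to meromorphic functions on \<open>S\<close>. On a
  compact surface such a function has a pole, and comparing the residues of the two logarithmic
  derivatives there shows that \<open>l / k\<close> is rational. In the exceptional cases a root is multiple; then
  \<open>\<zeta>\<close> and a nonconstant \<open>exp (c \<zeta>)\<close> would both be meromorphic on \<open>S\<close>, but \<open>c d\<zeta>\<close> has zero residues,
  unlike the logarithmic derivative of a function with a pole. If \<open>l / k = m / n\<close>, a suitable
  product of powers of the two exponentials is the map \<open>h\<close> of the domination: the identity \<open>f = X \<cdot> f\<^sub>q \<circ> h\<close> holds in one chart by solving the equation and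
  everywhere by the identity theorem.
\<close>

text \<open>The reduction and the equation exist only where neither \<open>f\<close> nor its
  Legendre associate is critical. So that regular part has to be shown nonempty, or constant bending
  would say nothing; and whatever is global has to be read off from the planes \<open>f p\<close>
  themselves. Quotients of Plucker coordinates are the bridge: they are single valued and
  meromorphic on all of \<open>S\<close>, whereas \<open>\<zeta>\<close>, the frames and the
  exponentials are found on one disc. A Plucker coordinate pairs a plane with two constant vectors
  and so multiplies two exponentials; hence exponents that are sums of two roots. The squares of the
  roots are \<open>- 5 p + d\<close> and \<open>- 5 p - d\<close> with
  \<open>d\<^sup>2 = 16 p\<^sup>2 - 1\<close>. They coincide exactly for
  \<open>\<kappa> = 1\<close>, and one of them vanishes exactly for
  \<open>\<kappa> = - 16/9\<close>; up to inversion, their quotient is the radicand in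
  \<open>r_map\<close>. The exponents \<open>l + k\<close> and \<open>l - k\<close> are
  \<open>(m + n) c\<close> and \<open>(m - n) c\<close>; the greatest common divisor of
  \<open>m + n\<close> and \<open>m - n\<close> depends on parity, which explains the number
  \<open>\<epsilon>\<close> in the W-curves.\<close>

no_notation fps_nth (infixl "$" 75)

section \<open>Charts\<close>

locale riemann =
  fixes X :: "'a topology" and \<A> :: "'a chart set"
  assumes riemann: "riemann_surface X \<A>"
begin

lemma chartD:
  assumes "(U, z) \<in> \<A>"
  shows "openin X U" "U \<subseteq> topspace X" "open (z ` U)" "inj_on z U"
    "continuous_map (subtopology X U) euclidean z"
    "homeomorphic_map (subtopology X U) (top_of_set (z ` U)) z"
proof -
  have "complex_chart X (U, z)"
    using riemann assms unfolding riemann_surface_def by blast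
  then show *: "openin X U" "open (z ` U)" and
    hom: "homeomorphic_map (subtopology X U) (top_of_set (z ` U)) z"
    by (auto simp: complex_chart_def)
  show U: "U \<subseteq> topspace X" using * openin_subset by blast
  show "inj_on z U"
    using homeomorphic_imp_injective_map[OF hom] U by (simp add: inf.absorb2)
  show "continuous_map (subtopology X U) euclidean z"
    using homeomorphic_imp_continuous_map[OF hom] continuous_map_in_subtopology by blast
qed

lemma ex_chart: "p \<in> topspace X \<Longrightarrow> \<exists>U z. (U, z) \<in> \<A> \<and> p \<in> U"
proof -
  assume "p \<in> topspace X"
  moreover have "(\<Union>(U, z)\<in>\<A>. U) = topspace X"
    using riemann by (simp add: riemann_surface_def)
  ultimately show ?thesis by blast
qed

lemma inv_chart [simp]: "(U, z) \<in> \<A> \<Longrightarrow> p \<in> U \<Longrightarrow> inv_into U z (z p) = p"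
  by (rule inv_into_f_f[OF chartD(4)])

lemma open_chart_image:
  assumes "(U, z) \<in> \<A>" "openin X W" "W \<subseteq> U"
  shows "open (z ` W)"
proof -
  have "openin (subtopology X U) W"
    using assms by (metis inf.absorb2 openin_subtopology_Int inf_commute)
  moreover have "W \<subseteq> topspace (subtopology X U)"
    using assms chartD(2) by (auto simp: topspace_subtopology)
  ultimately have "openin (top_of_set (z ` U)) (z ` W)"
    using homeomorphic_map_openness[OF chartD(6)[OF assms(1)]] by blast
  then show ?thesis using chartD(3)[OF assms(1)] openin_open_eq by blast
qed

lemma open_chart_preimage:
  assumes "(U, z) \<in> \<A>" "open B"
  shows "openin X {p \<in> U. z p \<in> B}"
proof -
  have "openin (subtopology X U) {p \<in> topspace (subtopology X U). z p \<in> B}"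
    using openin_continuous_map_preimage[OF chartD(5)[OF assms(1)]] assms(2) by auto
  moreover have "topspace (subtopology X U) = U"
    using chartD(2)[OF assms(1)] by (auto simp: topspace_subtopology)
  ultimately show ?thesis
    using chartD(1)[OF assms(1)] openin_trans_full by fastforce
qed

lemma compatibleD:
  assumes "(U, z) \<in> \<A>" "(V, w) \<in> \<A>"
  shows "(z \<circ> inv_into V w) holomorphic_on w ` (U \<inter> V)"
proof -
  have "compatible (U, z) (V, w)"
    using riemann assms unfolding riemann_surface_def by blast
  then show ?thesis by (simp add: compatible_def transition_def)
qed

text \<open>Maximality of the atlas admits the new chart: it only has to be compatible with every
  old one in both directions, and the holomorphic inverse \<open>g\<close> of \<open>\<psi>\<close>
  serves for the second. Both special coordinates of the proof, the adapted one and
  \<open>\<zeta>\<close>, are introduced this way.\<close>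

lemma chart_change:
  assumes UA: "(U, z) \<in> \<A>" and W: "openin X W" "W \<subseteq> U"
    and \<psi>: "\<psi> holomorphic_on z ` W" "inj_on \<psi> (z ` W)"
  shows "(W, \<psi> \<circ> z) \<in> \<A>"
proof -
  have op: "open (z ` W)" by (rule open_chart_image[OF UA W])
  obtain g where g: "g holomorphic_on (\<psi> ` z ` W)"
      "\<And>x. x \<in> z ` W \<Longrightarrow> deriv \<psi> x * deriv g (\<psi> x) = 1" "\<And>x. x \<in> z ` W \<Longrightarrow> g (\<psi> x) = x"
    using holomorphic_has_inverse[OF \<psi>(1) op \<psi>(2)] by metis
  have injz: "inj_on z U" by (rule chartD(4)[OF UA])
  have inj: "inj_on (\<psi> \<circ> z) W"
    using injz \<psi>(2) W by (meson comp_inj_on inj_on_subset)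
  have open2: "open (\<psi> ` z ` W)" by (rule open_mapping_thm3[OF \<psi>(1) op \<psi>(2)])
  have "homeomorphic_map (subtopology (subtopology X U) W) (subtopology (top_of_set (z ` U)) (z ` W)) z"
    by (rule homeomorphic_map_subtopologies[OF chartD(6)[OF UA]])
      (use W chartD(2)[OF UA] in \<open>auto simp: topspace_subtopology\<close>)
  then have h1: "homeomorphic_map (subtopology X W) (top_of_set (z ` W)) z"
    using W by (metis image_mono inf.absorb2 subtopology_subtopology)
  have h2: "homeomorphic_map (top_of_set (z ` W)) (top_of_set (\<psi> ` z ` W)) \<psi>"
    unfolding homeomorphic_map_maps
    by (rule exI[of _ g])
      (use g \<psi> in \<open>auto simp: homeomorphic_maps_def holomorphic_on_imp_continuous_on\<close>)
  have cc: "complex_chart X (W, \<psi> \<circ> z)"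
    using W open2 homeomorphic_map_compose[OF h1 h2]
    by (simp add: complex_chart_def image_comp)
  have "compatible (W, \<psi> \<circ> z) (V, w)" if V: "(V, w) \<in> \<A>" for V w
  proof -
    have invw: "inv_into V w (w p) = p" if "p \<in> V" for p using V that by simp
    have "(\<psi> \<circ> (z \<circ> inv_into V w)) holomorphic_on w ` (W \<inter> V)"
    proof (rule holomorphic_on_compose_gen[OF _ \<psi>(1)])
      show "(z \<circ> inv_into V w) holomorphic_on w ` (W \<inter> V)"
        by (rule holomorphic_on_subset[OF compatibleD[OF UA V]]) (use W in auto)
      show "(z \<circ> inv_into V w) ` w ` (W \<inter> V) \<subseteq> z ` W"
        using invw by auto
    qed
    moreover have "((w \<circ> inv_into U z) \<circ> g) holomorphic_on (\<psi> \<circ> z) ` (W \<inter> V)"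
    proof (rule holomorphic_on_compose_gen)
      show "(w \<circ> inv_into U z) holomorphic_on z ` (V \<inter> U)" by (rule compatibleD[OF V UA])
      show "g holomorphic_on (\<psi> \<circ> z) ` (W \<inter> V)"
        by (rule holomorphic_on_subset[OF g(1)]) auto
      show "g ` (\<psi> \<circ> z) ` (W \<inter> V) \<subseteq> z ` (V \<inter> U)"
      proof
        fix x assume "x \<in> g ` (\<psi> \<circ> z) ` (W \<inter> V)"
        then obtain p where "p \<in> W" "p \<in> V" "x = g (\<psi> (z p))" by auto
        then show "x \<in> z ` (V \<inter> U)" using g(3)[of "z p"] W by auto
      qed
    qed
    then have "(w \<circ> inv_into W (\<psi> \<circ> z)) holomorphic_on (\<psi> \<circ> z) ` (W \<inter> V)"
    proof (rule holomorphic_transform)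
      fix x assume "x \<in> (\<psi> \<circ> z) ` (W \<inter> V)"
      then obtain p where p: "p \<in> W" "x = \<psi> (z p)" by auto
      then have "inv_into W (\<psi> \<circ> z) x = p" using inj by (metis comp_apply inv_into_f_f)
      moreover have "inv_into U z (g x) = p" using p g(3) UA W by auto
      ultimately show "((w \<circ> inv_into U z) \<circ> g) x = (w \<circ> inv_into W (\<psi> \<circ> z)) x" by simp
    qed
    ultimately show ?thesis by (simp add: compatible_def transition_def comp_assoc)
  qed
  then show ?thesis
    using cc riemann unfolding riemann_surface_def by auto
qed

lemma subchart: "(U, z) \<in> \<A> \<Longrightarrow> openin X W \<Longrightarrow> W \<subseteq> U \<Longrightarrow> (W, z) \<in> \<A>"
  using chart_change[of U z W id] by auto

text \<open>Discs are the working domains: on them holomorphic functions have primitives, nowhere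
  vanishing ones have logarithms, and the identity theorem applies.\<close>

lemma ball_chart:
  assumes "(U, z) \<in> \<A>" "p \<in> U" "openin X W" "p \<in> W"
  obtains V r where "(V, z) \<in> \<A>" "p \<in> V" "V \<subseteq> U" "V \<subseteq> W" "r > 0" "z ` V = ball (z p) r"
proof -
  have o: "openin X (U \<inter> W)" using assms chartD(1) by auto
  then have "open (z ` (U \<inter> W))" using open_chart_image assms(1) by auto
  then obtain r where r: "r > 0" "ball (z p) r \<subseteq> z ` (U \<inter> W)"
    using assms open_contains_ball by blast
  define V where "V = {q \<in> U. z q \<in> ball (z p) r}"
  have "V \<subseteq> U \<inter> W"
    using r chartD(4)[OF assms(1)] by (auto simp: V_def inj_on_def subset_iff image_iff)
  moreover have "openin X V" unfolding V_def by (rule open_chart_preimage) (use assms in auto)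
  moreover have "z ` V = ball (z p) r" using r by (auto simp: V_def)
  ultimately show ?thesis
    using that[of V r] subchart[OF assms(1)] assms r by (auto simp: V_def)
qed

lemma ball_chart_in:
  assumes "(U, z) \<in> \<A>" "x \<in> B" "open B" "B \<subseteq> z ` U"
  obtains V r where "(V, z) \<in> \<A>" "V \<subseteq> U" "r > 0" "z ` V = ball x r" "ball x r \<subseteq> B"
    "inv_into U z x \<in> V" "z (inv_into U z x) = x"
proof -
  let ?p = "inv_into U z x"
  have p: "?p \<in> U" "z ?p = x" using assms by (auto intro: inv_into_into f_inv_into_f)
  have "openin X {q \<in> U. z q \<in> B}" using open_chart_preimage assms by blast
  then obtain V r where V: "(V, z) \<in> \<A>" "?p \<in> V" "V \<subseteq> U" "V \<subseteq> {q \<in> U. z q \<in> B}" "r > 0"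
    "z ` V = ball (z ?p) r"
    using ball_chart[OF assms(1), of ?p "{q \<in> U. z q \<in> B}"] p assms by auto
  show ?thesis
  proof (rule that[OF V(1,3,5)])
    show "z ` V = ball x r" using V(6) p by simp
    have "z ` V \<subseteq> B" using V(4) by blast
    then show "ball x r \<subseteq> B" using V(6) p by simp
    show "inv_into U z x \<in> V" by (rule V(2))
    show "z (inv_into U z x) = x" by (rule p(2))
  qed
qed

lemma transition_eq [simp]:
  assumes "(V, w) \<in> \<A>" "p \<in> V"
  shows "transition (U, z) (V, w) (w p) = z p"
  using assms by (simp add: transition_def)

lemma transition_holomorphic:
  assumes "(U, z) \<in> \<A>" "(V, w) \<in> \<A>"
  shows "transition (U, z) (V, w) holomorphic_on w ` (U \<inter> V)"
  using compatibleD[OF assms] by (simp add: transition_def)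

lemma open_overlap: "(U, z) \<in> \<A> \<Longrightarrow> (V, w) \<in> \<A> \<Longrightarrow> open (w ` (U \<inter> V))"
  by (metis chartD(1) inf_le2 open_chart_image openin_Int)

lemma inj_transition:
  assumes "(U, z) \<in> \<A>" "(V, w) \<in> \<A>"
  shows "inj_on (transition (U, z) (V, w)) (w ` (U \<inter> V))"
  using transition_eq[OF assms(2), of _ U z] chartD(4)[OF assms(1)] by (auto simp: inj_on_def)

lemma transition_DERIV:
  assumes "(U, z) \<in> \<A>" "(V, w) \<in> \<A>" "x \<in> w ` (U \<inter> V)"
  shows "(transition (U, z) (V, w) has_field_derivative deriv (transition (U, z) (V, w)) x) (at x)"
  using holomorphic_derivI[OF transition_holomorphic open_overlap] assms by blast

text \<open>Injectivity keeps nearby points away from the centre of the target. Meromorphic data,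
  whose values on sparse sets are arbitrary, can be transferred between charts only in this
  punctured form.\<close>

lemma transition_filterlim:
  assumes "(U, z) \<in> \<A>" "(V, w) \<in> \<A>" "x \<in> w ` (U \<inter> V)"
  shows "filterlim (transition (U, z) (V, w)) (at (transition (U, z) (V, w) x)) (at x)"
proof -
  let ?T = "transition (U, z) (V, w)"
  have "?T \<midarrow>x\<rightarrow> ?T x"
    using transition_DERIV[OF assms] DERIV_isCont isContD by blast
  moreover have "eventually (\<lambda>y. y \<in> w ` (U \<inter> V) - {x}) (at x)"
    using eventually_at_in_open[OF open_overlap[OF assms(1,2)] assms(3)] .
  then have "eventually (\<lambda>y. ?T y \<noteq> ?T x) (at x)"
    by eventually_elim (use inj_transition[OF assms(1,2)] assms(3) in \<open>auto simp: inj_on_def\<close>)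
  ultimately show ?thesis by (simp add: filterlim_at)
qed

end

section \<open>Identity theorems on a connected Riemann surface\<close>

lemma holomorphic_zero_continuation:
  assumes "\<phi> holomorphic_on S" "open S" "connected S" "open W" "W \<noteq> {}" "W \<subseteq> S"
    and "\<And>y. y \<in> W \<Longrightarrow> \<phi> y = 0" and "x \<in> S"
  shows "\<phi> x = 0"
  using analytic_continuation_open[where f = \<phi> and g = "\<lambda>_. 0" and s = W and s' = S and z = x] assms
  by auto

locale connected_riemann = riemann +
  assumes conn: "connected_space X"
begin

text \<open>The hypothesis \<open>step\<close> makes the complement of \<open>T\<close> open as
  well, so \<open>T\<close> is clopen.\<close>

lemma continuation:
  assumes T: "openin X T" "T \<noteq> {}"
    and step: "\<And>p. p \<in> topspace X \<Longrightarrow> \<exists>U. openin X U \<and> p \<in> U \<and> (U \<inter> T \<noteq> {} \<longrightarrow> U \<subseteq> T)"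
  shows "T = topspace X"
proof -
  have "openin X (topspace X - T)"
  proof (subst openin_subopen, rule ballI)
    fix p assume p: "p \<in> topspace X - T"
    obtain U where U: "openin X U" "p \<in> U" "U \<inter> T \<noteq> {} \<longrightarrow> U \<subseteq> T"
      using step p by blast
    then have "U \<subseteq> topspace X - T" using p openin_subset by blast
    then show "\<exists>V. openin X V \<and> p \<in> V \<and> V \<subseteq> topspace X - T" using U by blast
  qed
  then have "closedin X T"
    using T openin_subset by (auto simp: closedin_def)
  with T conn show ?thesis unfolding connected_space_clopen_in by blast
qed

text \<open>The interior of \<open>T\<close> is clopen: if a connected coordinate domain meets it,
  every local defining function vanishes on an open set and hence on the whole domain. The family
  \<open>\<Phi>\<close> may vary from point to point.\<close>

lemma analytic_set_everywhere:
  assumes W: "openin X W" "W \<noteq> {}" "W \<subseteq> T"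
    and loc: "\<And>p. p \<in> topspace X \<Longrightarrow> \<exists>U z \<Phi>. (U, z) \<in> \<A> \<and> p \<in> U \<and> connected (z ` U) \<and>
       (\<forall>\<phi>\<in>\<Phi>. \<phi> holomorphic_on z ` U) \<and> (\<forall>q\<in>U. q \<in> T \<longleftrightarrow> (\<forall>\<phi>\<in>\<Phi>. \<phi> (z q) = 0))"
  shows "topspace X \<subseteq> T"
proof -
  define T' where "T' = X interior_of T"
  have "T' = topspace X"
  proof (rule continuation)
    show "openin X T'" by (simp add: T'_def)
    show "T' \<noteq> {}" using W interior_of_maximal unfolding T'_def by blast
    fix p assume "p \<in> topspace X"
    then obtain U z \<Phi> where U: "(U, z) \<in> \<A>" "p \<in> U" "connected (z ` U)"
       "\<forall>\<phi>\<in>\<Phi>. \<phi> holomorphic_on z ` U" "\<forall>q\<in>U. q \<in> T \<longleftrightarrow> (\<forall>\<phi>\<in>\<Phi>. \<phi> (z q) = 0)"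
      using loc by blast
    have "U \<subseteq> T'" if ne: "U \<inter> T' \<noteq> {}"
    proof -
      have o: "openin X (U \<inter> T')" using chartD(1)[OF U(1)] by (simp add: T'_def openin_Int)
      then have oz: "open (z ` (U \<inter> T'))" using open_chart_image U(1) by blast
      have "\<phi> x = 0" if \<phi>: "\<phi> \<in> \<Phi>" and x: "x \<in> z ` U" for \<phi> x
      proof (rule holomorphic_zero_continuation[OF _ chartD(3)[OF U(1)] U(3) oz _ _ _ x])
        show "\<phi> holomorphic_on z ` U" using U(4) \<phi> by blast
        show "z ` (U \<inter> T') \<noteq> {}" using ne by blast
        show "z ` (U \<inter> T') \<subseteq> z ` U" by blast
        fix y assume "y \<in> z ` (U \<inter> T')"
        then obtain q where "q \<in> U" "q \<in> T" "y = z q"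
          using interior_of_subset[of X T] unfolding T'_def by blast
        then show "\<phi> y = 0" using U(5) \<phi> by blast
      qed
      then have "U \<subseteq> T" using U(5) by auto
      then show ?thesis unfolding T'_def using interior_of_maximal chartD(1)[OF U(1)] by blast
    qed
    then show "\<exists>U. openin X U \<and> p \<in> U \<and> (U \<inter> T' \<noteq> {} \<longrightarrow> U \<subseteq> T')"
      using U(2) chartD(1)[OF U(1)] by (intro exI[of _ U] conjI impI)
  qed
  then show ?thesis using interior_of_subset[of X T] by (auto simp: T'_def)
qed

lemma differential_zero_transfer:
  assumes \<delta>: "meromorphic_differential \<A> n \<delta>"
    and U: "(U, z) \<in> \<A>" "p \<in> U" and V: "(V, w) \<in> \<A>" "p \<in> V"
    and ev: "eventually (\<lambda>x. \<delta> (U, z) x = 0) (at (z p))"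
  shows "eventually (\<lambda>x. \<delta> (V, w) x = 0) (at (w p))"
proof -
  let ?T = "transition (U, z) (V, w)"
  have wp: "w p \<in> w ` (U \<inter> V)" using U V by auto
  have "\<forall>\<^sub>\<approx>x\<in>w ` (U \<inter> V). \<delta> (V, w) x = \<delta> (U, z) (?T x) * deriv ?T x ^ n"
    using \<delta> U V by (auto simp: meromorphic_differential_def)
  then have "eventually (\<lambda>x. \<delta> (V, w) x = \<delta> (U, z) (?T x) * deriv ?T x ^ n) (at (w p))"
    using eventually_cosparse_open_eq[OF open_overlap[OF U(1) V(1)]] wp by blast
  moreover have "eventually (\<lambda>x. \<delta> (U, z) (?T x) = 0) (at (w p))"
    using transition_filterlim[OF U(1) V(1) wp] ev V transition_eq[OF V, of U z]
    by (auto dest: eventually_compose_filterlim)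
  ultimately show ?thesis by eventually_elim auto
qed

text \<open>The germ condition \<open>Z\<close> is independent of the chart. On a disc it holds at
  all points or at none, since a meromorphic function there is zero, or nonzero, off a sparse set.
  So it spreads over the connected surface, and a relation between meromorphic forms need be
  verified in one chart only.\<close>

lemma zero_differentialI:
  assumes \<delta>: "meromorphic_differential \<A> n \<delta>"
    and U: "(U, z) \<in> \<A>" "p \<in> U" and ev: "eventually (\<lambda>x. \<delta> (U, z) x = 0) (at (z p))"
  shows "zero_differential \<A> \<delta>"
proof -
  define Z where "Z = (\<lambda>q. \<forall>(V, w)\<in>\<A>. q \<in> V \<longrightarrow> eventually (\<lambda>x. \<delta> (V, w) x = 0) (at (w q)))"
  have ZI: "Z q" if "(V, w) \<in> \<A>" "q \<in> V" "eventually (\<lambda>x. \<delta> (V, w) x = 0) (at (w q))" for V w q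
    unfolding Z_def using differential_zero_transfer[OF \<delta> that(1,2) _ _ that(3)] by blast
  have propagate: "\<exists>V. openin X V \<and> q \<in> V \<and> (\<forall>q'\<in>V. Z q' \<longrightarrow> (\<forall>q''\<in>V. Z q''))"
    if q: "q \<in> topspace X" for q
  proof -
    obtain V0 w where V0: "(V0, w) \<in> \<A>" "q \<in> V0" using ex_chart[OF q] by auto
    obtain V r where V: "(V, w) \<in> \<A>" "q \<in> V" "w ` V = ball (w q) r"
      using ball_chart[OF V0 chartD(1)[OF V0(1)] V0(2)] by metis
    have mero: "\<delta> (V, w) meromorphic_on w ` V"
      using \<delta> V by (auto simp: meromorphic_differential_def)
    have conn: "connected (w ` V)" "open (w ` V)" using V by auto
    have "Z q''" if q': "q' \<in> V" "q'' \<in> V" "Z q'" for q' q''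
    proof -
      have ev0: "eventually (\<lambda>x. \<delta> (V, w) x = 0) (at (w q'))"
        using q' V unfolding Z_def by blast
      have "\<not> (\<forall>\<^sub>\<approx>x\<in>w ` V. \<delta> (V, w) x \<noteq> 0)"
      proof
        assume "\<forall>\<^sub>\<approx>x\<in>w ` V. \<delta> (V, w) x \<noteq> 0"
        then have "eventually (\<lambda>x. \<delta> (V, w) x \<noteq> 0) (at (w q'))"
          using q'(1) eventually_cosparse_open_eq[OF conn(2)] by blast
        with ev0
        have "eventually (\<lambda>_. False) (at (w q'))" by eventually_elim simp
        then show False by simp
      qed
      then have "\<forall>\<^sub>\<approx>x\<in>w ` V. \<delta> (V, w) x = 0"
        using meromorphic_imp_constant_or_avoid[OF mero conn(2,1), of 0] by auto
      then have "eventually (\<lambda>x. \<delta> (V, w) x = 0) (at (w q''))"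
        using q'(2) eventually_cosparse_open_eq[OF conn(2)] by blast
      then show ?thesis using ZI[OF V(1) q'(2)] by blast
    qed
    then show ?thesis using V chartD(1)[OF V(1)] by meson
  qed
  define T where "T = {q \<in> topspace X. Z q}"
  have Tsub: "V \<subseteq> T" if "openin X V" "\<forall>q'\<in>V. Z q' \<longrightarrow> (\<forall>q''\<in>V. Z q'')" "q' \<in> V" "q' \<in> T" for V q'
  proof
    fix q'' assume "q'' \<in> V"
    then show "q'' \<in> T" using that openin_subset[OF that(1)] by (auto simp: T_def)
  qed
  have "T = topspace X"
  proof (rule continuation)
    have "p \<in> T" using ZI[OF U ev] U chartD(2)[OF U(1)] by (auto simp: T_def)
    then show "T \<noteq> {}" by blast
    show "openin X T"
    proof (subst openin_subopen, rule ballI)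
      fix q assume q: "q \<in> T"
      then obtain V where V: "openin X V" "q \<in> V" "\<forall>q'\<in>V. Z q' \<longrightarrow> (\<forall>q''\<in>V. Z q'')"
        using propagate[of q] by (auto simp: T_def)
      show "\<exists>V. openin X V \<and> q \<in> V \<and> V \<subseteq> T"
        using Tsub[OF V(1,3,2) q] V(1,2) by (intro exI[of _ V] conjI)
    qed
    fix q assume "q \<in> topspace X"
    then obtain V where V: "openin X V" "q \<in> V" "\<forall>q'\<in>V. Z q' \<longrightarrow> (\<forall>q''\<in>V. Z q'')"
      using propagate[of q] by auto
    have "V \<inter> T \<noteq> {} \<longrightarrow> V \<subseteq> T" using Tsub[OF V(1,3)] by blast
    then show "\<exists>V. openin X V \<and> q \<in> V \<and> (V \<inter> T \<noteq> {} \<longrightarrow> V \<subseteq> T)"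
      using V(1,2) by (intro exI[of _ V] conjI)
  qed
  then have Z: "Z q" if "q \<in> topspace X" for q using that by (auto simp: T_def)
  have "\<forall>\<^sub>\<approx>x\<in>w ` V. \<delta> (V, w) x = 0" if V: "(V, w) \<in> \<A>" for V w
  proof -
    have "\<forall>\<^sub>F x in at (w q). \<delta> (V, w) x = 0" if "q \<in> V" for q
      using Z[of q] chartD(2)[OF V] V that unfolding Z_def by blast
    then show ?thesis using eventually_cosparse_open_eq[OF chartD(3)[OF V]] by blast
  qed
  then show ?thesis unfolding zero_differential_def by blast
qed

end

section \<open>Symplectic linear algebra\<close>

lemma \<omega>_simps [simp]:
  "\<omega> (x + y) v = \<omega> x v + \<omega> y v" "\<omega> v (x + y) = \<omega> v x + \<omega> v y"
  "\<omega> (x - y) v = \<omega> x v - \<omega> y v" "\<omega> v (x - y) = \<omega> v x - \<omega> v y"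
  "\<omega> (c *s x) v = c * \<omega> x v" "\<omega> v (c *s x) = c * \<omega> v x"
  "\<omega> (- x) v = - \<omega> x v" "\<omega> v (- x) = - \<omega> v x"
  "\<omega> x x = 0" "\<omega> 0 x = 0" "\<omega> x 0 = 0"
  by (simp_all add: \<omega>_def algebra_simps)

lemma \<omega>_commute: "\<omega> x y = - \<omega> y x"
  by (simp add: \<omega>_def algebra_simps)

lemma \<omega>_nondegenerate:
  assumes "\<And>y. \<omega> x y = 0"
  shows "x = 0"
proof -
  have "\<omega> x (e 1) = 0" "\<omega> x (e 2) = 0" "\<omega> x (e 3) = 0" "\<omega> x (e 4) = 0"
    using assms by auto
  then show ?thesis
    by (simp add: \<omega>_def vec_eq_iff forall_4 axis_def)
qed

text \<open>Stated by coefficients rather than by independence of the set \<open>{a, b}\<close>,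
  which would collapse to a singleton for \<open>a = b\<close>.\<close>

definition indep2 :: "complex^4 \<Rightarrow> complex^4 \<Rightarrow> bool" where
  "indep2 a b \<longleftrightarrow> (\<forall>s t. s *s a + t *s b = 0 \<longrightarrow> s = 0 \<and> t = 0)"

lemma indep2D: "indep2 a b \<Longrightarrow> s *s a + t *s b = 0 \<Longrightarrow> s = 0 \<and> t = 0"
  by (auto simp: indep2_def)

lemma in_span2: "x \<in> vec.span {a, b} \<longleftrightarrow> (\<exists>s t. x = s *s a + t *s (b :: complex^4))"
proof -
  have "x \<in> vec.span {a, b} \<longleftrightarrow> (\<exists>s. x - s *s a \<in> vec.span {b})"
    by (rule vec.span_insert[THEN eqset_imp_iff, simplified])
  also have "\<dots> \<longleftrightarrow> (\<exists>s t. x - s *s a = t *s b)"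
    by (auto simp: vec.span_singleton)
  finally show ?thesis by (simp add: diff_eq_eq add.commute)
qed

lemma indep2_iff: "indep2 a b \<longleftrightarrow> a \<noteq> b \<and> vec.independent {a, b}"
proof
  assume *: "indep2 a b"
  have b: "b \<noteq> 0" using indep2D[OF *, of 0 1] by auto
  have "\<not> (\<exists>t. a = t *s b)"
    using indep2D[OF *, of 1] by (metis add.right_inverse one_neq_zero vec.scale_minus_left vec.scale_one)
  then have "a \<notin> vec.span {b}" by (auto simp: vec.span_singleton)
  then show "a \<noteq> b \<and> vec.independent {a, b}"
    using b vec.independent_insert[of a "{b}"] vec.span_base[of b "{b}"] by auto
next
  assume *: "a \<noteq> b \<and> vec.independent {a, b}"
  then have a: "a \<notin> vec.span {b}" "b \<noteq> 0"
    using vec.independent_insert[of a "{b}"] by auto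
  show "indep2 a b"
    unfolding indep2_def
  proof (intro allI impI)
    fix s t assume st: "s *s a + t *s b = 0"
    have "s = 0"
    proof (rule ccontr)
      assume "s \<noteq> 0"
      have "s *s a = (- t) *s b" using st by (simp add: eq_neg_iff_add_eq_0)
      then have "inverse s *s (s *s a) = inverse s *s ((- t) *s b)" by simp
      then have "a = (inverse s * (- t)) *s b" using \<open>s \<noteq> 0\<close> by simp
      then show False using a by (metis rangeI vec.span_singleton)
    qed
    then show "s = 0 \<and> t = 0" using st a by simp
  qed
qed

lemma dim_span2: "vec.dim (vec.span {a, b :: complex^4}) = 2 \<longleftrightarrow> indep2 a b"
proof
  assume d: "vec.dim (vec.span {a, b}) = 2"
  have fin: "finite {a, b}" by simp
  have "card {a, b} \<le> 2" by (simp add: card_insert_if)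
  then have "vec.independent {a, b}"
    by (intro vec.card_le_dim_spanning[of "{a, b}" "vec.span {a, b}"])
      (use d in \<open>auto intro: vec.span_base\<close>)
  moreover have "a \<noteq> b"
  proof
    assume "a = b"
    then have "vec.dim (vec.span {a, b}) \<le> card {a}"
      using vec.dim_le_card[of "{a}" "{a}"] by (simp add: vec.dim_span vec.span_superset)
    with d show False by simp
  qed
  ultimately show "indep2 a b" by (simp add: indep2_iff)
next
  assume "indep2 a b"
  then show "vec.dim (vec.span {a, b}) = 2"
    by (simp add: indep2_iff vec.dim_eq_card_independent vec.dim_span)
qed

lemma plane_eq_span:
  assumes "vec.subspace P" "vec.dim P = 2" "a \<in> P" "b \<in> P" "indep2 a b"
  shows "P = vec.span {a, b}"
proof
  show "P \<subseteq> vec.span {a, b}"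
    by (rule vec.card_ge_dim_independent) (use assms in \<open>auto simp: indep2_iff\<close>)
  show "vec.span {a, b} \<subseteq> P" using assms by (intro vec.span_minimal) auto
qed

lemma Q3_span:
  assumes "indep2 a b" "\<omega> a b = 0"
  shows "vec.span {a, b} \<in> Q3"
  unfolding Q3_def using assms dim_span2 \<omega>_commute[of b a] by (auto simp: in_span2)

lemma dim2_obtain:
  assumes "vec.subspace P" "vec.dim (P :: (complex^4) set) = 2"
  obtains a b where "P = vec.span {a, b}" "indep2 a b"
proof -
  obtain B where B: "B \<subseteq> P" "vec.independent B" "P \<subseteq> vec.span B" "card B = vec.dim P"
    using vec.basis_exists by blast
  then obtain a b where "B = {a, b}" "a \<noteq> b" using assms(2) by (auto simp: card_2_iff)
  then have "indep2 a b" "a \<in> P" "b \<in> P" using B by (auto simp: indep2_iff)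
  then show ?thesis using that[of a b] plane_eq_span[OF assms, of a b] by blast
qed

text \<open>The four minors are those of the coordinate pairs that span Lagrangian planes. By the
  Plucker relation they determine the product of the two remaining minors, which are opposite to
  each other because \<open>\<omega> a b = 0\<close>. If all four vanish, so do the other two, and
  the vectors are dependent.\<close>

lemma symplectic_minor_nonzero:
  assumes "indep2 a b" "\<omega> a b = 0"
  shows "a$1 * b$2 - a$2 * b$1 \<noteq> 0 \<or> a$1 * b$4 - a$4 * b$1 \<noteq> 0 \<or>
         a$3 * b$2 - a$2 * b$3 \<noteq> 0 \<or> a$3 * b$4 - a$4 * b$3 \<noteq> 0"
proof (rule ccontr)
  assume "\<not> ?thesis"
  then have m: "a$1 * b$2 - a$2 * b$1 = 0" "a$1 * b$4 - a$4 * b$1 = 0"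
    "a$3 * b$2 - a$2 * b$3 = 0" "a$3 * b$4 - a$4 * b$3 = 0" by blast+
  have w: "a$1 * b$3 - a$3 * b$1 = - (a$2 * b$4 - a$4 * b$2)"
    using assms(2) unfolding \<omega>_def eq_neg_iff_add_eq_0 .
  have prod: "(a$1 * b$3 - a$3 * b$1) * (a$2 * b$4 - a$4 * b$2) =
     (a$1 * b$2 - a$2 * b$1) * (a$3 * b$4 - a$4 * b$3) - (a$1 * b$4 - a$4 * b$1) * (a$3 * b$2 - a$2 * b$3)"
    by (simp add: algebra_simps)
  have "- (a$2 * b$4 - a$4 * b$2) * (a$2 * b$4 - a$4 * b$2) = 0"
    unfolding w[symmetric] prod m by simp
  then have m2: "a$2 * b$4 - a$4 * b$2 = 0" by (metis mult_eq_0_iff neg_equal_0_iff_equal)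
  have m3: "a$1 * b$3 - a$3 * b$1 = 0" unfolding w m2 by simp
  have eqs: "a$1 * b$2 = a$2 * b$1" "a$1 * b$4 = a$4 * b$1" "a$3 * b$2 = a$2 * b$3"
    "a$3 * b$4 = a$4 * b$3" "a$2 * b$4 = a$4 * b$2" "a$1 * b$3 = a$3 * b$1"
    using m m2 m3 by (simp_all only: right_minus_eq)
  have "a$i * b$j = a$j * b$i" for i j
    using exhaust_4[of i] exhaust_4[of j] by (elim disjE; simp only: eqs)
  then have "b$j *s a + (- (a$j)) *s b = 0" for j by (simp add: vec_eq_iff)
  then have "a$j = 0" for j using indep2D[OF assms(1)] by fastforce
  then have "a = 0" by (simp add: vec_eq_iff)
  then show False using indep2D[OF assms(1), of 1 0] by simp
qed

section \<open>Symplectic matrices and Lagrangian graphs\<close>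

lemma matrix_vector_4:
  fixes A :: "complex^4^'n"
  shows "(A *v x) $ i = A$i$1 * x$1 + A$i$2 * x$2 + A$i$3 * x$3 + A$i$4 * x$4"
  by (simp add: matrix_vector_mult_def sum_4)

lemma matrix_vector_scale: "A *v (c *s x) = c *s (A *v (x :: complex^4))"
  by (simp add: vec_eq_iff matrix_vector_4 algebra_simps)

lemma Sp2I:
  assumes "\<And>x y. \<omega> (A *v x) (A *v y) = \<omega> x y"
  shows "A \<in> Sp2"
proof -
  have "x = 0" if "A *v x = 0" for x
    using \<omega>_nondegenerate[of x] assms[of x] that by simp
  then have "invertible A"
    by (metis invertible_left_inverse matrix_left_invertible_ker)
  then show ?thesis using assms by (simp add: Sp2_def)
qed

lemma Sp2_\<omega>: "A \<in> Sp2 \<Longrightarrow> \<omega> (A *v x) (A *v y) = \<omega> x y"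
  by (simp add: Sp2_def)

lemma matrix_inv_mult:
  assumes "invertible (A :: complex^4^4)"
  shows "matrix_inv A ** A = mat 1" "A ** matrix_inv A = mat 1"
  using assms unfolding invertible_def matrix_inv_def by (metis (mono_tags, lifting) someI_ex)+

lemma Sp2_inv:
  assumes "A \<in> Sp2"
  shows "matrix_inv A \<in> Sp2" "A *v (matrix_inv A *v x) = x" "matrix_inv A *v (A *v x) = x"
proof -
  have i: "invertible A" using assms by (simp add: Sp2_def)
  show 1: "A *v (matrix_inv A *v x) = x" for x
    by (simp add: matrix_vector_mul_assoc matrix_inv_mult[OF i])
  show "matrix_inv A *v (A *v x) = x"
    by (simp add: matrix_vector_mul_assoc matrix_inv_mult[OF i])
  show "matrix_inv A \<in> Sp2"
  proof (rule Sp2I)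
    fix x y show "\<omega> (matrix_inv A *v x) (matrix_inv A *v y) = \<omega> x y"
      using Sp2_\<omega>[OF assms, of "matrix_inv A *v x" "matrix_inv A *v y"] by (simp add: 1)
  qed
qed

definition columns4 :: "complex^4 \<Rightarrow> complex^4 \<Rightarrow> complex^4 \<Rightarrow> complex^4 \<Rightarrow> complex^4^4" where
  "columns4 a b c d =
     (\<chi> i j. if j = 1 then a$i else if j = 2 then b$i else if j = 3 then c$i else d$i)"

lemma columns4_mult:
  "columns4 a b c d *v x = x$1 *s a + x$2 *s b + x$3 *s c + x$4 *s d"
  by (simp add: vec_eq_iff matrix_vector_4 columns4_def algebra_simps)

lemma columns4_Sp2:
  assumes "\<omega> a c = 1" "\<omega> b d = 1" "\<omega> a b = 0" "\<omega> a d = 0" "\<omega> b c = 0" "\<omega> c d = 0"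
  shows "columns4 a b c d \<in> Sp2"
proof (rule Sp2I)
  fix x y :: "complex^4"
  have "\<omega> c a = -1" "\<omega> d b = -1" "\<omega> b a = 0" "\<omega> d a = 0" "\<omega> c b = 0" "\<omega> d c = 0"
    using assms \<omega>_commute by (metis, metis, metis neg_0_equal_iff_equal, metis neg_0_equal_iff_equal,
        metis neg_0_equal_iff_equal, metis neg_0_equal_iff_equal)
  then show "\<omega> (columns4 a b c d *v x) (columns4 a b c d *v y) = \<omega> x y"
    using assms by (simp add: columns4_mult algebra_simps) (simp add: \<omega>_def algebra_simps)
qed

lemma indep2_Sp2:
  assumes "A \<in> Sp2" shows "indep2 (A *v a) (A *v b) \<longleftrightarrow> indep2 a b"
proof -
  have "s *s (A *v a) + t *s (A *v b) = A *v (s *s a + t *s b)" for s t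
    by (simp add: matrix_vector_right_distrib matrix_vector_scale)
  moreover have "A *v x = 0 \<longleftrightarrow> x = 0" for x
    by (metis Sp2_inv(3) assms matrix_vector_mult_0_right)
  ultimately show ?thesis by (simp add: indep2_def)
qed

lemma image_span2: "(*v) (A :: complex^4^4) ` vec.span {a, b :: complex^4} = vec.span {A *v a, A *v b}"
proof -
  have "A *v (s *s a + t *s b) = s *s (A *v a) + t *s (A *v b)" for s t
    by (simp add: matrix_vector_right_distrib matrix_vector_scale)
  then show ?thesis
    unfolding set_eq_iff image_iff Bex_def in_span2 by metis
qed

text \<open>\<open>gr0 \<alpha> \<beta>\<close> and \<open>gr1 \<beta> \<gamma>\<close> span a Lagrangian plane, and every Lagrangian plane transverse to \<open>[e 3 \<and> e 4]\<close> is of this form.\<close>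

definition gr0 :: "complex \<Rightarrow> complex \<Rightarrow> complex^4" where
  "gr0 \<alpha> \<beta> = e 1 + \<alpha> *s e 3 + \<beta> *s e 4"

definition gr1 :: "complex \<Rightarrow> complex \<Rightarrow> complex^4" where
  "gr1 \<beta> \<gamma> = e 2 + \<beta> *s e 3 + \<gamma> *s e 4"

lemma gr_nth [simp]:
  "gr0 a b $ 1 = 1" "gr0 a b $ 2 = 0" "gr0 a b $ 3 = a" "gr0 a b $ 4 = b"
  "gr1 b c $ 1 = 0" "gr1 b c $ 2 = 1" "gr1 b c $ 3 = b" "gr1 b c $ 4 = c"
  by (simp_all add: gr0_def gr1_def axis_def)

lemma indep2_gr: "indep2 (gr0 \<alpha> \<beta>) (gr1 \<beta> \<gamma>)"
  by (simp add: indep2_def vec_eq_iff forall_4)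

lemma graph_perp:
  assumes "\<omega> x (gr0 \<alpha> \<beta>) = 0" "\<omega> x (gr1 \<beta> \<gamma>) = 0"
  shows "x = x$1 *s gr0 \<alpha> \<beta> + x$2 *s gr1 \<beta> \<gamma>"
  using assms by (simp add: vec_eq_iff forall_4 \<omega>_def algebra_simps)

text \<open>
  Rotating the symplectic coordinate planes by a quarter turn makes any Lagrangian plane
  transverse to the coordinate plane \<open>[e 3 \<and> e 4]\<close>.
\<close>

lemma Sp2_rotation:
  assumes "indep2 a b" "\<omega> a b = 0"
  obtains R where "R \<in> Sp2" "(R *v a)$1 * (R *v b)$2 - (R *v a)$2 * (R *v b)$1 \<noteq> 0"
proof -
  let ?R1 = "columns4 (e 1) (e 2) (e 3) (e 4)"
  let ?R2 = "columns4 (e 1) (- e 4) (e 3) (e 2)"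
  let ?R3 = "columns4 (- e 3) (e 2) (e 1) (e 4)"
  let ?R4 = "columns4 (- e 3) (- e 4) (e 1) (e 2)"
  have "?R1 \<in> Sp2" "?R2 \<in> Sp2" "?R3 \<in> Sp2" "?R4 \<in> Sp2"
    by (auto intro!: columns4_Sp2 simp: \<omega>_def axis_def)
  moreover have "(?R1 *v a)$1 * (?R1 *v b)$2 - (?R1 *v a)$2 * (?R1 *v b)$1 = a$1 * b$2 - a$2 * b$1"
    "(?R2 *v a)$1 * (?R2 *v b)$2 - (?R2 *v a)$2 * (?R2 *v b)$1 = a$1 * b$4 - a$4 * b$1"
    "(?R3 *v a)$1 * (?R3 *v b)$2 - (?R3 *v a)$2 * (?R3 *v b)$1 = a$3 * b$2 - a$2 * b$3"
    "(?R4 *v a)$1 * (?R4 *v b)$2 - (?R4 *v a)$2 * (?R4 *v b)$1 = a$3 * b$4 - a$4 * b$3"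
    by (simp_all add: columns4_mult axis_def)
  ultimately show ?thesis
    using symplectic_minor_nonzero[OF assms] that[of ?R1] that[of ?R2] that[of ?R3] that[of ?R4]
    by argo
qed

text \<open>Cramer's rule: the frame is multiplied by the inverse of its upper block, of determinant
  \<open>d\<close>. The condition \<open>\<omega> a b = 0\<close> makes the two off-diagonal entries
  agree, so that one \<open>\<beta>\<close> serves for both vectors.\<close>

lemma graph_coordinates:
  assumes d: "d = a$1 * b$2 - a$2 * b$1" "d \<noteq> 0" and w: "\<omega> a b = 0"
    and abc: "\<alpha> = (b$2 * a$3 - a$2 * b$3) / d" "\<beta> = (b$2 * a$4 - a$2 * b$4) / d"
      "\<gamma> = (a$1 * b$4 - b$1 * a$4) / d"
  shows "gr0 \<alpha> \<beta> = (b$2 / d) *s a + (- (a$2) / d) *s b"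
    and "gr1 \<beta> \<gamma> = (- (b$1) / d) *s a + (a$1 / d) *s b"
proof -
  have "b$2 * a$4 - a$2 * b$4 = a$1 * b$3 - b$1 * a$3"
    using w unfolding \<omega>_def by algebra
  then have \<beta>': "\<beta> = (a$1 * b$3 - b$1 * a$3) / d" by (simp add: abc)
  have 1: "(b$2 * a$1 - a$2 * b$1) / d = 1" "(a$1 * b$2 - b$1 * a$2) / d = 1"
    using d by (simp_all add: mult.commute)
  show "gr0 \<alpha> \<beta> = (b$2 / d) *s a + (- (a$2) / d) *s b"
    using 1 by (simp add: vec_eq_iff forall_4 abc diff_divide_distrib mult.commute)
  show "gr1 \<beta> \<gamma> = (- (b$1) / d) *s a + (a$1 / d) *s b"
    using 1 by (simp add: vec_eq_iff forall_4 abc(1,3) \<beta>' diff_divide_distrib mult.commute)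
qed

text \<open>Maximality of Lagrangian planes. A symplectic rotation makes the plane a graph over the
  first two coordinates, and a vector orthogonal to such a graph is visibly a combination of its two
  spanning vectors.\<close>

lemma Q3_perp:
  assumes "P \<in> Q3" and "\<And>y. y \<in> P \<Longrightarrow> \<omega> x y = 0"
  shows "x \<in> P"
proof -
  have P: "vec.subspace P" "vec.dim P = 2" using assms by (auto simp: Q3_def)
  then obtain a b where ab: "P = vec.span {a, b}" "indep2 a b" by (rule dim2_obtain)
  have inP: "a \<in> P" "b \<in> P" by (simp_all add: ab(1) vec.span_base)
  have w: "\<omega> a b = 0" using assms inP by (auto simp: Q3_def)
  obtain R where R: "R \<in> Sp2" and d: "(R *v a)$1 * (R *v b)$2 - (R *v a)$2 * (R *v b)$1 \<noteq> 0"
    using Sp2_rotation[OF ab(2) w] .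
  have w': "\<omega> (R *v a) (R *v b) = 0" using Sp2_\<omega>[OF R] w by simp
  let ?x = "R *v x"
  have "\<omega> ?x (R *v a) = 0" "\<omega> ?x (R *v b) = 0" using assms(2) inP Sp2_\<omega>[OF R] by auto
  have "\<exists>s t. ?x = s *s (R *v a) + t *s (R *v b)"
  proof -
    obtain \<alpha> \<beta> \<gamma> s0 t0 s1 t1 where
      gc': "gr0 \<alpha> \<beta> = s0 *s (R *v a) + t0 *s (R *v b)" "gr1 \<beta> \<gamma> = s1 *s (R *v a) + t1 *s (R *v b)"
      using graph_coordinates[OF refl d w' refl refl refl] by blast
    have "\<omega> ?x (gr0 \<alpha> \<beta>) = 0" "\<omega> ?x (gr1 \<beta> \<gamma>) = 0"
      using \<open>\<omega> ?x (R *v a) = 0\<close> \<open>\<omega> ?x (R *v b) = 0\<close> by (simp_all add: gc')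
    from graph_perp[OF this] have "?x \<in> vec.span {gr0 \<alpha> \<beta>, gr1 \<beta> \<gamma>}"
      by (metis in_span2)
    moreover have "gr0 \<alpha> \<beta> \<in> vec.span {R *v a, R *v b}" "gr1 \<beta> \<gamma> \<in> vec.span {R *v a, R *v b}"
      unfolding in_span2 gc' by blast+
    ultimately have "?x \<in> vec.span {R *v a, R *v b}"
      by (meson empty_subsetI insert_subset subsetD vec.span_minimal vec.subspace_span)
    then show ?thesis by (simp add: in_span2)
  qed
  then have "?x \<in> (*v) R ` P" by (simp add: ab(1) image_span2 in_span2)
  then show ?thesis by (metis R Sp2_inv(3) imageE)
qed

text \<open>Membership becomes two scalar equations, holomorphic in the point when the frame is; the
  identity theorems for curves rest on this.\<close>

lemma Q3_mem_iff:
  assumes "vec.span {a, b} \<in> Q3"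
  shows "x \<in> vec.span {a, b} \<longleftrightarrow> \<omega> x a = 0 \<and> \<omega> x b = 0"
proof
  assume "x \<in> vec.span {a, b}"
  moreover have "a \<in> vec.span {a, b}" "b \<in> vec.span {a, b}" by (simp_all add: vec.span_base)
  ultimately show "\<omega> x a = 0 \<and> \<omega> x b = 0" using assms unfolding Q3_def by blast
next
  assume "\<omega> x a = 0 \<and> \<omega> x b = 0"
  then have "\<omega> x y = 0" if "y \<in> vec.span {a, b}" for y
    using that unfolding in_span2 by auto
  then show "x \<in> vec.span {a, b}" by (rule Q3_perp[OF assms])
qed

section \<open>Differentiation of vectors and matrices\<close>

definition has_vec_deriv :: "(complex \<Rightarrow> complex^4) \<Rightarrow> complex^4 \<Rightarrow> complex \<Rightarrow> bool" where
  "has_vec_deriv u D x \<longleftrightarrow> (\<forall>i. ((\<lambda>y. u y $ i) has_field_derivative D $ i) (at x))"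

lemma vec_holomorphic_imp_deriv:
  "vec_holomorphic_on u S \<Longrightarrow> open S \<Longrightarrow> x \<in> S \<Longrightarrow> has_vec_deriv u (vec_deriv u x) x"
  by (auto simp: vec_holomorphic_on_def has_vec_deriv_def vec_deriv_def intro: holomorphic_derivI)

lemma has_vec_deriv_imp: "has_vec_deriv u D x \<Longrightarrow> vec_deriv u x = D"
  by (auto simp: has_vec_deriv_def vec_deriv_def vec_eq_iff intro!: DERIV_imp_deriv)

lemma vec_holomorphicI:
  assumes "open S" "\<And>x. x \<in> S \<Longrightarrow> has_vec_deriv u (D x) x"
  shows "vec_holomorphic_on u S"
  using assms by (auto simp: vec_holomorphic_on_def has_vec_deriv_def holomorphic_on_open)

lemma vec_deriv_holomorphic:
  "vec_holomorphic_on u S \<Longrightarrow> open S \<Longrightarrow> vec_holomorphic_on (vec_deriv u) S"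
  by (auto simp: vec_holomorphic_on_def vec_deriv_def intro: holomorphic_deriv)

lemma has_vec_deriv_add:
  "has_vec_deriv u D x \<Longrightarrow> has_vec_deriv v E x \<Longrightarrow> has_vec_deriv (\<lambda>y. u y + v y) (D + E) x"
  by (auto simp: has_vec_deriv_def intro!: derivative_intros)

lemma has_vec_deriv_scale:
  "has_vec_deriv u D x \<Longrightarrow> (a has_field_derivative a') (at x) \<Longrightarrow>
   has_vec_deriv (\<lambda>y. a y *s u y) (a' *s u x + a x *s D) x"
  by (auto simp: has_vec_deriv_def intro!: derivative_eq_intros)

lemma has_vec_deriv_const: "has_vec_deriv (\<lambda>_. c) 0 x"
  by (auto simp: has_vec_deriv_def)

lemma has_vec_deriv_matrix:
  "has_vec_deriv u D x \<Longrightarrow> has_vec_deriv (\<lambda>y. A *v u y) (A *v D) x"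
  by (auto simp: has_vec_deriv_def matrix_vector_4 intro!: derivative_eq_intros)

lemma has_deriv_\<omega>:
  "has_vec_deriv u D x \<Longrightarrow> has_vec_deriv v E x \<Longrightarrow>
   ((\<lambda>y. \<omega> (u y) (v y)) has_field_derivative \<omega> D (v x) + \<omega> (u x) E) (at x)"
proof -
  assume "has_vec_deriv u D x" "has_vec_deriv v E x"
  then have d: "((\<lambda>y. u y $ i) has_field_derivative D $ i) (at x)"
    "((\<lambda>y. v y $ i) has_field_derivative E $ i) (at x)" for i
    by (auto simp: has_vec_deriv_def)
  show ?thesis
    unfolding \<omega>_def
    by (rule DERIV_cong, (rule DERIV_add DERIV_diff DERIV_mult d)+) (simp add: algebra_simps)
qed

lemma has_vec_deriv_compose:
  assumes "has_vec_deriv u D (g x)" "(g has_field_derivative g') (at x)"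
  shows "has_vec_deriv (\<lambda>y. u (g y)) (g' *s D) x"
  unfolding has_vec_deriv_def
proof
  fix i
  have "((\<lambda>y. u y $ i) has_field_derivative D $ i) (at (g x))"
    using assms(1) by (auto simp: has_vec_deriv_def)
  from DERIV_chain2[OF this assms(2)]
  show "((\<lambda>y. u (g y) $ i) has_field_derivative (g' *s D) $ i) (at x)"
    by (simp add: mult.commute)
qed

lemma vec_holomorphic_subset: "vec_holomorphic_on u S \<Longrightarrow> T \<subseteq> S \<Longrightarrow> vec_holomorphic_on u T"
  by (auto simp: vec_holomorphic_on_def intro: holomorphic_on_subset)

lemma \<omega>_holomorphic:
  "vec_holomorphic_on u S \<Longrightarrow> vec_holomorphic_on v S \<Longrightarrow> (\<lambda>x. \<omega> (u x) (v x)) holomorphic_on S"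
  by (auto simp: vec_holomorphic_on_def \<omega>_def intro!: holomorphic_intros)

lemma vec_holomorphic_const: "vec_holomorphic_on (\<lambda>_. c) S"
  by (simp add: vec_holomorphic_on_def)

lemma vec_holomorphic_add:
  "vec_holomorphic_on u S \<Longrightarrow> vec_holomorphic_on v S \<Longrightarrow> vec_holomorphic_on (\<lambda>x. u x + v x) S"
  by (auto simp: vec_holomorphic_on_def intro!: holomorphic_intros)

lemma vec_holomorphic_scale:
  "a holomorphic_on S \<Longrightarrow> vec_holomorphic_on u S \<Longrightarrow> vec_holomorphic_on (\<lambda>x. a x *s u x) S"
  by (auto simp: vec_holomorphic_on_def intro!: holomorphic_intros)

lemma vec_holomorphic_matrix:
  "vec_holomorphic_on u S \<Longrightarrow> vec_holomorphic_on (\<lambda>x. A *v u x) S"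
  by (auto simp: vec_holomorphic_on_def matrix_vector_4 intro!: holomorphic_intros)

lemma gr_holomorphic:
  assumes "\<alpha> holomorphic_on S" "\<beta> holomorphic_on S"
  shows "vec_holomorphic_on (\<lambda>x. gr0 (\<alpha> x) (\<beta> x)) S" "vec_holomorphic_on (\<lambda>x. gr1 (\<alpha> x) (\<beta> x)) S"
  unfolding gr0_def gr1_def
  by (intro vec_holomorphic_add vec_holomorphic_scale vec_holomorphic_const assms)+

lemma maurer_cartan_eqI:
  assumes "invertible (A x)" "mat_deriv A x = A x ** N"
  shows "maurer_cartan A i j x = N $ i $ j"
  using assms by (simp add: maurer_cartan_def matrix_mul_assoc matrix_inv_mult)

lemma mat_deriv_maurer_cartan:
  assumes "invertible (A x)"
  shows "mat_deriv A x = A x ** (\<chi> i j. maurer_cartan A i j x)"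
proof -
  have "(\<chi> i j. maurer_cartan A i j x) = matrix_inv (A x) ** mat_deriv A x"
    by (simp add: vec_eq_iff maurer_cartan_def)
  then show ?thesis using assms by (simp add: matrix_mul_assoc matrix_inv_mult)
qed

section \<open>Holomorphic maps into the Lagrangian Grassmannian\<close>

text \<open>Holomorphic functions on a connected open set form an integral domain: where
  \<open>\<psi>\<close> is nonzero, an open set, \<open>\<phi>\<close> must vanish.\<close>

lemma holomorphic_mult_zero:
  assumes "\<phi> holomorphic_on S" "\<psi> holomorphic_on S" "open S" "connected S"
    and "\<And>x. x \<in> S \<Longrightarrow> \<phi> x * \<psi> x = 0"
  shows "(\<forall>x\<in>S. \<phi> x = 0) \<or> (\<forall>x\<in>S. \<psi> x = 0)"
proof (rule disjCI)
  assume "\<not> (\<forall>x\<in>S. \<psi> x = 0)"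
  then obtain x0 where x0: "x0 \<in> S" "\<psi> x0 \<noteq> 0" by blast
  have "open (S \<inter> \<psi> -` (- {0}))"
    using assms by (intro continuous_open_preimage holomorphic_on_imp_continuous_on) auto
  then show "\<forall>x\<in>S. \<phi> x = 0"
    using holomorphic_zero_continuation[OF assms(1,3,4), of "S \<inter> \<psi> -` (- {0})"] assms(5) x0 by force
qed

lemma image_lessThan_2: "h ` {..<2::nat} = {h 0, h 1}"
proof -
  have "{..<2::nat} = {0, 1}" by auto
  then show ?thesis by simp
qed

lemma frame_2_iff:
  "frame 2 f (U, z) u \<longleftrightarrow> vec_holomorphic_on (u 0) (z ` U) \<and> vec_holomorphic_on (u 1) (z ` U) \<and>
     (\<forall>p\<in>U. vec.dim (f p) = 2 \<and> f p = vec.span {u 0 (z p), u 1 (z p)})"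
  by (auto simp: frame_def image_lessThan_2 less_2_cases_iff)

lemma frame_1_iff:
  "frame 1 f (U, z) u \<longleftrightarrow> vec_holomorphic_on (u 0) (z ` U) \<and>
     (\<forall>p\<in>U. vec.dim (f p) = 1 \<and> f p = vec.span {u 0 (z p)})"
  by (auto simp: frame_def lessThan_Suc)

lemmas frame_1_iff' = frame_1_iff[unfolded One_nat_def]

lemma span_1_nonzero: "vec.dim (vec.span {a :: complex^4}) = 1 \<Longrightarrow> a \<noteq> 0"
  by auto

context riemann
begin

lemma frame_change:
  assumes fr: "frame k f (V, w) u" and V: "(V, w) \<in> \<A>" and U: "(U, z) \<in> \<A>" "U \<subseteq> V"
  shows "frame k f (U, z) (\<lambda>i x. u i (transition (V, w) (U, z) x))"
proof -
  let ?T = "transition (V, w) (U, z)"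
  have hol: "?T holomorphic_on z ` U"
    using transition_holomorphic[OF V U(1)] U(2) by (simp add: inf.absorb2)
  have im: "?T ` z ` U \<subseteq> w ` V" using U by (auto simp: transition_eq[OF U(1)])
  have "vec_holomorphic_on (\<lambda>x. u i (?T x)) (z ` U)" if "i < k" for i
    unfolding vec_holomorphic_on_def
  proof
    fix j
    have "(\<lambda>x. u i x $ j) holomorphic_on w ` V"
      using fr that by (auto simp: frame_def vec_holomorphic_on_def)
    from holomorphic_on_compose_gen[OF hol this im]
    show "(\<lambda>x. u i (?T x) $ j) holomorphic_on z ` U" by (simp add: comp_def)
  qed
  moreover have "vec.dim (f p) = k \<and> f p = vec.span ((\<lambda>i. u i (?T (z p))) ` {..<k})" if "p \<in> U" for p
    using fr that U unfolding frame_def by (simp only: transition_eq[OF U(1)] prod.case) blast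
  ultimately show ?thesis unfolding frame_def prod.case by blast
qed

lemma frame_restrict: "frame k f (V, w) u \<Longrightarrow> U \<subseteq> V \<Longrightarrow> frame k f (U, w) u"
  by (auto simp: frame_def intro: vec_holomorphic_subset)

text \<open>Holomorphy grants a frame over some chart about the point; here it is transported to a
  prescribed coordinate \<open>z\<close> and to a disc inside a prescribed neighbourhood.\<close>

lemma local_frame:
  assumes "holomorphic_into Y k X \<A> f" "(U, z) \<in> \<A>" "p \<in> U" "openin X W" "p \<in> W"
  obtains V r u where "(V, z) \<in> \<A>" "p \<in> V" "V \<subseteq> U" "V \<subseteq> W" "r > 0" "z ` V = ball (z p) r"
    "frame k f (V, z) u"
proof -
  have "p \<in> topspace X" using assms chartD(2) by blast
  then obtain V0 w u where V0: "(V0, w) \<in> \<A>" "p \<in> V0" "frame k f (V0, w) u"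
    using assms(1) unfolding holomorphic_into_def by blast
  obtain V r where V: "(V, z) \<in> \<A>" "p \<in> V" "V \<subseteq> U" "V \<subseteq> V0 \<inter> W" "r > 0" "z ` V = ball (z p) r"
    using ball_chart[OF assms(2,3), of "V0 \<inter> W"] V0 assms chartD(1)[OF V0(1)] by blast
  have "V \<subseteq> V0" "V \<subseteq> W" using V(4) by auto
  from that[OF V(1-3) this(2) V(5,6) frame_change[OF V0(3,1) V(1) this(1)]] show thesis .
qed

end

context connected_riemann
begin

text \<open>Two Lagrangian planes coincide exactly when all four pairings between their frames
  vanish, so the coincidence set is locally the zero set of holomorphic functions.\<close>

lemma Q3_identity:
  assumes f: "holomorphic_into Q3 2 X \<A> f" and F: "holomorphic_into Q3 2 X \<A> F"
    and W: "openin X W" "W \<noteq> {}" "\<And>p. p \<in> W \<Longrightarrow> f p = F p" and p: "p \<in> topspace X"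
  shows "f p = F p"
proof -
  have "topspace X \<subseteq> {q. f q = F q}"
  proof (rule analytic_set_everywhere[OF W(1,2)])
    show "W \<subseteq> {q. f q = F q}" using W(3) by blast
    fix p assume "p \<in> topspace X"
    then obtain U0 z where U0: "(U0, z) \<in> \<A>" "p \<in> U0" using ex_chart by blast
    obtain U1 r1 u where U1: "(U1, z) \<in> \<A>" "p \<in> U1" "frame 2 f (U1, z) u"
      using local_frame[OF f U0 chartD(1)[OF U0(1)] U0(2)] by metis
    obtain U r v where U: "(U, z) \<in> \<A>" "p \<in> U" "U \<subseteq> U1" "z ` U = ball (z p) r" "frame 2 F (U, z) v"
      using local_frame[OF F U1(1,2) chartD(1)[OF U1(1)] U1(2)] by metis
    have u: "frame 2 f (U, z) u" using frame_restrict[OF U1(3) U(3)] .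
    define \<Phi> where "\<Phi> = {\<lambda>x. \<omega> (v 0 x) (u 0 x), \<lambda>x. \<omega> (v 0 x) (u 1 x),
                            \<lambda>x. \<omega> (v 1 x) (u 0 x), \<lambda>x. \<omega> (v 1 x) (u 1 x)}"
    have hol: "\<forall>\<phi>\<in>\<Phi>. \<phi> holomorphic_on z ` U"
      using u U(5) by (auto simp: \<Phi>_def frame_2_iff intro!: \<omega>_holomorphic)
    have "f q = F q \<longleftrightarrow> (\<forall>\<phi>\<in>\<Phi>. \<phi> (z q) = 0)" if q: "q \<in> U" for q
    proof -
      have Q: "f q \<in> Q3" "F q \<in> Q3"
        using f F q chartD(2)[OF U(1)] by (auto simp: holomorphic_into_def)
      have fq: "f q = vec.span {u 0 (z q), u 1 (z q)}" and Fq: "F q = vec.span {v 0 (z q), v 1 (z q)}"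
        and d: "vec.dim (f q) = 2" "vec.dim (F q) = 2"
        using u U(5) q by (auto simp: frame_2_iff)
      have "f q = F q \<longleftrightarrow> v 0 (z q) \<in> f q \<and> v 1 (z q) \<in> f q"
      proof
        assume "f q = F q"
        then show "v 0 (z q) \<in> f q \<and> v 1 (z q) \<in> f q"
          unfolding Fq by (simp add: vec.span_base)
      next
        assume *: "v 0 (z q) \<in> f q \<and> v 1 (z q) \<in> f q"
        have "indep2 (v 0 (z q)) (v 1 (z q))" using d(2) Fq dim_span2 by metis
        then show "f q = F q" unfolding Fq
          using * d(1) Q(1) by (intro plane_eq_span) (auto simp: Q3_def)
      qed
      also have "\<dots> \<longleftrightarrow> (\<forall>\<phi>\<in>\<Phi>. \<phi> (z q) = 0)"
        unfolding fq Q3_mem_iff[OF Q(1)[unfolded fq]] by (simp add: \<Phi>_def)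
      finally show ?thesis .
    qed
    then show "\<exists>U z \<Phi>. (U, z) \<in> \<A> \<and> p \<in> U \<and> connected (z ` U) \<and>
       (\<forall>\<phi>\<in>\<Phi>. \<phi> holomorphic_on z ` U) \<and> (\<forall>q\<in>U. q \<in> {q. f q = F q} \<longleftrightarrow> (\<forall>\<phi>\<in>\<Phi>. \<phi> (z q) = 0))"
      using U(1,2,4) hol by (intro exI[of _ U] exI[of _ z] exI[of _ \<Phi>]) auto
  qed
  then show ?thesis using p by blast
qed

text \<open>The same argument for incidence with a fixed vector: a null ray that contains a piece of
  the curve contains all of it.\<close>

lemma vector_identity:
  assumes f: "holomorphic_into Q3 2 X \<A> f"
    and W: "openin X W" "W \<noteq> {}" "\<And>p. p \<in> W \<Longrightarrow> \<xi> \<in> f p" and p: "p \<in> topspace X"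
  shows "\<xi> \<in> f p"
proof -
  have "topspace X \<subseteq> {q. \<xi> \<in> f q}"
  proof (rule analytic_set_everywhere[OF W(1,2)])
    show "W \<subseteq> {q. \<xi> \<in> f q}" using W(3) by blast
    fix p assume "p \<in> topspace X"
    then obtain U0 z where U0: "(U0, z) \<in> \<A>" "p \<in> U0" using ex_chart by blast
    obtain U r u where U: "(U, z) \<in> \<A>" "p \<in> U" "z ` U = ball (z p) r" "frame 2 f (U, z) u"
      using local_frame[OF f U0 chartD(1)[OF U0(1)] U0(2)] by metis
    define \<Phi> where "\<Phi> = {\<lambda>x. \<omega> \<xi> (u 0 x), \<lambda>x. \<omega> \<xi> (u 1 x)}"
    have hol: "\<forall>\<phi>\<in>\<Phi>. \<phi> holomorphic_on z ` U"
      using U(4) by (auto simp: \<Phi>_def frame_2_iff intro!: \<omega>_holomorphic vec_holomorphic_const)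
    have "\<xi> \<in> f q \<longleftrightarrow> (\<forall>\<phi>\<in>\<Phi>. \<phi> (z q) = 0)" if q: "q \<in> U" for q
    proof -
      have Q: "f q \<in> Q3" using f q chartD(2)[OF U(1)] by (auto simp: holomorphic_into_def)
      have fq: "f q = vec.span {u 0 (z q), u 1 (z q)}" using U(4) q by (auto simp: frame_2_iff)
      show ?thesis unfolding fq Q3_mem_iff[OF Q[unfolded fq]] by (simp add: \<Phi>_def)
    qed
    then show "\<exists>U z \<Phi>. (U, z) \<in> \<A> \<and> p \<in> U \<and> connected (z ` U) \<and>
       (\<forall>\<phi>\<in>\<Phi>. \<phi> holomorphic_on z ` U) \<and> (\<forall>q\<in>U. q \<in> {q. \<xi> \<in> f q} \<longleftrightarrow> (\<forall>\<phi>\<in>\<Phi>. \<phi> (z q) = 0))"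
      using U(1-3) hol by (intro exI[of _ U] exI[of _ z] exI[of _ \<Phi>]) auto
  qed
  then show ?thesis using p by blast
qed

end

section \<open>Isotropic curves\<close>

locale isotropic =
  fixes X :: "'a topology" and \<A> :: "'a chart set" and f :: "'a \<Rightarrow> (complex^4) set"
  assumes isotropic: "isotropic_curve X \<A> f"

sublocale isotropic \<subseteq> connected_riemann X \<A>
  using isotropic by unfold_locales (auto simp: isotropic_curve_def)

context isotropic
begin

lemma f_into: "holomorphic_into Q3 2 X \<A> f"
  using isotropic by (simp add: isotropic_curve_def)

lemma f_Q3: "p \<in> topspace X \<Longrightarrow> f p \<in> Q3"
  using f_into by (simp add: holomorphic_into_def)

text \<open>Transversality to \<open>[e 3 \<and> e 4]\<close> is an open condition and can be
  reached at \<open>p\<close> by a symplectic rotation; \<open>M\<close> is its inverse. The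
  derivative of the symmetric matrix of \<open>\<alpha>\<close>, \<open>\<beta>\<close>,
  \<open>\<gamma>\<close> then represents the differential of \<open>f\<close>.\<close>

lemma local_graph:
  assumes "(U, z) \<in> \<A>" "p \<in> U"
  obtains V r M \<alpha> \<beta> \<gamma> where "(V, z) \<in> \<A>" "p \<in> V" "V \<subseteq> U" "r > 0" "z ` V = ball (z p) r" "M \<in> Sp2"
    "\<alpha> holomorphic_on z ` V" "\<beta> holomorphic_on z ` V" "\<gamma> holomorphic_on z ` V"
    "\<And>q. q \<in> V \<Longrightarrow> f q = vec.span {M *v gr0 (\<alpha> (z q)) (\<beta> (z q)), M *v gr1 (\<beta> (z q)) (\<gamma> (z q))}"
proof -
  obtain U1 r1 u where U1: "(U1, z) \<in> \<A>" "p \<in> U1" "U1 \<subseteq> U" and fr: "frame 2 f (U1, z) u"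
    using local_frame[OF f_into assms chartD(1)[OF assms(1)] assms(2)] by metis
  have fq: "f q = vec.span {u 0 (z q), u 1 (z q)}" "vec.dim (f q) = 2" "f q \<in> Q3"
    "\<omega> (u 0 (z q)) (u 1 (z q)) = 0" if "q \<in> U1" for q
  proof -
    show 1: "f q = vec.span {u 0 (z q), u 1 (z q)}" "vec.dim (f q) = 2"
      using fr that by (auto simp: frame_2_iff)
    show 2: "f q \<in> Q3" using f_Q3 that chartD(2)[OF U1(1)] by auto
    have "u 0 (z q) \<in> f q" "u 1 (z q) \<in> f q" unfolding 1(1) by (simp_all add: vec.span_base)
    then show "\<omega> (u 0 (z q)) (u 1 (z q)) = 0" using 2 by (auto simp: Q3_def)
  qed
  have "indep2 (u 0 (z p)) (u 1 (z p))" using fq[OF U1(2)] dim_span2 by metis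
  then obtain R where R: "R \<in> Sp2" and d0: "(R *v u 0 (z p))$1 * (R *v u 1 (z p))$2
      - (R *v u 0 (z p))$2 * (R *v u 1 (z p))$1 \<noteq> 0"
    using Sp2_rotation fq(4)[OF U1(2)] by metis
  define a where "a = (\<lambda>x. R *v u 0 x)"
  define b where "b = (\<lambda>x. R *v u 1 x)"
  define d where "d = (\<lambda>x. a x$1 * b x$2 - a x$2 * b x$1)"
  have "vec_holomorphic_on a (z ` U1)" "vec_holomorphic_on b (z ` U1)"
    using fr by (auto simp: a_def b_def frame_2_iff intro: vec_holomorphic_matrix)
  then have ab: "(\<lambda>x. a x$i) holomorphic_on z ` U1" "(\<lambda>x. b x$i) holomorphic_on z ` U1" for i
    by (auto simp: vec_holomorphic_on_def)
  have dh: "d holomorphic_on z ` U1" unfolding d_def by (intro holomorphic_intros ab)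
  define W where "W = {q \<in> U1. z q \<in> z ` U1 \<inter> d -` (- {0})}"
  have "open (z ` U1 \<inter> d -` (- {0}))"
    using dh chartD(3)[OF U1(1)]
    by (intro continuous_open_preimage holomorphic_on_imp_continuous_on) auto
  then have W: "openin X W" unfolding W_def by (rule open_chart_preimage[OF U1(1)])
  have pW: "p \<in> W" using U1 d0 by (auto simp: W_def d_def a_def b_def)
  obtain V r where V: "(V, z) \<in> \<A>" "p \<in> V" "V \<subseteq> U1" "V \<subseteq> W" "r > 0" "z ` V = ball (z p) r"
    using ball_chart[OF U1(1,2) W pW] by metis
  define \<alpha> where "\<alpha> = (\<lambda>x. (b x$2 * a x$3 - a x$2 * b x$3) / d x)"
  define \<beta> where "\<beta> = (\<lambda>x. (b x$2 * a x$4 - a x$2 * b x$4) / d x)"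
  define \<gamma> where "\<gamma> = (\<lambda>x. (a x$1 * b x$4 - b x$1 * a x$4) / d x)"
  have dV: "d x \<noteq> 0" if "x \<in> z ` V" for x using that V(4) by (auto simp: W_def)
  have abV: "(\<lambda>x. a x$i) holomorphic_on z ` V" "(\<lambda>x. b x$i) holomorphic_on z ` V" for i
    using ab holomorphic_on_subset V(3) by blast+
  have hol: "\<alpha> holomorphic_on z ` V" "\<beta> holomorphic_on z ` V" "\<gamma> holomorphic_on z ` V"
    unfolding \<alpha>_def \<beta>_def \<gamma>_def d_def
    by (intro holomorphic_intros abV; use dV in \<open>simp add: d_def\<close>)+
  have M: "matrix_inv R \<in> Sp2" by (rule Sp2_inv(1)[OF R])
  show thesis
  proof (rule that[OF V(1,2) _ V(5,6) M hol])
    show "V \<subseteq> U" using V(3) U1(3) by blast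
    fix q assume q: "q \<in> V"
    let ?x = "z q"
    have q1: "q \<in> U1" using q V(3) by blast
    have "\<omega> (a ?x) (b ?x) = 0" using fq(4)[OF q1] Sp2_\<omega>[OF R] by (simp add: a_def b_def)
    note gc = graph_coordinates[OF fun_cong[OF d_def] dV[OF imageI[OF q]] this
        fun_cong[OF \<alpha>_def] fun_cong[OF \<beta>_def] fun_cong[OF \<gamma>_def]]
    have "\<exists>s t. gr0 (\<alpha> ?x) (\<beta> ?x) = s *s a ?x + t *s b ?x"
      "\<exists>s t. gr1 (\<beta> ?x) (\<gamma> ?x) = s *s a ?x + t *s b ?x"
      using gc by blast+
    moreover have "matrix_inv R *v (s *s a ?x + t *s b ?x) \<in> f q" for s t
    proof -
      have "matrix_inv R *v (s *s a ?x + t *s b ?x) = s *s u 0 ?x + t *s u 1 ?x"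
        by (simp add: a_def b_def matrix_vector_right_distrib matrix_vector_scale Sp2_inv(3)[OF R])
      then show ?thesis unfolding fq(1)[OF q1] in_span2 by blast
    qed
    ultimately have "matrix_inv R *v gr0 (\<alpha> ?x) (\<beta> ?x) \<in> f q" "matrix_inv R *v gr1 (\<beta> ?x) (\<gamma> ?x) \<in> f q"
      by auto
    then show "f q = vec.span {matrix_inv R *v gr0 (\<alpha> ?x) (\<beta> ?x), matrix_inv R *v gr1 (\<beta> ?x) (\<gamma> ?x)}"
      using fq(2,3)[OF q1] indep2_Sp2[OF M] indep2_gr by (intro plane_eq_span) (auto simp: Q3_def)
  qed
qed

text \<open>Criticality is defined by the existence of one good frame in one chart and has to be
  tested on an arbitrary one. Pairings between the two frames vanish identically, because both lie
  in the same Lagrangian planes; differentiating them moves the derivative from one frame to the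
  other.\<close>

lemma critical_pointD:
  assumes U: "(U, z) \<in> \<A>" "p \<in> U" and fr: "frame 2 f (U, z) u"
    and crit: "critical_point 2 \<A> f p" and ij: "i < 2" "j < 2"
  shows "\<omega> (u i (z p)) (vec_deriv (u j) (z p)) = 0"
proof -
  obtain V w v where V: "(V, w) \<in> \<A>" "p \<in> V" "frame 2 f (V, w) v"
    and v': "\<And>i. i < 2 \<Longrightarrow> vec_deriv (v i) (w p) \<in> f p"
    using crit unfolding critical_point_def by blast
  let ?T = "transition (V, w) (U, z)" and ?x = "z p"
  have x: "?x \<in> z ` (V \<inter> U)" using U V by auto
  have Tx: "?T ?x = w p" using U by simp
  have uf: "u k (z q) \<in> f q" if "k < 2" "q \<in> U" for k q
    using fr that by (auto simp: frame_def intro!: vec.span_base)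
  have vf: "v k (w q) \<in> f q" if "k < 2" "q \<in> V" for k q
    using V(3) that by (auto simp: frame_def intro!: vec.span_base)
  have Q: "f q \<in> Q3" if "q \<in> U" for q using f_Q3 chartD(2)[OF U(1)] that by auto
  have du: "has_vec_deriv (u j) (vec_deriv (u j) ?x) ?x"
    using fr ij U chartD(3)[OF U(1)] by (intro vec_holomorphic_imp_deriv[of _ "z ` U"]) (auto simp: frame_def)
  have dv: "has_vec_deriv (\<lambda>x. v k (?T x)) (deriv ?T ?x *s vec_deriv (v k) (w p)) ?x" if "k < 2" for k
  proof (rule has_vec_deriv_compose)
    show "has_vec_deriv (v k) (vec_deriv (v k) (w p)) (?T ?x)"
      unfolding Tx using V that chartD(3)[OF V(1)]
      by (intro vec_holomorphic_imp_deriv[of _ "w ` V"]) (auto simp: frame_def)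
    show "(?T has_field_derivative deriv ?T ?x) (at ?x)"
      by (rule transition_DERIV[OF V(1) U(1) x])
  qed
  have vu: "\<omega> (v k (w p)) (vec_deriv (u j) ?x) = 0" if k: "k < 2" for k
  proof -
    have d1: "((\<lambda>x. \<omega> (v k (?T x)) (u j x)) has_field_derivative
        \<omega> (deriv ?T ?x *s vec_deriv (v k) (w p)) (u j ?x) + \<omega> (v k (?T ?x)) (vec_deriv (u j) ?x)) (at ?x)"
      by (rule has_deriv_\<omega>[OF dv[OF k] du])
    have d2: "((\<lambda>x. \<omega> (v k (?T x)) (u j x)) has_field_derivative 0) (at ?x)"
    proof (rule has_field_derivative_transform_within_open[OF DERIV_const open_overlap[OF V(1) U(1)] x])
      fix x assume "x \<in> z ` (V \<inter> U)"
      then obtain q where q: "q \<in> V" "q \<in> U" "x = z q" by auto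
      then have "v k (?T x) \<in> f q" "u j x \<in> f q" using vf uf k ij U by auto
      then show "0 = \<omega> (v k (?T x)) (u j x)" using Q[OF q(2)] by (auto simp: Q3_def)
    qed
    have "\<omega> (deriv ?T ?x *s vec_deriv (v k) (w p)) (u j ?x) + \<omega> (v k (w p)) (vec_deriv (u j) ?x) = 0"
      using DERIV_unique[OF d1 d2] unfolding Tx .
    moreover have "\<omega> (vec_deriv (v k) (w p)) (u j ?x) = 0"
      using v'[OF k] uf[OF ij(2) U(2)] Q[OF U(2)] by (auto simp: Q3_def)
    ultimately show ?thesis by simp
  qed
  have "f p = vec.span {v 0 (w p), v 1 (w p)}" using V by (auto simp: frame_2_iff)
  then have "u i (z p) \<in> vec.span {v 0 (w p), v 1 (w p)}" using uf[OF ij(1) U(2)] by simp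
  then obtain s t where "u i (z p) = s *s v 0 (w p) + t *s v 1 (w p)"
    unfolding in_span2 by blast
  then show ?thesis using vu by simp
qed

text \<open>The counterpart for curves of lines: the minors of two proportional frames vanish
  identically, and their derivative at \<open>p\<close> yields the minors of the given frame and its
  own derivative.\<close>

lemma critical_pointD_1:
  assumes g: "holomorphic_into CP3 1 X \<A> g"
    and U: "(U, z) \<in> \<A>" "p \<in> U" and fr: "frame 1 g (U, z) u" and crit: "critical_point 1 \<A> g p"
  shows "u 0 (z p) $ i * vec_deriv (u 0) (z p) $ j = u 0 (z p) $ j * vec_deriv (u 0) (z p) $ i"
proof -
  obtain V w v where V: "(V, w) \<in> \<A>" "p \<in> V" "frame 1 g (V, w) v" "vec_deriv (v 0) (w p) \<in> g p"
    using crit unfolding critical_point_def by auto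
  let ?T = "transition (V, w) (U, z)" and ?x = "z p"
  have x: "?x \<in> z ` (V \<inter> U)" using U V by auto
  have Tx: "?T ?x = w p" using U by simp
  have gU: "g q = vec.span {u 0 (z q)}" "vec.dim (g q) = 1" if "q \<in> U" for q
    using fr that by (auto simp: frame_1_iff')
  have gV: "g q = vec.span {v 0 (w q)}" if "q \<in> V" for q
    using V that by (auto simp: frame_1_iff')
  have du: "((\<lambda>x. u 0 x $ k) has_field_derivative vec_deriv (u 0) ?x $ k) (at ?x)" for k
    using fr U chartD(3)[OF U(1)] vec_holomorphic_imp_deriv[of "u 0" "z ` U" ?x]
    by (auto simp: frame_1_iff' has_vec_deriv_def)
  have dv: "((\<lambda>x. v 0 (?T x) $ k) has_field_derivative vec_deriv (v 0) (w p) $ k * deriv ?T ?x) (at ?x)" for k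
  proof -
    have *: "((\<lambda>x. v 0 x $ k) has_field_derivative vec_deriv (v 0) (w p) $ k) (at (?T ?x))"
      unfolding Tx using V chartD(3)[OF V(1)] vec_holomorphic_imp_deriv[of "v 0" "w ` V" "w p"]
      by (auto simp: frame_1_iff' has_vec_deriv_def)
    show ?thesis by (rule DERIV_chain2[OF * transition_DERIV[OF V(1) U(1) x]])
  qed
  define a where "a = u 0 ?x"
  define a' where "a' = vec_deriv (u 0) ?x"
  obtain c where c: "v 0 (w p) = c *s a"
    using gV[OF V(2)] gU(1)[OF U(2)] vec.span_base[of "v 0 (w p)" "{v 0 (w p)}"]
    by (auto simp: vec.span_singleton a_def)
  obtain c' where c': "vec_deriv (v 0) (w p) = c' *s a"
    using V(4) gU(1)[OF U(2)] by (auto simp: vec.span_singleton a_def)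
  have "c \<noteq> 0"
  proof
    assume "c = 0"
    then have "g p = vec.span {0}" using gV[OF V(2)] c by simp
    then show False using gU(2)[OF U(2)] by simp
  qed
  have "((\<lambda>x. v 0 (?T x) $ i * u 0 x $ j - v 0 (?T x) $ j * u 0 x $ i) has_field_derivative
      (vec_deriv (v 0) (w p) $ i * deriv ?T ?x) * a $ j + a' $ j * (v 0 (w p) $ i)
      - ((vec_deriv (v 0) (w p) $ j * deriv ?T ?x) * a $ i + a' $ i * (v 0 (w p) $ j))) (at ?x)"
    using DERIV_diff[OF DERIV_mult[OF dv[of i] du[of j]] DERIV_mult[OF dv[of j] du[of i]]]
    by (simp add: Tx a_def a'_def)
  moreover have "((\<lambda>x. v 0 (?T x) $ i * u 0 x $ j - v 0 (?T x) $ j * u 0 x $ i) has_field_derivative 0) (at ?x)"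
  proof (rule has_field_derivative_transform_within_open[OF DERIV_const open_overlap[OF V(1) U(1)] x])
    fix x assume "x \<in> z ` (V \<inter> U)"
    then obtain q where q: "q \<in> V" "q \<in> U" "x = z q" by auto
    have "v 0 (w q) \<in> vec.span {u 0 (z q)}"
      using gV[OF q(1)] gU(1)[OF q(2)] vec.span_base[of "v 0 (w q)" "{v 0 (w q)}"] by simp
    then obtain s where "v 0 (w q) = s *s u 0 (z q)" by (auto simp: vec.span_singleton)
    then show "0 = v 0 (?T x) $ i * u 0 x $ j - v 0 (?T x) $ j * u 0 x $ i"
      using q U(1) by simp
  qed
  ultimately have "(vec_deriv (v 0) (w p) $ i * deriv ?T ?x) * a $ j + a' $ j * (v 0 (w p) $ i)
      - ((vec_deriv (v 0) (w p) $ j * deriv ?T ?x) * a $ i + a' $ i * (v 0 (w p) $ j)) = 0"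
    by (rule DERIV_unique)
  then have "c * (a $ i * a' $ j - a $ j * a' $ i) = 0"
    unfolding c c' by (simp add: algebra_simps)
  then show ?thesis using \<open>c \<noteq> 0\<close> by (simp add: a_def a'_def)
qed

end

section \<open>Matrices given by their columns, and the differential of a graph\<close>

lemma columns4_nth [simp]:
  "columns4 a b c d $ i $ 1 = a $ i" "columns4 a b c d $ i $ 2 = b $ i"
  "columns4 a b c d $ i $ 3 = c $ i" "columns4 a b c d $ i $ 4 = d $ i"
  by (simp_all add: columns4_def)

lemma matrix_mult_4: "((A :: complex^4^4) ** B) $ i $ j =
    A$i$1 * B$1$j + A$i$2 * B$2$j + A$i$3 * B$3$j + A$i$4 * B$4$j"
  by (simp add: matrix_matrix_mult_def sum_4)

lemma mat_deriv_columns4: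
  assumes "has_vec_deriv a a' x" "has_vec_deriv b b' x" "has_vec_deriv c c' x" "has_vec_deriv d d' x"
  shows "mat_deriv (\<lambda>y. columns4 (a y) (b y) (c y) (d y)) x = columns4 a' b' c' d'"
proof -
  have "((\<lambda>y. columns4 (a y) (b y) (c y) (d y) $ i $ j) has_field_derivative
          columns4 a' b' c' d' $ i $ j) (at x)" for i j
    using exhaust_4[of j] assms by (elim disjE) (simp_all add: has_vec_deriv_def)
  then show ?thesis by (simp add: mat_deriv_def vec_eq_iff DERIV_imp_deriv)
qed

lemma mat_holomorphic_columns4:
  assumes "vec_holomorphic_on a S" "vec_holomorphic_on b S" "vec_holomorphic_on c S" "vec_holomorphic_on d S"
  shows "mat_holomorphic_on (\<lambda>y. columns4 (a y) (b y) (c y) (d y)) S"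
  unfolding mat_holomorphic_on_def
proof (intro allI)
  fix i j :: 4
  show "(\<lambda>y. columns4 (a y) (b y) (c y) (d y) $ i $ j) holomorphic_on S"
    using exhaust_4[of j] assms by (elim disjE) (simp_all add: vec_holomorphic_on_def)
qed

lemma columns4_axis: "columns4 a b c d *v e 1 = a" "columns4 a b c d *v e 2 = b"
  "columns4 a b c d *v e 3 = c" "columns4 a b c d *v e 4 = d"
  by (simp_all add: columns4_mult axis_def)

lemma has_vec_deriv_gr:
  assumes "(\<alpha> has_field_derivative \<alpha>') (at x)" "(\<beta> has_field_derivative \<beta>') (at x)"
  shows "has_vec_deriv (\<lambda>y. gr0 (\<alpha> y) (\<beta> y)) (\<alpha>' *s e 3 + \<beta>' *s e 4) x"
    "has_vec_deriv (\<lambda>y. gr1 (\<alpha> y) (\<beta> y)) (\<alpha>' *s e 3 + \<beta>' *s e 4) x"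
  using has_vec_deriv_add[OF has_vec_deriv_add[OF has_vec_deriv_const[of "e 1"]
        has_vec_deriv_scale[OF has_vec_deriv_const[of "e 3"] assms(1)]]
        has_vec_deriv_scale[OF has_vec_deriv_const[of "e 4"] assms(2)]]
    has_vec_deriv_add[OF has_vec_deriv_add[OF has_vec_deriv_const[of "e 2"]
        has_vec_deriv_scale[OF has_vec_deriv_const[of "e 3"] assms(1)]]
        has_vec_deriv_scale[OF has_vec_deriv_const[of "e 4"] assms(2)]]
  by (simp_all add: gr0_def gr1_def)

context isotropic
begin

text \<open>Completed by the constant columns \<open>M *v e 3\<close> and \<open>M *v e 4\<close>,
  the graph frame is a symplectic lift whose Maurer-Cartan form has only a lower left block, the
  derivative of the symmetric matrix. Nullity says that the determinant of this block
  vanishes.\<close>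

lemma graph_null:
  assumes U: "(U, z) \<in> \<A>" and M: "M \<in> Sp2"
    and hol: "\<alpha> holomorphic_on z ` U" "\<beta> holomorphic_on z ` U" "\<gamma> holomorphic_on z ` U"
    and f: "\<And>q. q \<in> U \<Longrightarrow> f q = vec.span {M *v gr0 (\<alpha> (z q)) (\<beta> (z q)), M *v gr1 (\<beta> (z q)) (\<gamma> (z q))}"
    and x: "x \<in> z ` U"
  shows "deriv \<alpha> x * deriv \<gamma> x = (deriv \<beta> x)\<^sup>2"
proof -
  let ?C = "\<lambda>y. columns4 (M *v gr0 (\<alpha> y) (\<beta> y)) (M *v gr1 (\<beta> y) (\<gamma> y)) (M *v e 3) (M *v e 4)"
  have Sp: "?C y \<in> Sp2" for y
    by (rule columns4_Sp2) (simp_all add: Sp2_\<omega>[OF M], simp_all add: \<omega>_def axis_def)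
  have lift: "sp_lift f (U, z) ?C"
    unfolding sp_lift_def prod.case
    using Sp f by (intro conjI mat_holomorphic_columns4 vec_holomorphic_matrix gr_holomorphic hol
        vec_holomorphic_const ballI) (auto simp: plane_of_def columns4_axis)
  define N :: "complex^4^4" where "N = columns4 (deriv \<alpha> x *s e 3 + deriv \<beta> x *s e 4)
       (deriv \<beta> x *s e 3 + deriv \<gamma> x *s e 4) 0 0"
  have d: "(\<alpha> has_field_derivative deriv \<alpha> x) (at x)" "(\<beta> has_field_derivative deriv \<beta> x) (at x)"
    "(\<gamma> has_field_derivative deriv \<gamma> x) (at x)"
    using hol x chartD(3)[OF U] by (auto intro: holomorphic_derivI)
  have "mat_deriv ?C x = columns4 (M *v (deriv \<alpha> x *s e 3 + deriv \<beta> x *s e 4))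
       (M *v (deriv \<beta> x *s e 3 + deriv \<gamma> x *s e 4)) 0 0"
    by (intro mat_deriv_columns4 has_vec_deriv_const has_vec_deriv_matrix has_vec_deriv_gr d)
  also have "\<dots> = ?C x ** N"
  proof -
    have "columns4 (M *v (deriv \<alpha> x *s e 3 + deriv \<beta> x *s e 4))
       (M *v (deriv \<beta> x *s e 3 + deriv \<gamma> x *s e 4)) 0 0 $ i $ j = (?C x ** N) $ i $ j" for i j
      using exhaust_4[of j]
      by (elim disjE) (simp_all add: matrix_mult_4 N_def axis_def matrix_vector_4 algebra_simps)
    then show ?thesis by (simp add: vec_eq_iff)
  qed
  finally have md: "mat_deriv ?C x = ?C x ** N" .
  have "invertible (?C x)" using Sp by (simp add: Sp2_def)
  note mc = maurer_cartan_eqI[OF this md]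
  have "null_curve \<A> f" using isotropic by (simp add: isotropic_curve_def)
  then have "maurer_cartan ?C 3 1 x * maurer_cartan ?C 4 2 x - (maurer_cartan ?C 4 1 x)\<^sup>2 = 0"
    using U lift x unfolding null_curve_def by blast
  then show ?thesis unfolding mc by (simp add: N_def axis_def)
qed

text \<open>Were all three derivatives zero, \<open>f\<close> would agree on an open set with a
  constant map, hence everywhere by the identity theorem.\<close>

lemma graph_not_constant:
  assumes U: "(U, z) \<in> \<A>" "U \<noteq> {}" "connected (z ` U)"
    and hol: "\<alpha> holomorphic_on z ` U" "\<beta> holomorphic_on z ` U" "\<gamma> holomorphic_on z ` U"
    and M: "M \<in> Sp2"
    and f: "\<And>q. q \<in> U \<Longrightarrow> f q = vec.span {M *v gr0 (\<alpha> (z q)) (\<beta> (z q)), M *v gr1 (\<beta> (z q)) (\<gamma> (z q))}"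
  shows "\<exists>\<phi>\<in>{deriv \<alpha>, deriv \<beta>, deriv \<gamma>}. \<exists>x\<in>z ` U. \<phi> x \<noteq> 0"
proof (rule ccontr)
  assume "\<not> ?thesis"
  then have 0: "\<And>x. x \<in> z ` U \<Longrightarrow> deriv \<alpha> x = 0" "\<And>x. x \<in> z ` U \<Longrightarrow> deriv \<beta> x = 0"
    "\<And>x. x \<in> z ` U \<Longrightarrow> deriv \<gamma> x = 0" by auto
  have const: "\<exists>c. \<forall>x\<in>z ` U. \<phi> x = c" if that0: "\<phi> holomorphic_on z ` U" "\<And>x. x \<in> z ` U \<Longrightarrow> deriv \<phi> x = 0" for \<phi>
  proof -
    have "\<phi> constant_on z ` U"
    proof (rule has_field_derivative_0_imp_constant_on)
      show "(\<phi> has_field_derivative 0) (at x)" if x: "x \<in> z ` U" for x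
        using holomorphic_derivI[OF that0(1) chartD(3)[OF U(1)] x] that0(2)[OF x] by simp
    qed (use U(3) chartD(3)[OF U(1)] in auto)
    then show ?thesis by (simp add: constant_on_def)
  qed
  from const[OF hol(1) 0(1)] obtain a where a: "\<forall>x\<in>z ` U. \<alpha> x = a" ..
  from const[OF hol(2) 0(2)] obtain b where b: "\<forall>x\<in>z ` U. \<beta> x = b" ..
  from const[OF hol(3) 0(3)] obtain c where c: "\<forall>x\<in>z ` U. \<gamma> x = c" ..
  define P where "P = vec.span {M *v gr0 a b, M *v gr1 b c}"
  have fP: "f q = P" if "q \<in> U" for q using f[OF that] a b c that by (simp add: P_def)
  obtain p0 where "p0 \<in> U" using U by blast
  then have P: "P \<in> Q3" using f_Q3 fP chartD(2)[OF U(1)] by blast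
  have "holomorphic_into Q3 2 X \<A> (\<lambda>_. P)"
    unfolding holomorphic_into_def
  proof (intro ballI conjI P)
    fix p assume "p \<in> topspace X"
    then obtain V w where V: "(V, w) \<in> \<A>" "p \<in> V" using ex_chart by blast
    have "frame 2 (\<lambda>_. P) (V, w) (\<lambda>i _. if i = 0 then M *v gr0 a b else M *v gr1 b c)"
      using P by (auto simp: frame_2_iff vec_holomorphic_const P_def Q3_def)
    then show "\<exists>(V, w)\<in>\<A>. p \<in> V \<and> (\<exists>u. frame 2 (\<lambda>_. P) (V, w) u)" using V by blast
  qed
  from Q3_identity[OF f_into this chartD(1)[OF U(1)] U(2) fP]
  have "f p = P" if "p \<in> topspace X" for p using that by simp
  then have "\<not> (\<exists>p\<in>topspace X. \<exists>q\<in>topspace X. f p \<noteq> f q)" by simp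
  then show False using isotropic unfolding isotropic_curve_def by blast
qed

text \<open>If the regular part were empty, the canonical reduction could be empty and the bending
  condition void. The differential of \<open>f\<close> is not identically zero since
  \<open>f\<close> is not constant; that of the Legendre associate is not either, since a constant
  associate would be a line contained in all planes of the curve. The product of the two is then
  nonzero somewhere.\<close>

lemma not_critical_somewhere:
  assumes leg: "legendre_associate X \<A> f g"
  shows "S_star X \<A> f g \<noteq> {}"
proof -
  have g: "holomorphic_into CP3 1 X \<A> g" using leg by (simp add: legendre_associate_def)
  obtain p where p: "p \<in> topspace X" using isotropic by (auto simp: isotropic_curve_def)
  obtain U0 z where U0: "(U0, z) \<in> \<A>" "p \<in> U0" using ex_chart[OF p] by blast
  obtain U1 r1 \<xi> where U1: "(U1, z) \<in> \<A>" "p \<in> U1" and fr1: "frame 1 g (U1, z) \<xi>"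
    using local_frame[OF g U0 chartD(1)[OF U0(1)] U0(2)] by metis
  obtain U r M \<alpha> \<beta> \<gamma> where U: "(U, z) \<in> \<A>" "p \<in> U" "U \<subseteq> U1" "r > 0" "z ` U = ball (z p) r"
    and M: "M \<in> Sp2"
    and hol: "\<alpha> holomorphic_on z ` U" "\<beta> holomorphic_on z ` U" "\<gamma> holomorphic_on z ` U"
    and f: "\<And>q. q \<in> U \<Longrightarrow> f q = vec.span {M *v gr0 (\<alpha> (z q)) (\<beta> (z q)), M *v gr1 (\<beta> (z q)) (\<gamma> (z q))}"
    using local_graph[OF U1] by metis
  have conn: "connected (z ` U)" and op: "open (z ` U)" using U(5) by auto
  have frg: "frame 1 g (U, z) \<xi>" by (rule frame_restrict[OF fr1 U(3)])
  then have \<xi>: "vec_holomorphic_on (\<xi> 0) (z ` U)"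
    and gq: "\<And>q. q \<in> U \<Longrightarrow> g q = vec.span {\<xi> 0 (z q)}" "\<And>q. q \<in> U \<Longrightarrow> vec.dim (g q) = 1"
    by (auto simp: frame_1_iff')
  define \<eta> where "\<eta> = \<xi> 0"
  have \<eta>h: "(\<lambda>x. \<eta> x $ i) holomorphic_on z ` U" for i
    using \<xi> by (auto simp: vec_holomorphic_on_def \<eta>_def)
  have \<eta>d: "((\<lambda>x. \<eta> x $ i) has_field_derivative vec_deriv \<eta> x $ i) (at x)" if "x \<in> z ` U" for x i
    using \<xi> op that vec_holomorphic_imp_deriv[of "\<eta>" "z ` U" x]
    by (auto simp: \<eta>_def has_vec_deriv_def)
  have \<eta>0: "\<eta> (z q) \<noteq> 0" if "q \<in> U" for q
    using span_1_nonzero gq[OF that] by (metis \<eta>_def)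
  define u where "u = (\<lambda>i::nat. if i = 0 then (\<lambda>x. M *v gr0 (\<alpha> x) (\<beta> x)) else (\<lambda>x. M *v gr1 (\<beta> x) (\<gamma> x)))"
  have u01: "u 0 = (\<lambda>x. M *v gr0 (\<alpha> x) (\<beta> x))" "u 1 = (\<lambda>x. M *v gr1 (\<beta> x) (\<gamma> x))"
    by (auto simp: u_def)
  have fru: "frame 2 f (U, z) u"
    unfolding frame_2_iff u01
  proof (intro conjI ballI vec_holomorphic_matrix gr_holomorphic hol)
    fix q assume q: "q \<in> U"
    then have "f q \<in> Q3" using f_Q3 chartD(2)[OF U(1)] by blast
    then show "vec.dim (f q) = 2" by (simp add: Q3_def)
    show "f q = vec.span {M *v gr0 (\<alpha> (z q)) (\<beta> (z q)), M *v gr1 (\<beta> (z q)) (\<gamma> (z q))}"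
      by (rule f[OF q])
  qed
  have d: "(\<alpha> has_field_derivative deriv \<alpha> x) (at x)" "(\<beta> has_field_derivative deriv \<beta> x) (at x)"
    "(\<gamma> has_field_derivative deriv \<gamma> x) (at x)" if "x \<in> z ` U" for x
    using hol op that by (auto intro: holomorphic_derivI)
  have vd: "vec_deriv (u 0) x = M *v (deriv \<alpha> x *s e 3 + deriv \<beta> x *s e 4)"
    "vec_deriv (u 1) x = M *v (deriv \<beta> x *s e 3 + deriv \<gamma> x *s e 4)" if "x \<in> z ` U" for x
    unfolding u01
    by (intro has_vec_deriv_imp has_vec_deriv_matrix has_vec_deriv_gr d that)+
  have md: "mdot u x 0 0 = deriv \<alpha> x" "mdot u x 0 1 = deriv \<beta> x" "mdot u x 1 0 = deriv \<beta> x"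
    "mdot u x 1 1 = deriv \<gamma> x" if "x \<in> z ` U" for x
    unfolding mdot_def vd[OF that] unfolding u01
    by (simp_all add: Sp2_\<omega>[OF M], simp_all add: \<omega>_def axis_def)
  define minor where "minor = (\<lambda>i j x. \<eta> x $ i * deriv (\<lambda>y. \<eta> y $ j) x - \<eta> x $ j * deriv (\<lambda>y. \<eta> y $ i) x)"
  have minor_hol: "minor i j holomorphic_on z ` U" for i j
    unfolding minor_def by (intro holomorphic_intros \<eta>h holomorphic_deriv op)
  have minor_eq: "minor i j x = \<eta> x $ i * vec_deriv \<eta> x $ j - \<eta> x $ j * vec_deriv \<eta> x $ i" for i j x
    by (simp add: minor_def vec_deriv_def)
  \<comment> \<open>The minors of \<open>\<eta>\<close> and its derivative detect noncritical points
    of \<open>g\<close>; if they all vanish, the line \<open>g\<close> is locally constant, spanned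
    by \<open>\<xi>0\<close>.\<close>
  have "\<exists>i j. \<exists>x\<in>z ` U. minor i j x \<noteq> 0"
  proof (rule ccontr)
    assume "\<not> ?thesis"
    then have m0: "minor i j x = 0" if "x \<in> z ` U" for i j x using that by blast
    have "\<eta> (z p) \<noteq> 0" using \<eta>0 U(2) by blast
    then obtain i where i: "\<eta> (z p) $ i \<noteq> 0" by (auto simp: vec_eq_iff)
    define W where "W = {q \<in> U. z q \<in> z ` U \<inter> (\<lambda>x. \<eta> x $ i) -` (- {0})}"
    have "open (z ` U \<inter> (\<lambda>x. \<eta> x $ i) -` (- {0}))"
      using \<eta>h op by (intro continuous_open_preimage holomorphic_on_imp_continuous_on) auto
    then have W: "openin X W" unfolding W_def by (rule open_chart_preimage[OF U(1)])
    have pW: "p \<in> W" using U i by (auto simp: W_def)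
    obtain V r' where V: "(V, z) \<in> \<A>" "p \<in> V" "V \<subseteq> U" "V \<subseteq> W" "z ` V = ball (z p) r'" "r' > 0"
      using ball_chart[OF U(1,2) W pW] by metis
    have opV: "open (z ` V)" "connected (z ` V)" using V(5) by auto
    have nz: "\<eta> x $ i \<noteq> 0" if "x \<in> z ` V" for x using V(4) that by (auto simp: W_def)
    have ratio: "\<eta> x $ j / \<eta> x $ i = \<eta> (z p) $ j / \<eta> (z p) $ i" if x: "x \<in> z ` V" for x j
    proof -
      have "((\<lambda>x. \<eta> x $ j / \<eta> x $ i) has_field_derivative 0) (at y)" if y: "y \<in> z ` V" for y
      proof -
        have yU: "y \<in> z ` U" using y V(3) by auto
        have "vec_deriv \<eta> y $ j * \<eta> y $ i - \<eta> y $ j * vec_deriv \<eta> y $ i = 0"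
          using m0[OF yU, of i j] unfolding minor_eq by (simp add: algebra_simps)
        then show ?thesis
          using DERIV_divide[OF \<eta>d[OF yU, of j] \<eta>d[OF yU, of i] nz[OF y]] by simp
      qed
      then have "(\<lambda>x. \<eta> x $ j / \<eta> x $ i) constant_on z ` V"
        using opV by (intro has_field_derivative_0_imp_constant_on) auto
      then show ?thesis using x V(2) by (auto simp: constant_on_def)
    qed
    define \<xi>0 where "\<xi>0 = \<eta> (z p)"
    have in_g: "\<xi>0 \<in> g q" if q: "q \<in> V" for q
    proof -
      have "\<xi>0 = (\<xi>0 $ i / \<eta> (z q) $ i) *s \<eta> (z q)"
        using ratio[OF imageI[OF q]] nz[OF imageI[OF q]] i
        by (simp add: vec_eq_iff \<xi>0_def field_simps)
      moreover have "g q = vec.span {\<eta> (z q)}" using gq(1) q V(3) by (auto simp: \<eta>_def)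
      ultimately show ?thesis by (metis rangeI vec.span_singleton)
    qed
    have "f q = vec.span {u 0 (z q), u 1 (z q)}" if "q \<in> V" for q
      using fru that V(3) by (auto simp: frame_2_iff)
    \<comment> \<open>Where the differential of \<open>f\<close> is nonzero, the associate is a line
      of the plane.\<close>
    have in_f: "\<xi>0 \<in> f q" if q: "q \<in> V" and ne: "\<exists>\<phi>\<in>{deriv \<alpha>, deriv \<beta>, deriv \<gamma>}. \<phi> (z q) \<noteq> 0" for q
    proof -
      let ?x = "z q"
      have qU: "q \<in> U" "?x \<in> z ` U" using q V(3) by auto
      have null: "deriv \<alpha> ?x * deriv \<gamma> ?x = deriv \<beta> ?x * deriv \<beta> ?x"
        using graph_null[OF U(1) M hol f qU(2)] by (simp add: power2_eq_square)
      \<comment> \<open>A kernel vector of the singular symmetric matrix: built from its first row,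
        or \<open>(1, 0)\<close> if that row is zero.\<close>
      obtain k0 k1 where k: "(k0, k1) \<noteq> (0, 0)" "deriv \<alpha> ?x * k0 + deriv \<beta> ?x * k1 = 0"
        "deriv \<beta> ?x * k0 + deriv \<gamma> ?x * k1 = 0"
      proof (cases "deriv \<alpha> ?x = 0 \<and> deriv \<beta> ?x = 0")
        case True
        then show ?thesis using that[of 1 0] by simp
      next
        case False
        then show ?thesis
          using that[of "deriv \<beta> ?x" "- deriv \<alpha> ?x"] null by (auto simp: mult.commute)
      qed
      define k where "k = (\<lambda>n::nat. if n = 0 then k0 else k1)"
      have "(\<exists>i<2. \<exists>j<2. mdot u ?x i j \<noteq> 0)"
      proof -
        have lt: "(0::nat) < 2" "(1::nat) < 2" by auto
        from ne consider "mdot u ?x 0 0 \<noteq> 0" | "mdot u ?x 0 1 \<noteq> 0" | "mdot u ?x 1 1 \<noteq> 0"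
          unfolding md[OF qU(2)] by blast
        then show ?thesis by cases (use lt in blast)+
      qed
      moreover have "(k 0, k 1) \<noteq> (0, 0)" using k(1) by (simp add: k_def)
      moreover have "\<forall>i<2. mdot u ?x i 0 * k 0 + mdot u ?x i 1 * k 1 = 0"
        using k(2,3) md[OF qU(2)] by (auto simp: less_2_cases_iff k_def)
      ultimately have "g q = vec.span {k 0 *s u 0 ?x + k 1 *s u 1 ?x}"
        using leg U(1) fru qU(1) unfolding legendre_associate_def by blast
      then obtain s where "\<xi>0 = s *s (k 0 *s u 0 ?x + k 1 *s u 1 ?x)"
        using in_g[OF q] by (auto simp: vec.span_singleton)
      then have "\<xi>0 = (s * k 0) *s u 0 ?x + (s * k 1) *s u 1 ?x"
        by (simp add: vec.scale_right_distrib)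
      moreover have "f q = vec.span {u 0 ?x, u 1 ?x}" using fru qU by (auto simp: frame_2_iff)
      ultimately show ?thesis using in_span2 by blast
    qed
    have holV: "\<alpha> holomorphic_on z ` V" "\<beta> holomorphic_on z ` V" "\<gamma> holomorphic_on z ` V"
      using hol V(3) by (auto intro: holomorphic_on_subset)
    have fV: "\<And>q. q \<in> V \<Longrightarrow> f q = vec.span {M *v gr0 (\<alpha> (z q)) (\<beta> (z q)), M *v gr1 (\<beta> (z q)) (\<gamma> (z q))}"
      using f V(3) by auto
    obtain \<phi> where \<phi>: "\<phi> \<in> {deriv \<alpha>, deriv \<beta>, deriv \<gamma>}" "\<not> (\<forall>x\<in>z ` V. \<phi> x = 0)"
      using graph_not_constant[OF V(1) _ opV(2) holV M fV] V(2) by blast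
    have \<phi>h: "\<phi> holomorphic_on z ` V"
      using \<phi>(1) holV opV by (auto intro: holomorphic_deriv)
    \<comment> \<open>At zeros of the differential of \<open>f\<close> the definition of the
      associate does not place it in the plane; these points are bridged by the absence of zero
      divisors, applied to \<open>\<phi>\<close> and the pairing with \<open>\<xi>0\<close>.\<close>
    have w0: "\<omega> \<xi>0 (u k x) = 0" if k: "k < 2" and x: "x \<in> z ` V" for k x
    proof -
      have wh: "(\<lambda>x. \<omega> \<xi>0 (u k x)) holomorphic_on z ` V"
        using fru k V(3)
        by (intro \<omega>_holomorphic vec_holomorphic_const) (auto simp: frame_def intro: vec_holomorphic_subset)
      have "\<phi> y * \<omega> \<xi>0 (u k y) = 0" if y: "y \<in> z ` V" for y
      proof (cases "\<phi> y = 0")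
        case False
        obtain q where q: "q \<in> V" "y = z q" using y by blast
        have "\<xi>0 \<in> f q" using in_f[OF q(1)] \<phi>(1) False q(2) by blast
        moreover have "q \<in> U" using q V(3) by blast
        then have "u k y \<in> f q"
          using fru k q(2) by (auto simp: frame_def intro!: vec.span_base)
        moreover have "f q \<in> Q3" using f_Q3 q chartD(2)[OF V(1)] by blast
        ultimately show ?thesis by (auto simp: Q3_def)
      qed simp
      then show ?thesis
        using holomorphic_mult_zero[OF \<phi>h wh opV] \<phi>(2) x by blast
    qed
    have "\<xi>0 \<in> f q" if q: "q \<in> V" for q
    proof -
      have fq: "f q = vec.span {u 0 (z q), u 1 (z q)}" using fru q V(3) by (auto simp: frame_2_iff)
      have "f q \<in> Q3" using f_Q3 q chartD(2)[OF V(1)] by blast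
      then show ?thesis unfolding fq using Q3_mem_iff w0[of 0 "z q"] w0[of 1 "z q"] q by auto
    qed
    from vector_identity[OF f_into chartD(1)[OF V(1)] _ this] V(2)
    have "\<xi>0 \<in> f q" if "q \<in> topspace X" for q using that by blast
    moreover have "\<xi>0 \<noteq> 0" using i by (auto simp: \<xi>0_def)
    ultimately show False using isotropic unfolding isotropic_curve_def by blast
  qed
  then obtain i j where ij: "\<not> (\<forall>x\<in>z ` U. minor i j x = 0)" by blast
  obtain \<phi> where \<phi>: "\<phi> \<in> {deriv \<alpha>, deriv \<beta>, deriv \<gamma>}" "\<not> (\<forall>x\<in>z ` U. \<phi> x = 0)"
    using graph_not_constant[OF U(1) _ conn hol M f] U(2) by blast
  have \<phi>h: "\<phi> holomorphic_on z ` U" using \<phi>(1) hol op by (auto intro: holomorphic_deriv)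
  have "\<exists>x\<in>z ` U. \<phi> x * minor i j x \<noteq> 0"
    using holomorphic_mult_zero[OF \<phi>h minor_hol op conn] ij \<phi>(2) by blast
  then obtain q where q: "q \<in> U" "\<phi> (z q) \<noteq> 0" "minor i j (z q) \<noteq> 0" by auto
  have qz: "z q \<in> z ` U" using q by blast
  have "\<not> critical_point 2 \<A> f q"
  proof
    assume "critical_point 2 \<A> f q"
    then have *: "\<omega> (u a (z q)) (vec_deriv (u b) (z q)) = 0" if "a < 2" "b < 2" for a b
      using critical_pointD[OF U(1) q(1) fru] that by blast
    have "deriv \<alpha> (z q) = 0" "deriv \<beta> (z q) = 0" "deriv \<gamma> (z q) = 0"
      using *[of 0 0] *[of 0 1] *[of 1 1] md[OF qz] by (simp_all add: mdot_def)
    then show False using q(2) \<phi>(1) by auto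
  qed
  moreover have "\<not> critical_point 1 \<A> g q"
  proof
    assume "critical_point 1 \<A> g q"
    from critical_pointD_1[OF g U(1) q(1) frg this, of i j] show False
      using q(3) unfolding minor_eq \<eta>_def by simp
  qed
  ultimately have "q \<in> S_star X \<A> f g"
    using chartD(2)[OF U(1)] q(1) by (auto simp: S_star_def)
  then show ?thesis by blast
qed

end

section \<open>Linear differential equations\<close>

lemma bounded_primitive:
  fixes f :: "complex \<Rightarrow> complex"
  assumes "f holomorphic_on ball x0 \<rho>" "\<rho> > 0"
  shows "\<exists>g. (\<forall>x\<in>ball x0 \<rho>. (g has_field_derivative f x) (at x)) \<and> g x0 = 0"
proof -
  obtain g where g: "\<And>x. x \<in> ball x0 \<rho> \<Longrightarrow> (g has_field_derivative f x) (at x within ball x0 \<rho>)"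
    using holomorphic_convex_primitive'[of "ball x0 \<rho>" f] assms by auto
  have "((\<lambda>x. g x - g x0) has_field_derivative f x) (at x)" if "x \<in> ball x0 \<rho>" for x
    using g[OF that] that by (auto simp: at_within_open[of _ "ball x0 \<rho>"] intro!: derivative_eq_intros)
  then show ?thesis by (intro exI[of _ "\<lambda>x. g x - g x0"]) auto
qed

text \<open>Picard iteration; the two components of the system are indexed by \<open>bool\<close>.\<close>

lemma linear_system_solution:
  fixes a :: "bool \<Rightarrow> bool \<Rightarrow> complex \<Rightarrow> complex" and c :: "bool \<Rightarrow> complex"
  assumes "r > 0" and hol: "\<And>i j. a i j holomorphic_on ball x0 r"
  obtains \<rho> v where "0 < \<rho>" "\<rho> \<le> r" "\<And>i. v i x0 = c i"
    "\<And>i x. x \<in> ball x0 \<rho> \<Longrightarrow>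
       (v i has_field_derivative a i True x * v True x + a i False x * v False x) (at x)"
proof -
  have "\<exists>K. \<forall>x\<in>cball x0 (r/2). norm (a i j x) \<le> K" for i j
  proof -
    have "continuous_on (cball x0 (r/2)) (a i j)"
      by (rule holomorphic_on_imp_continuous_on[OF holomorphic_on_subset[OF hol]]) (use \<open>r > 0\<close> in auto)
    then have "bounded (a i j ` cball x0 (r/2))"
      using compact_continuous_image compact_imp_bounded compact_cball by blast
    then show ?thesis by (auto simp: bounded_iff)
  qed
  then obtain K0 where K0: "\<And>i j x. x \<in> cball x0 (r/2) \<Longrightarrow> norm (a i j x) \<le> K0 i j" by metis
  define K where "K = 1 + (\<Sum>i\<in>UNIV. \<Sum>j\<in>UNIV. \<bar>K0 i j\<bar>)"
  have K: "norm (a i j x) \<le> K" if "x \<in> cball x0 (r/2)" for i j x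
    using K0[OF that, of i j] unfolding K_def UNIV_bool by (cases i; cases j; simp)
  have "K \<ge> 1" unfolding K_def by (simp add: sum_nonneg)
  \<comment> \<open>Two coefficients per row, each at most \<open>K\<close>, on a disc of radius at
    most \<open>1 / (4 * K)\<close>: integration at least halves the bound at every step.\<close>
  define \<rho> where "\<rho> = min (r/2) (1 / (4 * K))"
  have \<rho>: "0 < \<rho>" "\<rho> \<le> r" "\<rho> \<le> r/2" "\<rho> * (4 * K) \<le> 1"
    using \<open>K \<ge> 1\<close> \<open>r > 0\<close> by (auto simp: \<rho>_def min_def field_simps)
  let ?B = "ball x0 \<rho>"
  have Ksub: "norm (a i j x) \<le> K" if "x \<in> ?B" for i j x using K[of x] that \<rho>(3) by auto
  have holB: "a i j holomorphic_on ?B" for i j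
    by (rule holomorphic_on_subset[OF hol]) (use \<rho>(2) in auto)
  define I where "I = (\<lambda>f. SOME g. (\<forall>x\<in>?B. (g has_field_derivative f x) (at x)) \<and> g x0 = (0 :: complex))"
  have I: "\<And>x. x \<in> ?B \<Longrightarrow> (I f has_field_derivative f x) (at x)" "I f x0 = 0"
    if "f holomorphic_on ?B" for f
    using someI_ex[OF bounded_primitive[OF that \<rho>(1)]] unfolding I_def by blast+
  define S where "S = (\<lambda>u i x. a i True x * u True x + a i False x * u False (x :: complex))"
  \<comment> \<open>\<open>V n\<close> is the \<open>n\<close>-th term of a series, not an
    approximate solution: the iteration starts from the constants, and the solution is the sum of
    all terms.\<close>
  define V where "V = (\<lambda>n. ((\<lambda>u i. I (S u i)) ^^ n) (\<lambda>i _. c i))"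
  have V0: "V 0 = (\<lambda>i _. c i)" and VS: "V (Suc n) i = I (S (V n) i)" for n i
    by (simp_all add: V_def)
  have Vhol: "V n i holomorphic_on ?B" for n i
  proof (induction n arbitrary: i)
    case (Suc n)
    have "S (V n) i holomorphic_on ?B" unfolding S_def by (intro holomorphic_intros holB Suc)
    from I(1)[OF this] show ?case unfolding VS holomorphic_on_open[OF open_ball] by blast
  qed (simp add: V0)
  have Shol: "S (V n) i holomorphic_on ?B" for n i
    unfolding S_def by (intro holomorphic_intros holB Vhol)
  have VD: "(V (Suc n) i has_field_derivative S (V n) i x) (at x)" if "x \<in> ?B" for n i x
    unfolding VS using I(1)[OF Shol that] .
  define C where "C = norm (c True) + norm (c False)"
  have C: "norm (c i) \<le> C" for i by (cases i) (auto simp: C_def)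
  have S_bound: "norm (S u i x) \<le> 2 * K * B" if "x \<in> ?B" "\<And>i. norm (u i x) \<le> B" for u i x B
  proof -
    have "norm (a i j x * u j x) \<le> K * B" for j
      unfolding norm_mult using Ksub[OF that(1)] that(2) \<open>K \<ge> 1\<close>
      by (intro mult_mono) auto
    from norm_triangle_mono[OF this[of True] this[of False]] show ?thesis by (simp add: S_def mult_ac)
  qed
  have bound: "norm (V n i x) \<le> C * (1/2) ^ n" if "x \<in> ?B" for n i x
    using that
  proof (induction n arbitrary: i x)
    case 0 then show ?case using C by (simp add: V0)
  next
    case (Suc n)
    have "norm (V (Suc n) i x - V (Suc n) i x0) \<le> (2 * K * (C * (1/2) ^ n)) * norm (x - x0)"
    proof (rule field_differentiable_bound[of ?B])
      show "(V (Suc n) i has_field_derivative S (V n) i y) (at y within ?B)" if "y \<in> ?B" for y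
        using VD[OF that] has_field_derivative_at_within by blast
      show "norm (S (V n) i y) \<le> 2 * K * (C * (1/2) ^ n)" if "y \<in> ?B" for y
        by (rule S_bound[of y "V n", OF that]) (rule Suc.IH[OF that])
    qed (use \<rho> Suc.prems in auto)
    also have "\<dots> \<le> (2 * K * (C * (1/2) ^ n)) * \<rho>"
      using Suc.prems \<open>K \<ge> 1\<close> by (intro mult_left_mono) (auto simp: dist_norm norm_minus_commute C_def)
    also have "\<dots> = (C * (1/2) ^ n) / 2 * (\<rho> * (4 * K))" by simp
    also have "\<dots> \<le> (C * (1/2) ^ n) / 2 * 1"
      using \<rho>(4) by (intro mult_left_mono) (auto simp: C_def)
    finally show ?case using I(2)[OF Shol] by (simp add: VS)
  qed
  have summ: "summable (\<lambda>n. V n i x)" if "x \<in> ?B" for i x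
    by (rule summable_comparison_test'[of "\<lambda>n. C * (1/2) ^ n" 0])
      (use bound[OF that] in \<open>auto intro: summable_mult summable_geometric\<close>)
  define v where "v = (\<lambda>i x. \<Sum>n. V n i x)"
  \<comment> \<open>The constant term has derivative zero, and term \<open>n + 1\<close> has as
    derivative the system applied to term \<open>n\<close>; hence the shift, and the extra factor 2
    in the majorant below.\<close>
  define D where "D = (\<lambda>i n x. case n of 0 \<Rightarrow> 0 | Suc n \<Rightarrow> S (V n) i x)"
  have Dsum: "(\<Sum>n. D i n x) = S v i x" if x: "x \<in> ?B" for i x
  proof -
    have "(\<lambda>n. S (V n) i x) sums S v i x"
      unfolding S_def v_def using summ[OF x] by (intro sums_add sums_mult summable_sums)
    then have "(\<lambda>n. D i (Suc n) x) sums S v i x" by (simp add: D_def)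
    then have "(\<lambda>n. D i n x) sums (S v i x + D i 0 x)" by (rule sums_Suc)
    then show ?thesis by (simp add: D_def sums_iff)
  qed
  have deriv: "(v i has_field_derivative S v i x) (at x)" if x: "x \<in> ?B" for i x
  proof -
    have "uniform_limit ?B (\<lambda>n x. \<Sum>k<n. D i k x) (\<lambda>x. \<Sum>k. D i k x) sequentially"
    proof (rule Weierstrass_m_test[of _ _ "\<lambda>n. 2 * (2 * K * C) * (1/2) ^ n"])
      show "norm (D i n y) \<le> 2 * (2 * K * C) * (1/2) ^ n" if "y \<in> ?B" for n y
      proof (cases n)
        case 0 then show ?thesis using \<open>K \<ge> 1\<close> by (simp add: D_def C_def)
      next
        case (Suc m)
        have "norm (S (V m) i y) \<le> 2 * K * (C * (1/2) ^ m)"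
          by (rule S_bound[of y "V m", OF that]) (rule bound[OF that])
        then show ?thesis by (simp add: Suc D_def mult_ac)
      qed
    qed (auto intro: summable_mult summable_geometric)
    then have "\<exists>g. \<forall>x\<in>?B. ((\<lambda>n. V n i x) sums g x) \<and> (g has_field_derivative (\<Sum>k. D i k x)) (at x within ?B)"
    proof (rule has_field_derivative_series[of ?B "\<lambda>n. V n i" "\<lambda>n. D i n", rotated 2])
      show "(V n i has_field_derivative D i n y) (at y within ?B)" if "y \<in> ?B" for n y
        using VD[OF that, THEN has_field_derivative_at_within]
        by (cases n) (auto simp: D_def V0)
    qed (use summ[of x0] \<rho> in auto)
    then obtain g where g: "\<And>x. x \<in> ?B \<Longrightarrow> (\<lambda>n. V n i x) sums g x"
      "\<And>x. x \<in> ?B \<Longrightarrow> (g has_field_derivative (\<Sum>k. D i k x)) (at x within ?B)" by blast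
    have "(g has_field_derivative S v i x) (at x)"
      using g(2)[OF x] Dsum[OF x] x by (simp add: at_within_open[of _ ?B])
    moreover have "g y = v i y" if "y \<in> ?B" for y using g(1)[OF that] by (simp add: v_def sums_iff)
    ultimately show ?thesis
      using x has_field_derivative_transform_within_open[of g _ x ?B "v i"] by auto
  qed
  have "v i x0 = c i" for i
  proof -
    have "(\<lambda>n. V n i x0) = (\<lambda>n. if n = 0 then c i else 0)"
    proof
      fix n show "V n i x0 = (if n = 0 then c i else 0)"
        using I(2)[OF Shol] by (cases n) (simp_all add: V0 VS)
    qed
    then show ?thesis
      using sums_single[of 0 "\<lambda>_. c i"] by (simp add: v_def sums_iff eq_commute)
  qed
  from that[OF \<rho>(1,2) this deriv[unfolded S_def]] show thesis .
qed

section \<open>The structure group\<close>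

text \<open>All cube roots in \<open>F_iso\<close> and in the connection are rational multiples of
  powers of this one, so the matrix identities below reduce to
  \<open>\<nu> ^ 3 = 1/6\<close>.\<close>

definition \<nu> :: complex where "\<nu> = cbrt (1/6)"

lemma \<nu>_cube: "\<nu> ^ 3 = 1/6" "\<nu> \<noteq> 0" "\<nu> * (\<nu> * \<nu>) = 1/6" "\<nu> * (\<nu> * (\<nu> * x)) = x/6"
proof -
  have "root 3 (1/6) ^ 3 = (1/6 :: real)" by (simp add: real_root_pow_pos2)
  then have "\<nu> ^ 3 = complex_of_real (1/6)"
    unfolding \<nu>_def cbrt_def of_real_power[symmetric] by (rule arg_cong)
  then show *: "\<nu> ^ 3 = 1/6" by simp
  then show "\<nu> \<noteq> 0" by auto
  have e: "\<nu> * (\<nu> * \<nu>) = \<nu> ^ 3" by (simp add: power3_eq_cube)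
  show **: "\<nu> * (\<nu> * \<nu>) = 1/6" unfolding e by (rule *)
  have "\<nu> * (\<nu> * (\<nu> * x)) = (\<nu> * (\<nu> * \<nu>)) * x" by (simp only: mult.assoc)
  also have "\<dots> = x/6" unfolding ** by simp
  finally show "\<nu> * (\<nu> * (\<nu> * x)) = x/6" .
qed

lemma cbrt_eqs:
  "cbrt (2/9) = 2 * \<nu>\<^sup>2" "inverse (cbrt 6) = \<nu>" "cbrt (3/32) = 3/2 * \<nu>\<^sup>2" "cbrt (1/6) = \<nu>"
proof -
  define r :: real where "r = root 3 (1/6)"
  have r: "r > 0" "r ^ 3 = 1/6" by (simp_all add: r_def real_root_pow_pos2)
  have n: "\<nu> = of_real r" by (simp add: \<nu>_def cbrt_def r_def)
  have "(r\<^sup>2) ^ 3 = (r ^ 3)\<^sup>2" by (simp flip: power_mult)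
  then have r6: "(r\<^sup>2) ^ 3 = 1/36" unfolding r(2) by (simp add: power2_eq_square)
  have "(2 * r\<^sup>2) ^ 3 = 2/9" unfolding power_mult_distrib r6 by simp
  then have "root 3 (2/9) = 2 * r\<^sup>2" using r by (intro real_root_pos_unique) auto
  then show "cbrt (2/9) = 2 * \<nu>\<^sup>2" by (simp add: cbrt_def n)
  have "(1 / r) ^ 3 = 6" unfolding power_divide r(2) by simp
  then have "root 3 6 = 1 / r" using r by (intro real_root_pos_unique) auto
  then show "inverse (cbrt 6) = \<nu>" by (simp add: cbrt_def n)
  have "(3/2 * r\<^sup>2) ^ 3 = 3/32" unfolding power_mult_distrib r6 by (simp add: power3_eq_cube)
  then have "root 3 (3/32) = 3/2 * r\<^sup>2" using r by (intro real_root_pos_unique) auto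
  then show "cbrt (3/32) = 3/2 * \<nu>\<^sup>2"
    by (simp only: cbrt_def n of_real_mult of_real_divide of_real_numeral of_real_power)
qed (simp add: \<nu>_def)

definition vec4 :: "complex \<Rightarrow> complex \<Rightarrow> complex \<Rightarrow> complex \<Rightarrow> complex^4" where
  "vec4 a b c d = a *s e 1 + b *s e 2 + c *s e 3 + d *s e 4"

lemma vec4_nth [simp]: "vec4 a b c d $ 1 = a" "vec4 a b c d $ 2 = b" "vec4 a b c d $ 3 = c" "vec4 a b c d $ 4 = d"
  by (simp_all add: vec4_def axis_def)

text \<open>The action on binary cubic forms of the upper triangular matrix with diagonal
  \<open>a\<close>, \<open>d\<close> and corner \<open>b\<close>, in the basis \<open>e 1\<close> to
  \<open>e 4\<close>. The relation \<open>a * d = 1\<close> is imposed only where the group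
  \<open>H1\<close> is meant.\<close>

definition tri_rep :: "complex \<Rightarrow> complex \<Rightarrow> complex \<Rightarrow> complex^4^4" where
  "tri_rep a b d = columns4 (vec4 (a ^ 3) 0 0 0) (vec4 (- 3 * \<nu> * a\<^sup>2 * b) (a\<^sup>2 * d) 0 0)
     (vec4 (b ^ 3) (- 6 * \<nu>\<^sup>2 * b\<^sup>2 * d) (d ^ 3) (3 * \<nu> * b * d\<^sup>2))
     (vec4 (6 * \<nu>\<^sup>2 * a * b\<^sup>2) (- 4 * \<nu> * a * b * d) 0 (a * d\<^sup>2))"

lemma F_iso_nth: "F_iso p $ 1 = coeff p 0" "F_iso p $ 2 = - (coeff p 1 * (2 * \<nu>\<^sup>2))"
  "F_iso p $ 3 = coeff p 3" "F_iso p $ 4 = coeff p 2 * \<nu>"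
  by (simp_all add: F_iso_def axis_def cbrt_eqs)

lemma inj_F_iso: "inj_on F_iso Sym3"
proof (rule inj_onI)
  fix p q assume pq: "p \<in> Sym3" "q \<in> Sym3" "F_iso p = F_iso q"
  have eq: "coeff p 0 = coeff q 0" "coeff p 1 = coeff q 1" "coeff p 2 = coeff q 2" "coeff p 3 = coeff q 3"
    using arg_cong[OF pq(3), of "\<lambda>v. v $ 1"] arg_cong[OF pq(3), of "\<lambda>v. v $ 2"]
      arg_cong[OF pq(3), of "\<lambda>v. v $ 3"] arg_cong[OF pq(3), of "\<lambda>v. v $ 4"] \<nu>_cube(2)
    by (simp_all add: F_iso_nth cbrt_eqs)
  show "p = q"
  proof (rule poly_eqI)
    fix n :: nat
    consider "n = 0" | "n = 1" | "n = 2" | "n = 3" | "n > 3" by linarith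
    then show "coeff p n = coeff q n"
    proof cases
      case 5 then show ?thesis using pq(1,2) by (simp add: Sym3_def coeff_eq_0)
    qed (simp_all only: eq)
  qed
qed

lemma S_rep_upper:
  assumes "g $ 2 $ 1 = 0"
  shows "S_rep g = tri_rep (g$1$1) (g$1$2) (g$2$2)"
proof -
  have inv: "inv_into Sym3 F_iso v = p" if "degree p \<le> 3" "F_iso p = v" for p v
    using inv_into_f_f[OF inj_F_iso, of p] that by (simp add: Sym3_def)
  have 1: "inv_into Sym3 F_iso (e 1) = [:1:]"
    by (rule inv) (simp_all add: vec_eq_iff forall_4 F_iso_nth axis_def numeral_eq_Suc)
  \<comment> \<open>The coefficient is \<open>- 1 / (2 * \<nu>\<^sup>2)\<close>, which is
    \<open>- 3 * \<nu>\<close> because \<open>\<nu> ^ 3 = 1/6\<close>; likewise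
    \<open>1 / \<nu> = 6 * \<nu>\<^sup>2\<close> for \<open>e 4\<close>.\<close>
  have 2: "inv_into Sym3 F_iso (e 2) = [:0, - 3 * \<nu>:]"
    by (rule inv) (simp_all add: vec_eq_iff forall_4 F_iso_nth axis_def numeral_eq_Suc cbrt_eqs(1) \<nu>_cube)
  have 3: "inv_into Sym3 F_iso (e 3) = [:0, 0, 0, 1:]"
    by (rule inv) (simp_all add: vec_eq_iff forall_4 F_iso_nth axis_def numeral_eq_Suc)
  have 4: "inv_into Sym3 F_iso (e 4) = [:0, 0, 6 * \<nu>\<^sup>2:]"
    by (rule inv) (simp_all add: vec_eq_iff forall_4 F_iso_nth axis_def numeral_eq_Suc \<nu>_cube mult.assoc)
  define a b d where abd: "a = g$1$1" "b = g$1$2" "d = g$2$2"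
  have act: "sym3_act g p = (\<Sum>j\<le>3. smult (coeff p j) ([:a:] ^ (3 - j) * [:b, d:] ^ j))" for p
    by (simp add: sym3_act_def assms abd)
  have s: "{..3::nat} = {0, 1, 2, 3}" by auto
  have act': "sym3_act g p = smult (coeff p 0) [:a ^ 3:] + smult (coeff p 1) [:a\<^sup>2 * b, a\<^sup>2 * d:] +
      smult (coeff p 2) [:a * b\<^sup>2, 2 * a * b * d, a * d\<^sup>2:] +
      smult (coeff p 3) [:b ^ 3, 3 * b\<^sup>2 * d, 3 * b * d\<^sup>2, d ^ 3:]" for p
    unfolding act s by (simp add: power2_eq_square power3_eq_cube algebra_simps)
  have col: "F_iso (sym3_act g (inv_into Sym3 F_iso (e j))) $ i = tri_rep a b d $ i $ j" for i j
    using exhaust_4[of j] exhaust_4[of i]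
    by (elim disjE) (simp_all add: 1 2 3 4 act' F_iso_nth tri_rep_def numeral_eq_Suc \<nu>_cube algebra_simps)
  have "S_rep g = tri_rep a b d"
    unfolding S_rep_def matrix_def by (simp add: vec_eq_iff col)
  then show ?thesis by (simp add: abd)
qed

lemma H1_eq: "H1 = {tri_rep a b d | a b d. a * d = 1}"
proof (intro equalityI subsetI)
  fix h assume "h \<in> H1"
  then obtain g where g: "g \<in> SL2_1" "h = S_rep g" by (auto simp: H1_def)
  then have "g$1$1 * g$2$2 = 1" "g$2$1 = 0" by (auto simp: SL2_1_def det_2)
  then show "h \<in> {tri_rep a b d | a b d. a * d = 1}" using g(2) S_rep_upper by blast
next
  fix h assume "h \<in> {tri_rep a b d | a b d. a * d = 1}"
  then obtain a b d where abd: "h = tri_rep a b d" "a * d = 1" by blast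
  define g :: "complex^2^2" where "g = vector [vector [a, b], vector [0, d]]"
  have g: "g$1$1 = a" "g$1$2 = b" "g$2$1 = 0" "g$2$2 = d" by (simp_all add: g_def)
  then have "g \<in> SL2_1" using abd by (simp add: SL2_1_def det_2)
  moreover have "S_rep g = h" using S_rep_upper[of g] g abd by simp
  ultimately show "h \<in> H1" unfolding H1_def by blast
qed

lemma tri_rep_mult:
  "tri_rep a b d ** tri_rep a' b' d' = tri_rep (a * a') (a * b' + b * d') (d * d')"
proof -
  have "(tri_rep a b d ** tri_rep a' b' d') $ i $ j = tri_rep (a * a') (a * b' + b * d') (d * d') $ i $ j" for i j
    using exhaust_4[of j] exhaust_4[of i]
    by (elim disjE)
      (simp_all add: matrix_mult_4 tri_rep_def power2_eq_square power3_eq_cube algebra_simps \<nu>_cube)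
  then show ?thesis by (simp add: vec_eq_iff)
qed

lemma H1_mult: "g \<in> H1 \<Longrightarrow> h \<in> H1 \<Longrightarrow> g ** h \<in> H1"
  unfolding H1_eq
proof clarify
  fix a b d a' b' d' :: complex
  assume *: "a * d = 1" "a' * d' = 1"
  then have "(a * a') * (d * d') = 1" by algebra
  then show "\<exists>a'' b'' d''. tri_rep a b d ** tri_rep a' b' d' = tri_rep a'' b'' d'' \<and> a'' * d'' = 1"
    using tri_rep_mult by blast
qed

section \<open>Adapted sections of the canonical reduction\<close>

text \<open>The general value of the Maurer-Cartan form on the canonical reduction: of the ten
  parameters of the symplectic Lie algebra its six linear equations leave four, and
  \<open>t\<close>, \<open>s\<close>, \<open>u\<close>, \<open>w\<close> are the entries (2, 2), (4,
  2), (2, 4), (1, 3).\<close>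

definition mc_pattern :: "complex \<Rightarrow> complex \<Rightarrow> complex \<Rightarrow> complex \<Rightarrow> complex^4^4" where
  "mc_pattern t s u w = columns4 (vec4 (3 * t) s 0 0) (vec4 (3/4 * u) t 0 s)
     (vec4 w 0 (- 3 * t) (- 3/4 * u)) (vec4 0 u (- s) (- t))"

definition tri_rep_deriv ::
  "complex \<Rightarrow> complex \<Rightarrow> complex \<Rightarrow> complex \<Rightarrow> complex \<Rightarrow> complex \<Rightarrow> complex^4^4" where
  "tri_rep_deriv a b d a' b' d' = columns4 (vec4 (3 * a\<^sup>2 * a') 0 0 0)
     (vec4 (- 3 * \<nu> * (2 * a * a' * b + a\<^sup>2 * b')) (2 * a * a' * d + a\<^sup>2 * d') 0 0)
     (vec4 (3 * b\<^sup>2 * b') (- 6 * \<nu>\<^sup>2 * (2 * b * b' * d + b\<^sup>2 * d')) (3 * d\<^sup>2 * d')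
       (3 * \<nu> * (b' * d\<^sup>2 + 2 * b * d * d')))
     (vec4 (6 * \<nu>\<^sup>2 * (a' * b\<^sup>2 + 2 * a * b * b')) (- 4 * \<nu> * (a' * b * d + a * b' * d + a * b * d')) 0
       (a' * d\<^sup>2 + 2 * a * d * d'))"

text \<open>Change of gauge by \<open>h = tri_rep a b ai\<close>: the new form \<open>N'\<close>
  satisfies \<open>N h + h' = h N'\<close>. The prescribed derivatives of \<open>a\<close>,
  \<open>b\<close>, \<open>ai\<close> are those that annihilate the entries \<open>t\<close> and
  \<open>u\<close>. Since \<open>s\<close> gains the factor \<open>a\<^sup>2\<close> and
  \<open>w\<close> the factor \<open>ai ^ 6\<close>, the coefficient \<open>w * s ^ 3\<close> of the
  quartic differential is unchanged.\<close>

lemma gauge_identity: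
  assumes "a * ai = 1"
  shows "mc_pattern t s u w ** tri_rep a b ai +
      tri_rep_deriv a b ai (- (a * t) - \<nu> * a\<^sup>2 * s * b) (3/2 * \<nu>\<^sup>2 * u * ai - t * b) (t * ai + \<nu> * s * b)
    = tri_rep a b ai ** mc_pattern 0 (s * a\<^sup>2) 0 (w * ai ^ 6)"
proof -
  have r: "a * (ai * x) = x" for x using assms by (simp flip: mult.assoc)
  have p6: "ai ^ 6 = ai * (ai * (ai * (ai * (ai * ai))))" by (simp add: numeral_eq_Suc)
  have "(mc_pattern t s u w ** tri_rep a b ai +
      tri_rep_deriv a b ai (- (a * t) - \<nu> * a\<^sup>2 * s * b) (3/2 * \<nu>\<^sup>2 * u * ai - t * b) (t * ai + \<nu> * s * b)) $ i $ j
    = (tri_rep a b ai ** mc_pattern 0 (s * a\<^sup>2) 0 (w * ai ^ 6)) $ i $ j" for i j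
    using exhaust_4[of j] exhaust_4[of i]
    by (elim disjE)
      (simp_all add: matrix_mult_4 tri_rep_def mc_pattern_def tri_rep_deriv_def power2_eq_square
        power3_eq_cube p6 algebra_simps \<nu>_cube assms r)
  then show ?thesis by (simp add: vec_eq_iff)
qed

section \<open>Derivatives of matrix functions and of symplectic frames\<close>

lemma has_vec_deriv_vec4:
  assumes "(a has_field_derivative a') (at x)" "(b has_field_derivative b') (at x)"
    "(c has_field_derivative c') (at x)" "(d has_field_derivative d') (at x)"
  shows "has_vec_deriv (\<lambda>y. vec4 (a y) (b y) (c y) (d y)) (vec4 a' b' c' d') x"
  unfolding has_vec_deriv_def
proof
  fix i :: 4
  show "((\<lambda>y. vec4 (a y) (b y) (c y) (d y) $ i) has_field_derivative vec4 a' b' c' d' $ i) (at x)"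
    using exhaust_4[of i] assms by (elim disjE) simp_all
qed

definition has_mat_deriv :: "(complex \<Rightarrow> complex^4^4) \<Rightarrow> complex^4^4 \<Rightarrow> complex \<Rightarrow> bool" where
  "has_mat_deriv A D x \<longleftrightarrow> (\<forall>i j. ((\<lambda>y. A y $ i $ j) has_field_derivative D $ i $ j) (at x))"

lemma has_mat_deriv_imp: "has_mat_deriv A D x \<Longrightarrow> mat_deriv A x = D"
  by (auto simp: has_mat_deriv_def mat_deriv_def vec_eq_iff intro!: DERIV_imp_deriv)

lemma mat_holomorphic_imp_deriv:
  "mat_holomorphic_on A S \<Longrightarrow> open S \<Longrightarrow> x \<in> S \<Longrightarrow> has_mat_deriv A (mat_deriv A x) x"
  by (auto simp: mat_holomorphic_on_def has_mat_deriv_def mat_deriv_def intro: holomorphic_derivI)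

lemma has_mat_deriv_columns4:
  assumes "has_vec_deriv a a' x" "has_vec_deriv b b' x" "has_vec_deriv c c' x" "has_vec_deriv d d' x"
  shows "has_mat_deriv (\<lambda>y. columns4 (a y) (b y) (c y) (d y)) (columns4 a' b' c' d') x"
  unfolding has_mat_deriv_def
proof (intro allI)
  fix i j :: 4
  show "((\<lambda>y. columns4 (a y) (b y) (c y) (d y) $ i $ j) has_field_derivative
          columns4 a' b' c' d' $ i $ j) (at x)"
    using exhaust_4[of j] assms by (elim disjE) (simp_all add: has_vec_deriv_def)
qed

lemma has_mat_deriv_mult:
  assumes "has_mat_deriv A A' x" "has_mat_deriv B B' x"
  shows "has_mat_deriv (\<lambda>y. A y ** B y) (A' ** B x + A x ** B') x"
  unfolding has_mat_deriv_def
proof (intro allI)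
  fix i j :: 4
  have d: "((\<lambda>y. A y $ k $ l) has_field_derivative A' $ k $ l) (at x)"
    "((\<lambda>y. B y $ k $ l) has_field_derivative B' $ k $ l) (at x)" for k l
    using assms by (auto simp: has_mat_deriv_def)
  show "((\<lambda>y. (A y ** B y) $ i $ j) has_field_derivative (A' ** B x + A x ** B') $ i $ j) (at x)"
    unfolding matrix_mult_4
    by (rule DERIV_cong, (rule DERIV_add DERIV_mult d)+) (simp add: matrix_mult_4 algebra_simps)
qed

lemma has_mat_deriv_tri_rep:
  assumes "(a has_field_derivative a') (at x)" "(b has_field_derivative b') (at x)"
    "(d has_field_derivative d') (at x)"
  shows "has_mat_deriv (\<lambda>y. tri_rep (a y) (b y) (d y)) (tri_rep_deriv (a x) (b x) (d x) a' b' d') x"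
  unfolding tri_rep_def tri_rep_deriv_def
  by (intro has_mat_deriv_columns4 has_vec_deriv_vec4)
    (auto intro!: derivative_eq_intros assms simp: algebra_simps power2_eq_square)

lemma has_mat_deriv_columnD:
  assumes "has_mat_deriv A (A x ** N) x"
  shows "has_vec_deriv (\<lambda>y. A y *v e j) (A x *v (N *v e j)) x"
proof -
  have ax: "(B *v e j) $ i = B $ i $ j" for B :: "complex^4^4" and i j
    using exhaust_4[of j] by (elim disjE) (simp_all add: matrix_vector_4 axis_def)
  show ?thesis
    unfolding has_vec_deriv_def matrix_vector_mul_assoc ax
    using assms by (simp add: has_mat_deriv_def)
qed

text \<open>The pairings of the columns of a symplectic matrix are constant; differentiating them
  puts \<open>N\<close> into the symplectic Lie algebra, which in coordinates is this list of
  equations.\<close>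

lemma sp_pattern:
  assumes der: "has_mat_deriv A (A x ** N) x" and S: "open S" "x \<in> S" "\<And>y. y \<in> S \<Longrightarrow> A y \<in> Sp2"
  shows "N$3$3 = - N$1$1" "N$3$4 = - N$2$1" "N$4$3 = - N$1$2" "N$4$4 = - N$2$2"
    "N$3$2 = N$4$1" "N$2$3 = N$1$4"
proof -
  have *: "\<omega> (N *v e i) (e j) + \<omega> (e i) (N *v e j) = 0" for i j
  proof -
    have d1: "((\<lambda>y. \<omega> (A y *v e i) (A y *v e j)) has_field_derivative
        \<omega> (A x *v (N *v e i)) (A x *v e j) + \<omega> (A x *v e i) (A x *v (N *v e j))) (at x)"
      by (rule has_deriv_\<omega>[OF has_mat_deriv_columnD[OF der] has_mat_deriv_columnD[OF der]])
    have d2: "((\<lambda>y. \<omega> (A y *v e i) (A y *v e j)) has_field_derivative 0) (at x)"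
      by (rule has_field_derivative_transform_within_open[OF DERIV_const[of "\<omega> (e i) (e j)"] S(1,2)])
        (simp add: Sp2_\<omega>[OF S(3)])
    show ?thesis using DERIV_unique[OF d1 d2] by (simp add: Sp2_\<omega>[OF S(3)[OF S(2)]])
  qed
  show "N$3$3 = - N$1$1" "N$3$4 = - N$2$1" "N$4$3 = - N$1$2" "N$4$4 = - N$2$2"
    "N$3$2 = N$4$1" "N$2$3 = N$1$4"
    using *[of 1 3] *[of 1 4] *[of 2 3] *[of 2 4] *[of 1 2] *[of 3 4]
    by (simp_all add: \<omega>_def matrix_vector_4 axis_def eq_neg_iff_add_eq_0 add.commute)
qed

text \<open>In a symplectic frame the entries are pairings of columns with their derivatives, so the
  matrix inverse disappears and holomorphy of the forms becomes evident.\<close>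

lemma maurer_cartan_\<omega>:
  assumes "A x \<in> Sp2"
  shows "maurer_cartan A 2 2 x = \<omega> (mat_deriv A x *v e 2) (A x *v e 4)"
    "maurer_cartan A 4 2 x = - \<omega> (mat_deriv A x *v e 2) (A x *v e 2)"
    "maurer_cartan A 2 4 x = \<omega> (mat_deriv A x *v e 4) (A x *v e 4)"
proof -
  define N where "N = matrix_inv (A x) ** mat_deriv A x"
  have inv: "invertible (A x)" using assms by (simp add: Sp2_def)
  have "mat_deriv A x = A x ** N" by (simp add: N_def matrix_mul_assoc matrix_inv_mult[OF inv])
  then have "\<omega> (mat_deriv A x *v e i) (A x *v e j) = \<omega> (N *v e i) (e j)" for i j
    using Sp2_\<omega>[OF assms] by (simp flip: matrix_vector_mul_assoc)
  then show "maurer_cartan A 2 2 x = \<omega> (mat_deriv A x *v e 2) (A x *v e 4)"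
    "maurer_cartan A 4 2 x = - \<omega> (mat_deriv A x *v e 2) (A x *v e 2)"
    "maurer_cartan A 2 4 x = \<omega> (mat_deriv A x *v e 4) (A x *v e 4)"
    by (simp_all add: maurer_cartan_def flip: N_def, simp_all add: \<omega>_def matrix_vector_4 axis_def)
qed

lemma maurer_cartan_holomorphic:
  assumes A: "mat_holomorphic_on A S" "open S" "\<And>x. x \<in> S \<Longrightarrow> A x \<in> Sp2"
  shows "maurer_cartan A 2 2 holomorphic_on S" "maurer_cartan A 4 2 holomorphic_on S"
    "maurer_cartan A 2 4 holomorphic_on S"
proof -
  have ax: "(B *v e j) $ i = B $ i $ j" for B :: "complex^4^4" and i j
    using exhaust_4[of j] by (elim disjE) (simp_all add: matrix_vector_4 axis_def)
  have h: "vec_holomorphic_on (\<lambda>x. A x *v e j) S" "vec_holomorphic_on (\<lambda>x. mat_deriv A x *v e j) S" for j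
    using A(1,2) unfolding vec_holomorphic_on_def ax mat_deriv_def mat_holomorphic_on_def
    by (auto intro: holomorphic_deriv)
  show "maurer_cartan A 2 2 holomorphic_on S"
    by (rule holomorphic_transform[OF \<omega>_holomorphic[OF h(2)[of 2] h(1)[of 4]]])
      (simp add: maurer_cartan_\<omega>[OF A(3)])
  show "maurer_cartan A 4 2 holomorphic_on S"
    by (rule holomorphic_transform[OF holomorphic_on_minus[OF \<omega>_holomorphic[OF h(2)[of 2] h(1)[of 2]]]])
      (simp add: maurer_cartan_\<omega>[OF A(3)])
  show "maurer_cartan A 2 4 holomorphic_on S"
    by (rule holomorphic_transform[OF \<omega>_holomorphic[OF h(2)[of 4] h(1)[of 4]]])
      (simp add: maurer_cartan_\<omega>[OF A(3)])
qed

lemma mat_holomorphicI: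
  assumes "open S" "\<And>x. x \<in> S \<Longrightarrow> has_mat_deriv A (D x) x"
  shows "mat_holomorphic_on A S"
  using assms by (auto simp: mat_holomorphic_on_def has_mat_deriv_def holomorphic_on_open)

lemma section_restrict: "local_section R (U, z) A \<Longrightarrow> V \<subseteq> U \<Longrightarrow> local_section R (V, z) A"
  unfolding local_section_def mat_holomorphic_on_def prod.case
  using holomorphic_on_subset[OF _ image_mono[of V U z]] by blast

context isotropic
begin

lemma section_pattern:
  assumes R: "canonical_reduction X \<A> f R" and U: "(U, z) \<in> \<A>" and A: "local_section R (U, z) A"
    and x: "x \<in> z ` U"
  shows "A x \<in> Sp2" "maurer_cartan A 4 2 x \<noteq> 0"
    "has_mat_deriv A (A x ** mc_pattern (maurer_cartan A 2 2 x) (maurer_cartan A 4 2 x)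
       (maurer_cartan A 2 4 x) (maurer_cartan A 1 3 x)) x"
proof -
  obtain g where g: "H1_reduction \<A> (S_star X \<A> f g) f R"
    using R unfolding canonical_reduction_def by blast
  have sp: "A y \<in> Sp2" if y: "y \<in> z ` U" for y
  proof -
    obtain p where p: "p \<in> U" "y = z p" using y by blast
    then have "(p, A y) \<in> R" using A by (auto simp: local_section_def)
    then show ?thesis using g unfolding H1_reduction_def by blast
  qed
  show "A x \<in> Sp2" using sp x by blast
  then have inv: "invertible (A x)" by (simp add: Sp2_def)
  define N :: "complex^4^4" where "N = (\<chi> i j. maurer_cartan A i j x)"
  have hol: "mat_holomorphic_on A (z ` U)" using A by (simp add: local_section_def)
  have der: "has_mat_deriv A (A x ** N) x"
    using mat_holomorphic_imp_deriv[OF hol chartD(3)[OF U] x] mat_deriv_maurer_cartan[of A x, OF inv]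
    by (simp add: N_def)
  note sp = sp_pattern[OF der chartD(3)[OF U] x sp]
  have N: "N$3$1 = 0" "N$4$1 = 0" "N$2$1 = N$4$2" "N$1$1 = 3 * N$2$2" "4 * N$1$2 = 3 * N$2$4"
    "N$1$4 = 0" "N$4$2 \<noteq> 0"
    using R U A x unfolding canonical_reduction_def Let_def N_def by fastforce+
  show "maurer_cartan A 4 2 x \<noteq> 0" using N(7) by (simp add: N_def)
  have N12: "N$1$2 = 3/4 * N$2$4" using N(5) by (simp add: mult.commute)
  have "N $ i $ j = mc_pattern (N$2$2) (N$4$2) (N$2$4) (N$1$3) $ i $ j" for i j
    using exhaust_4[of j] exhaust_4[of i]
    by (elim disjE) (simp_all add: mc_pattern_def sp N(1-4,6) N12)
  then have "N = mc_pattern (N$2$2) (N$4$2) (N$2$4) (N$1$3)" unfolding vec_eq_iff by blast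
  then have "has_mat_deriv A (A x ** mc_pattern (N$2$2) (N$4$2) (N$2$4) (N$1$3)) x"
    using der by (rule subst)
  then show "has_mat_deriv A (A x ** mc_pattern (maurer_cartan A 2 2 x) (maurer_cartan A 4 2 x)
       (maurer_cartan A 2 4 x) (maurer_cartan A 1 3 x)) x"
    by (simp add: N_def)
qed

lemma section_gauge:
  assumes R: "canonical_reduction X \<A> f R" and A: "(q, B) \<in> R" and h: "h \<in> H1"
  shows "(q, B ** h) \<in> R"
proof -
  obtain g where g: "H1_reduction \<A> (S_star X \<A> f g) f R"
    using R unfolding canonical_reduction_def by blast
  then have "q \<in> S_star X \<A> f g" using A unfolding H1_reduction_def by blast
  then obtain C where C: "{B. (q, B) \<in> R} = (\<lambda>h. C ** h) ` H1"
    using g unfolding H1_reduction_def by blast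
  then obtain h0 where h0: "h0 \<in> H1" "B = C ** h0" using A by blast
  have "B ** h = C ** (h0 ** h)" by (simp add: h0 matrix_mul_assoc)
  then have "B ** h \<in> {B. (q, B) \<in> R}" unfolding C using H1_mult[OF h0(1) h] by blast
  then show ?thesis by simp
qed

text \<open>In complex dimension one a connection meets no integrability condition: a linear system
  moves any section along the fibres until \<open>t\<close> and \<open>u\<close> vanish, and a
  change of coordinate then makes \<open>s\<close> constant. The value \<open>- 1 / \<nu>\<close> is
  the one for which the connection pulls back to \<open>mat_unit 2 1\<close>, so the resulting chart
  is adapted.\<close>

lemma adapted_section:
  assumes R: "canonical_reduction X \<A> f R"
  obtains V z r A w x0 where "(V, z) \<in> \<A>" "z ` V = ball x0 r" "r > 0" "local_section R (V, z) A"
    "\<And>x. x \<in> z ` V \<Longrightarrow> has_mat_deriv A (A x ** mc_pattern 0 (- 1 / \<nu>) 0 (w x)) x"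
proof -
  obtain g where leg: "legendre_associate X \<A> f g" and g: "H1_reduction \<A> (S_star X \<A> f g) f R"
    using R unfolding canonical_reduction_def by blast
  obtain p where "p \<in> S_star X \<A> f g" using not_critical_somewhere[OF leg] by blast
  then obtain U z A where U: "(U, z) \<in> \<A>" "p \<in> U" and A: "local_section R (U, z) A"
    using g unfolding H1_reduction_def by fast
  obtain U1 r1 where U1: "(U1, z) \<in> \<A>" "p \<in> U1" "U1 \<subseteq> U" "r1 > 0" "z ` U1 = ball (z p) r1"
    using ball_chart[OF U chartD(1)[OF U(1)] U(2)] by metis
  define x0 where "x0 = z p"
  have A1: "local_section R (U1, z) A"
    by (rule section_restrict[OF A U1(3)])
  note pat = section_pattern[OF R U1(1) A1]
  define t s u w where "t = maurer_cartan A 2 2" and "s = maurer_cartan A 4 2"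
    and "u = maurer_cartan A 2 4" and "w = maurer_cartan A 1 3"
  have "mat_holomorphic_on A (z ` U1)" using A1 by (simp add: local_section_def)
  then have tsu: "t holomorphic_on ball x0 r1" "s holomorphic_on ball x0 r1" "u holomorphic_on ball x0 r1"
    unfolding t_def s_def u_def using maurer_cartan_holomorphic[of A "z ` U1"] pat(1) U1(5)
    by (auto simp: x0_def)
  \<comment> \<open>\<open>True\<close> stands for the unknown \<open>d\<close>,
    \<open>False\<close> for \<open>b\<close>; the coefficients are the derivatives demanded by
    \<open>gauge_identity\<close> with \<open>ai = d\<close>.\<close>
  define M where "M = (\<lambda>i j. if i then (if j then t else (\<lambda>x. \<nu> * s x))
       else (if j then (\<lambda>x. 3/2 * \<nu>\<^sup>2 * u x) else (\<lambda>x. - t x)))"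
  have M: "M i j holomorphic_on ball x0 r1" for i j
    by (cases i; cases j) (auto simp: M_def intro!: holomorphic_intros tsu)
  have "\<exists>\<rho> v. 0 < \<rho> \<and> \<rho> \<le> r1 \<and> (\<forall>i. v i x0 = (if i then 1 else 0)) \<and> (\<forall>i. \<forall>x\<in>ball x0 \<rho>.
       (v i has_field_derivative M i True x * v True x + M i False x * v False x) (at x))"
    by (rule linear_system_solution[of r1 M x0 "\<lambda>i. if i then 1 else 0", OF U1(4) M]) blast
  then obtain \<rho> v where \<rho>: "0 < \<rho>" "\<rho> \<le> r1" and v0: "\<And>i. v i x0 = (if i then 1 else 0)"
    and v: "\<And>i x. x \<in> ball x0 \<rho> \<Longrightarrow>
       (v i has_field_derivative M i True x * v True x + M i False x * v False x) (at x)"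
    by blast
  define d b where "d = v True" and "b = v False"
  have d': "(d has_field_derivative t x * d x + \<nu> * s x * b x) (at x)"
    and b': "(b has_field_derivative 3/2 * \<nu>\<^sup>2 * u x * d x - t x * b x) (at x)" if "x \<in> ball x0 \<rho>" for x
    using v[OF that, of True] v[OF that, of False] by (simp_all add: M_def d_def b_def)
  have dhol: "d holomorphic_on ball x0 \<rho>" unfolding holomorphic_on_open[OF open_ball] using d' by blast
  have "open (ball x0 \<rho> \<inter> d -` (- {0}))"
    using dhol by (intro continuous_open_preimage holomorphic_on_imp_continuous_on) auto
  moreover have "x0 \<in> ball x0 \<rho> \<inter> d -` (- {0})" using \<rho> v0 by (simp add: d_def)
  ultimately obtain \<rho>1 where \<rho>1: "\<rho>1 > 0" "ball x0 \<rho>1 \<subseteq> ball x0 \<rho> \<inter> d -` (- {0})"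
    using open_contains_ball by blast
  have d0: "d x \<noteq> 0" if "x \<in> ball x0 \<rho>1" for x using \<rho>1 that by auto
  have sub: "ball x0 \<rho>1 \<subseteq> ball x0 \<rho>" "ball x0 \<rho>1 \<subseteq> ball x0 r1" using \<rho>1(2) \<rho>(2) by auto
  have shol: "(\<lambda>x. - \<nu> * s x / (d x)\<^sup>2) holomorphic_on ball x0 \<rho>1"
    using d0 by (intro holomorphic_intros holomorphic_on_subset[OF tsu(2)] holomorphic_on_subset[OF dhol] sub) auto
  \<comment> \<open>In the new gauge the entry (4, 2) is \<open>s / d\<^sup>2\<close>; taking this
    primitive as coordinate divides it by \<open>- \<nu> * s / d\<^sup>2\<close> and leaves
    \<open>- 1 / \<nu>\<close>.\<close>
  obtain \<psi> where \<psi>: "\<And>x. x \<in> ball x0 \<rho>1 \<Longrightarrow> (\<psi> has_field_derivative - \<nu> * s x / (d x)\<^sup>2) (at x)"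
    using bounded_primitive[OF shol \<rho>1(1)] by blast
  have \<psi>hol: "\<psi> holomorphic_on ball x0 \<rho>1" unfolding holomorphic_on_open[OF open_ball] using \<psi> by blast
  have s0: "s x \<noteq> 0" if "x \<in> ball x0 \<rho>1" for x
    using pat(2)[of x] that sub(2) U1(5) by (auto simp: s_def x0_def)
  have \<psi>0: "- \<nu> * s x / (d x)\<^sup>2 \<noteq> 0" if "x \<in> ball x0 \<rho>1" for x
    using s0[OF that] d0[OF that] \<nu>_cube(2) by simp
  have x0B: "x0 \<in> ball x0 \<rho>1" using \<rho>1 by simp
  then have "deriv \<psi> x0 \<noteq> 0" using \<psi>[OF x0B] \<psi>0[OF x0B] by (simp add: DERIV_imp_deriv)
  then obtain r2 where r2: "r2 > 0" "ball x0 r2 \<subseteq> ball x0 \<rho>1" "inj_on \<psi> (ball x0 r2)"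
    using has_complex_derivative_locally_injective[OF \<psi>hol x0B open_ball] by metis
  have \<psi>hol2: "\<psi> holomorphic_on ball x0 r2" by (rule holomorphic_on_subset[OF \<psi>hol r2(2)])
  obtain k where khol: "k holomorphic_on \<psi> ` ball x0 r2"
    and k': "\<And>x. x \<in> ball x0 r2 \<Longrightarrow> deriv \<psi> x * deriv k (\<psi> x) = 1"
    and k: "\<And>x. x \<in> ball x0 r2 \<Longrightarrow> k (\<psi> x) = x"
    using holomorphic_has_inverse[OF \<psi>hol2 open_ball r2(3)] by metis
  have op: "open (\<psi> ` ball x0 r2)" by (rule open_mapping_thm3[OF \<psi>hol2 open_ball r2(3)])
  define V0 where "V0 = {q \<in> U1. z q \<in> ball x0 r2}"
  have V0: "openin X V0" "V0 \<subseteq> U1" unfolding V0_def using open_chart_preimage[OF U1(1) open_ball] by blast+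
  have "ball x0 r2 \<subseteq> z ` U1" using r2(2) sub(2) U1(5) unfolding x0_def by blast
  then have zV0: "z ` V0 = ball x0 r2" unfolding V0_def by blast
  have W: "(V0, \<psi> \<circ> z) \<in> \<A>"
    by (rule chart_change[OF U1(1) V0]) (simp_all only: zV0 \<psi>hol2 r2(3))
  have imW: "(\<psi> \<circ> z) ` V0 = \<psi> ` ball x0 r2" unfolding image_comp[symmetric] zV0 ..
  define B where "B = (\<lambda>x. A x ** tri_rep (1 / d x) (b x) (d x))"
  have Bd: "has_mat_deriv B (B x ** mc_pattern 0 (s x * (1 / d x)\<^sup>2) 0 (w x * d x ^ 6)) x"
    if x: "x \<in> ball x0 r2" for x
  proof -
    have x1: "x \<in> ball x0 \<rho>1" "x \<in> ball x0 \<rho>" "x \<in> z ` U1"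
      using x r2(2) sub U1(5) unfolding x0_def by blast+
    have inv1: "1 / d x * d x = 1" using d0[OF x1(1)] by simp
    have ad: "((\<lambda>y. 1 / d y) has_field_derivative - (1 / d x * t x) - \<nu> * (1 / d x)\<^sup>2 * s x * b x) (at x)"
      using d0[OF x1(1)]
      by (rule_tac DERIV_cong[OF DERIV_divide[OF DERIV_const[of 1] d'[OF x1(2)]]])
        (simp_all add: field_simps power2_eq_square)
    have "has_mat_deriv B ((A x ** mc_pattern (t x) (s x) (u x) (w x)) ** tri_rep (1 / d x) (b x) (d x)
        + A x ** tri_rep_deriv (1 / d x) (b x) (d x) (- (1 / d x * t x) - \<nu> * (1 / d x)\<^sup>2 * s x * b x)
           (3/2 * \<nu>\<^sup>2 * u x * d x - t x * b x) (t x * d x + \<nu> * s x * b x)) x"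
      unfolding B_def
      by (rule has_mat_deriv_mult[OF _ has_mat_deriv_tri_rep[OF ad b'[OF x1(2)] d'[OF x1(2)]]])
        (use pat(3)[OF x1(3)] in \<open>simp add: t_def s_def u_def w_def\<close>)
    then show ?thesis
      unfolding matrix_mul_assoc[symmetric] matrix_add_ldistrib[symmetric] gauge_identity[OF inv1]
      unfolding B_def matrix_mul_assoc .
  qed
  define C where "C = (\<lambda>\<xi>. B (k \<xi>))"
  define w1 where "w1 = (\<lambda>\<xi>. (w (k \<xi>) * d (k \<xi>) ^ 6) / (- \<nu> * s (k \<xi>) / (d (k \<xi>))\<^sup>2))"
  have Cd: "has_mat_deriv C (C \<xi> ** mc_pattern 0 (- 1 / \<nu>) 0 (w1 \<xi>)) \<xi>" if \<xi>: "\<xi> \<in> \<psi> ` ball x0 r2" for \<xi>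
  proof -
    obtain x where x: "x \<in> ball x0 r2" "\<xi> = \<psi> x" using \<xi> by blast
    define c where "c = - \<nu> * s x / (d x)\<^sup>2"
    have x1: "x \<in> ball x0 \<rho>1" using x(1) r2(2) by blast
    have "deriv \<psi> x = c" using \<psi>[OF x1] by (simp add: c_def DERIV_imp_deriv)
    have c0: "c \<noteq> 0" using \<psi>0[OF x1] by (simp add: c_def)
    then have "deriv k \<xi> = 1 / c" using k'[OF x(1)] \<open>deriv \<psi> x = c\<close> x(2) by (simp add: field_simps)
    then have kd: "(k has_field_derivative 1 / c) (at \<xi>)"
      using holomorphic_derivI[OF khol op \<xi>] by simp
    have kx: "k \<xi> = x" using k[OF x(1)] x(2) by simp
    define N where "N = mc_pattern 0 (s x * (1 / d x)\<^sup>2) 0 (w x * d x ^ 6)"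
    have N: "N $ i $ j * (1 / c) = mc_pattern 0 (- 1 / \<nu>) 0 (w1 \<xi>) $ i $ j" for i j
    proof -
      have "s x * (1 / d x)\<^sup>2 / c = - 1 / \<nu>"
        using s0[OF x1] d0[OF x1] \<nu>_cube(2) by (simp add: c_def power_divide field_simps)
      moreover have "w x * d x ^ 6 / c = w1 \<xi>" by (simp add: w1_def kx c_def)
      ultimately show ?thesis
        using exhaust_4[of j] exhaust_4[of i] by (elim disjE) (simp_all add: N_def mc_pattern_def)
    qed
    show ?thesis
      unfolding has_mat_deriv_def
    proof (intro allI)
      fix i j
      have "((\<lambda>y. B y $ i $ j) has_field_derivative (B x ** N) $ i $ j) (at (k \<xi>))"
        using Bd[OF x(1)] unfolding kx by (simp add: has_mat_deriv_def N_def)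
      from DERIV_chain2[OF this kd]
      have "((\<lambda>y. C y $ i $ j) has_field_derivative (B x ** N) $ i $ j * (1 / c)) (at \<xi>)"
        by (simp add: C_def)
      moreover have "(B x ** N) $ i $ j * (1 / c) = (C \<xi> ** mc_pattern 0 (- 1 / \<nu>) 0 (w1 \<xi>)) $ i $ j"
        unfolding matrix_mult_4 N[symmetric] C_def kx by (simp add: algebra_simps add_divide_distrib)
      ultimately show "((\<lambda>y. C y $ i $ j) has_field_derivative
          (C \<xi> ** mc_pattern 0 (- 1 / \<nu>) 0 (w1 \<xi>)) $ i $ j) (at \<xi>)" by simp
    qed
  qed
  have sec: "local_section R (V0, \<psi> \<circ> z) C"
    unfolding local_section_def prod.case
  proof (intro conjI ballI)
    show "mat_holomorphic_on C ((\<psi> \<circ> z) ` V0)"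
      unfolding imW by (rule mat_holomorphicI[OF op Cd])
    fix q assume q: "q \<in> V0"
    then have zq: "z q \<in> ball x0 r2" "q \<in> U1" by (auto simp: V0_def)
    have "(q, A (z q)) \<in> R" using A1 zq(2) by (auto simp: local_section_def)
    moreover have "tri_rep (1 / d (z q)) (b (z q)) (d (z q)) \<in> H1"
    proof -
      have "1 / d (z q) * d (z q) = 1" using d0 zq r2(2) by auto
      then show ?thesis unfolding H1_eq by blast
    qed
    ultimately have "(q, B (z q)) \<in> R" unfolding B_def by (rule section_gauge[OF R])
    then show "(q, C ((\<psi> \<circ> z) q)) \<in> R" using k[OF zq(1)] by (simp add: C_def)
  qed
  have "\<psi> x0 \<in> (\<psi> \<circ> z) ` V0" unfolding imW using r2(1) by auto
  then obtain V r where V: "(V, \<psi> \<circ> z) \<in> \<A>" "V \<subseteq> V0" "r > 0" "(\<psi> \<circ> z) ` V = ball (\<psi> x0) r"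
    using ball_chart_in[OF W, of "\<psi> x0" "(\<psi> \<circ> z) ` V0"] op imW by (metis order_refl)
  have secV: "local_section R (V, \<psi> \<circ> z) C"
    by (rule section_restrict[OF sec V(2)])
  show thesis
  proof (rule that[OF V(1,4,3) secV])
    fix x assume "x \<in> (\<psi> \<circ> z) ` V"
    then have "x \<in> \<psi> ` ball x0 r2" using V(2) imW by blast
    then show "has_mat_deriv C (C x ** mc_pattern 0 (- 1 / \<nu>) 0 (w1 x)) x" by (rule Cd)
  qed
qed

end

section \<open>The constant coefficient equation of a curve with constant bending\<close>

text \<open>
  With \<open>Z = \<sigma>\<^sup>8\<close> and the new parameter \<open>\<zeta>\<close>, \<open>d\<zeta> = \<sigma>\<^sup>2 dx\<close>, in which the quartic differential is
  \<open>d\<zeta>\<^sup>4\<close>, the equation \<open>y'''' + Z y = 0\<close> acquires constant coefficients for the unknown \<open>\<sigma>\<^sup>3 y\<close>. The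
  following combinations are its successive derivatives with respect to \<open>\<zeta>\<close>.
\<close>

lemma reparametrized_jets:
  fixes \<sigma> \<tau> \<rho> y0 y1 y2 y3 :: "complex \<Rightarrow> complex"
  assumes d: "(\<sigma> has_field_derivative - (\<sigma> x)\<^sup>2 * \<rho> x) (at x)" "(\<tau> has_field_derivative \<rho> x) (at x)"
    "(\<rho> has_field_derivative p * \<sigma> x ^ 3) (at x)"
    "(y0 has_field_derivative y1 x) (at x)" "(y1 has_field_derivative y2 x) (at x)"
    "(y2 has_field_derivative y3 x) (at x)" "(y3 has_field_derivative - (\<sigma> x ^ 8) * y0 x) (at x)"
    and inv: "\<sigma> x * \<tau> x = 1"
  defines "Y0 \<equiv> \<lambda>x. \<sigma> x ^ 3 * y0 x"
    and "Y1 \<equiv> \<lambda>x. \<sigma> x * y1 x + (- 3 * \<rho> x * (\<sigma> x)\<^sup>2) * y0 x"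
    and "Y2 \<equiv> \<lambda>x. \<tau> x * y2 x + (- 4 * \<rho> x) * y1 x + (6 * (\<rho> x)\<^sup>2 * \<sigma> x - 3 * p * \<sigma> x ^ 3) * y0 x"
    and "Y3 \<equiv> \<lambda>x. \<tau> x ^ 3 * y3 x + (- 3 * \<rho> x * (\<tau> x)\<^sup>2) * y2 x + (6 * (\<rho> x)\<^sup>2 * \<tau> x - 7 * p * \<sigma> x) * y1 x
            + (21 * \<rho> x * p * (\<sigma> x)\<^sup>2 - 6 * \<rho> x ^ 3) * y0 x"
  shows "(Y0 has_field_derivative (\<sigma> x)\<^sup>2 * Y1 x) (at x)"
    and "(Y1 has_field_derivative (\<sigma> x)\<^sup>2 * Y2 x) (at x)"
    and "(Y2 has_field_derivative (\<sigma> x)\<^sup>2 * Y3 x) (at x)"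
    and "(Y3 has_field_derivative (\<sigma> x)\<^sup>2 * (- (10 * p) * Y2 x - (9 * p\<^sup>2 + 1) * Y0 x)) (at x)"
proof -
  note di = derivative_eq_intros d
  have r: "\<sigma> x * (\<tau> x * c) = c" for c using inv by (simp flip: mult.assoc)
  have p8: "\<sigma> x ^ 8 = \<sigma> x * (\<sigma> x * (\<sigma> x * (\<sigma> x * (\<sigma> x * (\<sigma> x * (\<sigma> x * \<sigma> x))))))"
    by (simp add: numeral_eq_Suc)
  note alg = power2_eq_square power3_eq_cube algebra_simps inv r p8
  show "(Y0 has_field_derivative (\<sigma> x)\<^sup>2 * Y1 x) (at x)"
    unfolding Y0_def Y1_def by (rule di refl)+ (simp add: alg)
  show "(Y1 has_field_derivative (\<sigma> x)\<^sup>2 * Y2 x) (at x)"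
    unfolding Y1_def Y2_def by (rule di refl)+ (simp add: alg)
  show "(Y2 has_field_derivative (\<sigma> x)\<^sup>2 * Y3 x) (at x)"
    unfolding Y2_def Y3_def by (rule di refl)+ (simp add: alg)
  show "(Y3 has_field_derivative (\<sigma> x)\<^sup>2 * (- (10 * p) * Y2 x - (9 * p\<^sup>2 + 1) * Y0 x)) (at x)"
    unfolding Y0_def Y2_def Y3_def by (rule di refl)+ (simp add: alg)
qed

text \<open>In terms of a logarithm \<open>L\<close> of \<open>Z\<close>, the projective operator
  gives \<open>S = L''/2 - L'\<^sup>2/16\<close>, and the inverse eighth root \<open>\<tau>\<close>
  of \<open>Z\<close> satisfies \<open>\<tau>'' = - S \<tau> / 4\<close>. Constant bending says that
  \<open>S \<tau>\<^sup>4\<close> has the constant square \<open>\<kappa>\<close>, so it is itself a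
  constant, \<open>- 4 p\<close>, and \<open>\<tau>'' = p / \<tau>\<^sup>3\<close>. An eighth root
  occurs because the unknown is multiplied by the power 3/2 of \<open>d\<zeta>/dx\<close>, itself a
  fourth root.\<close>

lemma bending_normal_form:
  fixes Z :: "complex \<Rightarrow> complex"
  assumes Z: "Z holomorphic_on ball x0 r" "\<And>x. x \<in> ball x0 r \<Longrightarrow> Z x \<noteq> 0" and r: "r > 0"
    and eq: "\<And>x. x \<in> ball x0 r \<Longrightarrow>
      (1/2 * (deriv (deriv Z) x / Z x) - 9/16 * ((deriv Z x)\<^sup>2 / (Z x)\<^sup>2))\<^sup>2 = \<kappa> * Z x"
  shows "\<exists>\<sigma> \<tau> \<rho> p. 16 * p\<^sup>2 = \<kappa> \<and> (\<forall>x\<in>ball x0 r. \<sigma> x * \<tau> x = 1 \<and> Z x = \<sigma> x ^ 8 \<and>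
      (\<sigma> has_field_derivative - (\<sigma> x)\<^sup>2 * \<rho> x) (at x) \<and> (\<tau> has_field_derivative \<rho> x) (at x) \<and>
      (\<rho> has_field_derivative p * \<sigma> x ^ 3) (at x))"
proof -
  let ?B = "ball x0 r"
  obtain L where Lhol: "L holomorphic_on ?B" and L: "\<And>x. x \<in> ?B \<Longrightarrow> Z x = exp (L x)"
    using contractible_imp_holomorphic_log[OF Z(1) convex_imp_contractible[OF convex_ball] Z(2)] by metis
  define L1 L2 where "L1 = deriv L" and "L2 = deriv L1"
  have L1hol: "L1 holomorphic_on ?B" unfolding L1_def by (intro holomorphic_deriv Lhol) auto
  have L2hol: "L2 holomorphic_on ?B" unfolding L2_def by (intro holomorphic_deriv L1hol) auto
  have dL: "(L has_field_derivative L1 x) (at x)" "(L1 has_field_derivative L2 x) (at x)" if "x \<in> ?B" for x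
    using holomorphic_derivI[OF Lhol open_ball that] holomorphic_derivI[OF L1hol open_ball that]
    by (auto simp: L1_def L2_def)
  have Z1: "deriv Z x = exp (L x) * L1 x" if x: "x \<in> ?B" for x
  proof (rule DERIV_imp_deriv, rule has_field_derivative_transform_within_open[OF _ open_ball x])
    show "((\<lambda>x. exp (L x)) has_field_derivative exp (L x) * L1 x) (at x)"
      using dL[OF x] by (auto intro!: derivative_eq_intros)
  qed (use L in auto)
  have Z2: "deriv (deriv Z) x = exp (L x) * (L2 x + (L1 x)\<^sup>2)" if x: "x \<in> ?B" for x
  proof (rule DERIV_imp_deriv, rule has_field_derivative_transform_within_open[OF _ open_ball x])
    show "((\<lambda>x. exp (L x) * L1 x) has_field_derivative exp (L x) * (L2 x + (L1 x)\<^sup>2)) (at x)"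
      using dL[OF x] by (auto intro!: derivative_eq_intros simp: algebra_simps power2_eq_square)
  qed (use Z1 in auto)
  define S where "S = (\<lambda>x. L2 x / 2 - (L1 x)\<^sup>2 / 16)"
  have S: "(S x)\<^sup>2 = \<kappa> * exp (L x)" if x: "x \<in> ?B" for x
  proof -
    have "1/2 * (deriv (deriv Z) x / Z x) - 9/16 * ((deriv Z x)\<^sup>2 / (Z x)\<^sup>2) = S x"
      unfolding Z1[OF x] Z2[OF x] L[OF x] S_def by (simp add: power_mult_distrib field_simps)
    then show ?thesis using eq[OF x] L[OF x] by simp
  qed
  define \<tau> \<sigma> \<rho> where "\<tau> = (\<lambda>x. exp (- L x / 8))" and "\<sigma> = (\<lambda>x. exp (L x / 8))"
    and "\<rho> = (\<lambda>x. - (L1 x / 8) * exp (- L x / 8))"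
  define h where "h = (\<lambda>x. S x * (\<tau> x) ^ 4)"
  have pw: "exp (u / 8) ^ 8 = exp u" "exp (- u / 8) ^ 8 = exp (- u)" for u :: complex
    by (simp_all flip: exp_of_nat_mult)
  have \<tau>8: "\<tau> x ^ 8 = exp (- L x)" for x unfolding \<tau>_def by (rule pw)
  have hhol: "h holomorphic_on ?B"
    unfolding h_def S_def \<tau>_def by (intro holomorphic_intros L1hol L2hol Lhol) auto
  have h2: "(h x)\<^sup>2 = \<kappa>" if x: "x \<in> ?B" for x
  proof -
    have "(h x)\<^sup>2 = (S x)\<^sup>2 * \<tau> x ^ 8" by (simp add: h_def power_mult_distrib flip: power_mult)
    also have "\<dots> = \<kappa>" unfolding S[OF x] \<tau>8 by (simp add: exp_minus field_simps)
    finally show ?thesis .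
  qed
  define c where "c = csqrt \<kappa>"
  have c: "c\<^sup>2 = \<kappa>" by (simp add: c_def)
  \<comment> \<open>A holomorphic square root of a constant on a connected set keeps one
    sign.\<close>
  have "(\<forall>x\<in>?B. h x - c = 0) \<or> (\<forall>x\<in>?B. h x + c = 0)"
  proof (rule holomorphic_mult_zero)
    show "(h x - c) * (h x + c) = 0" if "x \<in> ?B" for x
      using h2[OF that] c by (simp add: algebra_simps power2_eq_square)
  qed (auto intro!: holomorphic_intros hhol)
  then obtain c0 where c0: "\<And>x. x \<in> ?B \<Longrightarrow> h x = c0" "c0\<^sup>2 = \<kappa>"
  proof
    assume "\<forall>x\<in>?B. h x - c = 0" with c that[of c] show thesis by simp
  next
    assume "\<forall>x\<in>?B. h x + c = 0" with c that[of "- c"] show thesis by (simp add: eq_neg_iff_add_eq_0)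
  qed
  define p where "p = - c0 / 4"
  have "16 * p\<^sup>2 = \<kappa>" using c0(2) by (simp add: p_def power_divide)
  moreover have "\<sigma> x * \<tau> x = 1 \<and> Z x = \<sigma> x ^ 8 \<and>
      (\<sigma> has_field_derivative - (\<sigma> x)\<^sup>2 * \<rho> x) (at x) \<and> (\<tau> has_field_derivative \<rho> x) (at x) \<and>
      (\<rho> has_field_derivative p * \<sigma> x ^ 3) (at x)" if x: "x \<in> ?B" for x
  proof (intro conjI)
    show st: "\<sigma> x * \<tau> x = 1" by (simp add: \<sigma>_def \<tau>_def flip: exp_add)
    show "Z x = \<sigma> x ^ 8" using L[OF x] pw(1) by (simp add: \<sigma>_def)
    have "(\<sigma> has_field_derivative (L1 x / 8) * \<sigma> x) (at x)"
      unfolding \<sigma>_def using dL[OF x] by (auto intro!: derivative_eq_intros)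
    moreover have "(L1 x / 8) * \<sigma> x = - (\<sigma> x)\<^sup>2 * \<rho> x"
    proof -
      have "- (\<sigma> x)\<^sup>2 * \<rho> x = (L1 x / 8) * \<sigma> x * (\<sigma> x * \<tau> x)"
        by (simp add: \<rho>_def \<tau>_def power2_eq_square)
      then show ?thesis using st by simp
    qed
    ultimately show "(\<sigma> has_field_derivative - (\<sigma> x)\<^sup>2 * \<rho> x) (at x)" by simp
    show "(\<tau> has_field_derivative \<rho> x) (at x)"
      unfolding \<tau>_def \<rho>_def using dL[OF x] by (auto intro!: derivative_eq_intros)
    have "(\<rho> has_field_derivative - (L2 x / 8) * \<tau> x + (L1 x)\<^sup>2 / 64 * \<tau> x) (at x)"
      unfolding \<rho>_def \<tau>_def using dL[OF x]
      by (auto intro!: derivative_eq_intros simp: power2_eq_square diff_divide_distrib)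
    moreover have "- (L2 x / 8) * \<tau> x + (L1 x)\<^sup>2 / 64 * \<tau> x = p * \<sigma> x ^ 3"
    proof -
      have "p * \<sigma> x ^ 3 = - (S x / 4) * \<tau> x * (\<sigma> x * \<tau> x) ^ 3"
        using c0(1)[OF x] by (simp add: p_def h_def power_mult_distrib numeral_eq_Suc algebra_simps)
      then show ?thesis unfolding st by (simp add: S_def algebra_simps diff_divide_distrib add_divide_distrib)
    qed
    ultimately show "(\<rho> has_field_derivative p * \<sigma> x ^ 3) (at x)" by simp
  qed
  ultimately show ?thesis by blast
qed

lemma mc_pattern_axis:
  "mc_pattern 0 s 0 w *v e 1 = s *s e 2" "mc_pattern 0 s 0 w *v e 2 = s *s e 4"
  "mc_pattern 0 s 0 w *v e 4 = (- s) *s e 3" "mc_pattern 0 s 0 w *v e 3 = w *s e 1"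
  by (simp_all add: mc_pattern_def columns4_axis vec4_def)

text \<open>The jets of the constant coefficient equation, in a chart given by the parameter \<open>\<zeta>\<close>.\<close>

definition jets :: "complex \<Rightarrow> complex set \<Rightarrow> (nat \<Rightarrow> complex \<Rightarrow> complex^4) \<Rightarrow> bool" where
  "jets p S Y \<longleftrightarrow> (\<forall>x\<in>S.
     has_vec_deriv (Y 0) (Y 1 x) x \<and> has_vec_deriv (Y 1) (Y 2 x) x \<and> has_vec_deriv (Y 2) (Y 3 x) x \<and>
     has_vec_deriv (Y 3) ((- (10 * p)) *s Y 2 x - (9 * p\<^sup>2 + 1) *s Y 0 x) x \<and>
     \<omega> (Y 0 x) (Y 1 x) = 0 \<and> \<omega> (Y 0 x) (Y 2 x) = 0 \<and> \<omega> (Y 0 x) (Y 3 x) = 6 \<and>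
     \<omega> (Y 1 x) (Y 2 x) = - 6 \<and> \<omega> (Y 1 x) (Y 3 x) = 0 \<and> \<omega> (Y 2 x) (Y 3 x) = - 60 * p)"

context isotropic
begin

text \<open>The disc shrinks to carry an adapted section, then to avoid the zeros of the quartic
  differential, then to make the primitive \<open>\<psi>\<close> of \<open>\<sigma>\<^sup>2\<close>,
  which is the parameter \<open>\<zeta>\<close>, injective. The order matters: the bending equation
  is formulated in adapted charts, so it is exploited before passing to
  \<open>\<zeta>\<close>.\<close>

lemma constant_coefficient_chart:
  assumes cb: "constant_bending X \<A> f \<kappa>"
  obtains V z r x0 p Y where "(V, z) \<in> \<A>" "z ` V = ball x0 r" "r > 0" "16 * p\<^sup>2 = \<kappa>"
    "jets p (ball x0 r) Y" "\<And>q. q \<in> V \<Longrightarrow> f q = vec.span {Y 0 (z q), Y 1 (z q)}"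
proof -
  obtain R \<delta> Q where R: "canonical_reduction X \<A> f R" and \<delta>: "quartic_differential \<A> R \<delta>"
    and nz: "\<not> zero_differential \<A> \<delta>" and Q: "frak_d \<A> (local_section R) eta_coeff \<delta> Q"
    and \<kappa>: "\<And>U z. (U, z) \<in> \<A> \<Longrightarrow> \<forall>\<^sub>\<approx>x\<in>z ` U. (Q (U, z) x)\<^sup>2 / \<delta> (U, z) x = \<kappa>"
    using cb unfolding constant_bending_def by blast
  obtain V z r A w x0 where V: "(V, z) \<in> \<A>" "z ` V = ball x0 r" "r > 0" and sec: "local_section R (V, z) A"
    and A': "\<And>x. x \<in> z ` V \<Longrightarrow> has_mat_deriv A (A x ** mc_pattern 0 (- 1 / \<nu>) 0 (w x)) x"
    using adapted_section[OF R] by metis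
  define s0 where "s0 = - 1 / \<nu>"
  have s0: "s0 ^ 3 = - 6" unfolding s0_def power_divide \<nu>_cube(1) by simp
  have sp: "A x \<in> Sp2" if "x \<in> z ` V" for x using section_pattern(1)[OF R V(1) sec that] .
  have mc: "maurer_cartan A i j x = mc_pattern 0 s0 0 (w x) $ i $ j" if "x \<in> z ` V" for x i j
    using sp[OF that] has_mat_deriv_imp[OF A'[OF that]]
    by (intro maurer_cartan_eqI) (simp_all add: Sp2_def s0_def)
  have "eta_coeff A x = mat_unit 2 1" if x: "x \<in> z ` V" for x
  proof -
    have "\<nu> * s0 = - 1" using \<nu>_cube(2) by (simp add: s0_def)
    then show ?thesis
      by (simp add: eta_coeff_def mc[OF x] mc_pattern_def cbrt_eqs vec_eq_iff)
  qed
  then have adapted: "adapted_chart (local_section R) eta_coeff (V, z)"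
    using sec by (auto simp: adapted_chart_def)
  define Z where "Z = \<delta> (V, z)"
  have Zw: "Z x = - 6 * w x" if x: "x \<in> z ` V" for x
  proof -
    have "Z x = maurer_cartan A 1 3 x * (maurer_cartan A 4 2 x)^3"
      using \<delta> V(1) sec x unfolding quartic_differential_def Z_def by blast
    then show ?thesis by (simp add: mc[OF x] mc_pattern_def s0)
  qed
  define a where "a = (\<lambda>j x. A x *v e j)"
  have a': "has_vec_deriv (a 1) (s0 *s a 2 x) x" "has_vec_deriv (a 2) (s0 *s a 4 x) x"
    "has_vec_deriv (a 4) ((- s0) *s a 3 x) x" "has_vec_deriv (a 3) (w x *s a 1 x) x" if "x \<in> ball x0 r" for x
  proof -
    have x: "x \<in> z ` V" using that V(2) by simp
    note * = has_mat_deriv_columnD[OF A'[OF x, folded s0_def]]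
    show "has_vec_deriv (a 1) (s0 *s a 2 x) x" "has_vec_deriv (a 2) (s0 *s a 4 x) x"
      "has_vec_deriv (a 4) ((- s0) *s a 3 x) x" "has_vec_deriv (a 3) (w x *s a 1 x) x"
      using *[of 1] *[of 2] *[of 3] *[of 4]
      by (simp_all only: a_def mc_pattern_axis matrix_vector_scale)
  qed
  have gram: "\<omega> (a i x) (a j x) = \<omega> (e i) (e j)" if "x \<in> ball x0 r" for i j x
    using Sp2_\<omega>[OF sp[of x]] that V(2) by (simp add: a_def)
  have ahol: "vec_holomorphic_on (a 3) (ball x0 r)" by (rule vec_holomorphicI[OF open_ball a'(4)])
  \<comment> \<open>The entry \<open>w\<close> comes without regularity; it is recovered as the
    pairing of the derivative of \<open>a 3\<close> with \<open>a 3\<close>.\<close>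
  have "w holomorphic_on ball x0 r"
  proof (rule holomorphic_transform[OF \<omega>_holomorphic[OF vec_deriv_holomorphic[OF ahol open_ball] ahol]])
    fix x assume x: "x \<in> ball x0 r"
    have "\<omega> (a 1 x) (a 3 x) = 1" unfolding gram[OF x] by (simp add: \<omega>_def axis_def)
    then show "\<omega> (vec_deriv (a 3) x) (a 3 x) = w x"
      using has_vec_deriv_imp[OF a'(4)[OF x]] by simp
  qed
  then have "(\<lambda>x. - 6 * w x) holomorphic_on ball x0 r" by (intro holomorphic_intros)
  then have Zhol: "Z holomorphic_on ball x0 r"
    by (rule holomorphic_transform) (use Zw V(2) in auto)
  have mero: "meromorphic_differential \<A> 4 \<delta>" using \<delta> by (simp add: quartic_differential_def)
  \<comment> \<open>General type is a global condition; the identity theorem makes it visible on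
    this disc.\<close>
  have "\<exists>x1\<in>ball x0 r. Z x1 \<noteq> 0"
  proof (rule ccontr)
    assume "\<not> ?thesis"
    then have "Z x = 0" if "x \<in> ball x0 r" for x using that by blast
    then have "eventually (\<lambda>x. \<delta> (V, z) x = 0) (at x0)"
      using eventually_at_in_open'[OF open_ball, of x0 x0 r] V(3) unfolding Z_def
      by (auto elim!: eventually_mono)
    moreover obtain p where "p \<in> V" "x0 = z p" using V(2,3) by (metis centre_in_ball imageE)
    ultimately show False using zero_differentialI[OF mero V(1)] nz by blast
  qed
  then obtain x1 where x1: "x1 \<in> ball x0 r" "Z x1 \<noteq> 0" by blast
  have "open (ball x0 r \<inter> Z -` (- {0}))"
    using Zhol by (intro continuous_open_preimage holomorphic_on_imp_continuous_on) auto
  then obtain r1 where r1: "r1 > 0" "ball x1 r1 \<subseteq> ball x0 r \<inter> Z -` (- {0})"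
    using x1 open_contains_ball by (metis ComplI IntI singletonD vimageI)
  let ?B = "ball x1 r1"
  have Bsub: "?B \<subseteq> ball x0 r" and Z0: "\<And>x. x \<in> ?B \<Longrightarrow> Z x \<noteq> 0" using r1(2) by auto
  have ZholB: "Z holomorphic_on ?B" by (rule holomorphic_on_subset[OF Zhol Bsub])
  define G where "G = (\<lambda>x. 1/2 * (deriv (deriv Z) x / Z x) - 9/16 * ((deriv Z x)\<^sup>2 / (Z x)\<^sup>2))"
  have Ghol: "(\<lambda>x. (G x)\<^sup>2 - \<kappa> * Z x) holomorphic_on ?B"
    unfolding G_def by (intro holomorphic_intros holomorphic_deriv ZholB open_ball) (use Z0 in auto)
  have opV: "open (z ` V)" by (rule chartD(3)[OF V(1)])
  have x1V: "x1 \<in> z ` V" using x1 V(2) by simp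
  have "\<forall>\<^sub>\<approx>x\<in>z ` V. Q (V, z) x = G x"
    using Q nz adapted V(1) unfolding frak_d_def Let_def G_def Z_def by auto
  then have "eventually (\<lambda>x. Q (V, z) x = G x) (at x1)"
    using eventually_cosparse_open_eq[OF opV] x1V by blast
  moreover have "eventually (\<lambda>x. (Q (V, z) x)\<^sup>2 / Z x = \<kappa>) (at x1)"
    using \<kappa>[OF V(1)] eventually_cosparse_open_eq[OF opV] x1V unfolding Z_def by blast
  moreover have "eventually (\<lambda>x. x \<in> ?B) (at x1)"
    using eventually_at_in_open'[OF open_ball, of x1 x1 r1] r1(1) by simp
  ultimately have "eventually (\<lambda>x. (G x)\<^sup>2 - \<kappa> * Z x = 0) (at x1)"
    by eventually_elim (use Z0 in \<open>auto simp: field_simps\<close>)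
  then obtain S where S: "open S" "x1 \<in> S" "\<And>x. x \<in> S \<Longrightarrow> x \<noteq> x1 \<Longrightarrow> (G x)\<^sup>2 - \<kappa> * Z x = 0"
    unfolding eventually_at_topological by blast
  \<comment> \<open>\<open>Q\<close> and the bending are known only off sparse sets, but
    \<open>G\<close> is holomorphic, so the equation on a punctured neighbourhood of
    \<open>x1\<close> extends to the whole disc.\<close>
  have "(G x)\<^sup>2 - \<kappa> * Z x = 0" if x: "x \<in> ?B" for x
  proof (rule holomorphic_zero_continuation[OF Ghol open_ball connected_ball _ _ _ _ x])
    show "open (S \<inter> ?B - {x1})" using S(1) by (intro open_Diff open_Int) auto
    show "S \<inter> ?B - {x1} \<noteq> {}"
    proof
      assume "S \<inter> ?B - {x1} = {}"
      then have "S \<inter> ?B = {x1}" using S(2) r1(1) by auto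
      moreover have "open (S \<inter> ?B)" using S(1) by (intro open_Int) auto
      ultimately show False using not_open_singleton[of x1] by simp
    qed
  qed (use S(3) in auto)
  then have "\<exists>\<sigma> \<tau> \<rho> p. 16 * p\<^sup>2 = \<kappa> \<and> (\<forall>x\<in>?B. \<sigma> x * \<tau> x = 1 \<and> Z x = \<sigma> x ^ 8 \<and>
      (\<sigma> has_field_derivative - (\<sigma> x)\<^sup>2 * \<rho> x) (at x) \<and> (\<tau> has_field_derivative \<rho> x) (at x) \<and>
      (\<rho> has_field_derivative p * \<sigma> x ^ 3) (at x))"
    by (intro bending_normal_form[OF ZholB Z0 r1(1)]) (auto simp: G_def)
  then obtain \<sigma> \<tau> \<rho> p where p: "16 * p\<^sup>2 = \<kappa>"
    and st: "\<And>x. x \<in> ?B \<Longrightarrow> \<sigma> x * \<tau> x = 1" and Z\<sigma>: "\<And>x. x \<in> ?B \<Longrightarrow> Z x = \<sigma> x ^ 8"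
    and d: "\<And>x. x \<in> ?B \<Longrightarrow> (\<sigma> has_field_derivative - (\<sigma> x)\<^sup>2 * \<rho> x) (at x)"
      "\<And>x. x \<in> ?B \<Longrightarrow> (\<tau> has_field_derivative \<rho> x) (at x)"
      "\<And>x. x \<in> ?B \<Longrightarrow> (\<rho> has_field_derivative p * \<sigma> x ^ 3) (at x)"
    by blast
  \<comment> \<open>Columns of the section, scaled so that each is the derivative of the preceding
    one; the factor 6 is \<open>- s0 ^ 3\<close>.\<close>
  define y0 y1 y2 y3 where "y0 = a 1" and "y1 = (\<lambda>x. s0 *s a 2 x)" and "y2 = (\<lambda>x. s0\<^sup>2 *s a 4 x)"
    and "y3 = (\<lambda>x. 6 *s a 3 x)"
  have y': "has_vec_deriv y0 (y1 x) x" "has_vec_deriv y1 (y2 x) x" "has_vec_deriv y2 (y3 x) x"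
    "has_vec_deriv y3 ((- (\<sigma> x ^ 8)) *s y0 x) x" if x: "x \<in> ?B" for x
  proof -
    have xr: "x \<in> ball x0 r" using x Bsub by blast
    have scl: "has_vec_deriv (\<lambda>y. c *s u y) (c *s D) x" if "has_vec_deriv u D x" for c u D
      using has_vec_deriv_scale[OF that DERIV_const[of c]] by simp
    show "has_vec_deriv y0 (y1 x) x" using a'(1)[OF xr] by (simp add: y0_def y1_def)
    show "has_vec_deriv y1 (y2 x) x"
      using scl[OF a'(2)[OF xr], of s0] by (simp add: y1_def y2_def power2_eq_square)
    have s06: "s0\<^sup>2 * (- s0) = 6" using s0 by (simp add: power2_eq_square power3_eq_cube)
    show "has_vec_deriv y2 (y3 x) x"
      using scl[OF a'(3)[OF xr], of "s0\<^sup>2"] unfolding vec.scale_scale s06 y2_def y3_def .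
    have "6 * w x = - (\<sigma> x ^ 8)" using Zw[of x] Z\<sigma>[OF x] xr V(2) by simp
    then show "has_vec_deriv y3 ((- (\<sigma> x ^ 8)) *s y0 x) x"
      using scl[OF a'(4)[OF xr], of 6] by (simp add: y3_def y0_def)
  qed
  \<comment> \<open>The factor \<open>\<sigma>\<^sup>3\<close> is the power 3/2 of
    \<open>d\<zeta>/dx\<close>, which removes the third order term of the transformed
    equation.\<close>
  define Y :: "nat \<Rightarrow> complex \<Rightarrow> complex^4" where "Y = (\<lambda>k x.
     if k = 0 then \<sigma> x ^ 3 *s y0 x
     else if k = 1 then \<sigma> x *s y1 x + (- 3 * \<rho> x * (\<sigma> x)\<^sup>2) *s y0 x
     else if k = 2 then \<tau> x *s y2 x + (- 4 * \<rho> x) *s y1 x + (6 * (\<rho> x)\<^sup>2 * \<sigma> x - 3 * p * \<sigma> x ^ 3) *s y0 x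
     else \<tau> x ^ 3 *s y3 x + (- 3 * \<rho> x * (\<tau> x)\<^sup>2) *s y2 x + (6 * (\<rho> x)\<^sup>2 * \<tau> x - 7 * p * \<sigma> x) *s y1 x
            + (21 * \<rho> x * p * (\<sigma> x)\<^sup>2 - 6 * \<rho> x ^ 3) *s y0 x)"
  have Yc: "Y 0 x $ i = \<sigma> x ^ 3 * y0 x $ i"
    "Y 1 x $ i = \<sigma> x * y1 x $ i + (- 3 * \<rho> x * (\<sigma> x)\<^sup>2) * y0 x $ i"
    "Y 2 x $ i = \<tau> x * y2 x $ i + (- 4 * \<rho> x) * y1 x $ i + (6 * (\<rho> x)\<^sup>2 * \<sigma> x - 3 * p * \<sigma> x ^ 3) * y0 x $ i"
    "Y 3 x $ i = \<tau> x ^ 3 * y3 x $ i + (- 3 * \<rho> x * (\<tau> x)\<^sup>2) * y2 x $ i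
       + (6 * (\<rho> x)\<^sup>2 * \<tau> x - 7 * p * \<sigma> x) * y1 x $ i
       + (21 * \<rho> x * p * (\<sigma> x)\<^sup>2 - 6 * \<rho> x ^ 3) * y0 x $ i" for x i
    by (simp_all add: Y_def algebra_simps)
  have Yd: "has_vec_deriv (Y 0) ((\<sigma> x)\<^sup>2 *s Y 1 x) x" "has_vec_deriv (Y 1) ((\<sigma> x)\<^sup>2 *s Y 2 x) x"
    "has_vec_deriv (Y 2) ((\<sigma> x)\<^sup>2 *s Y 3 x) x"
    "has_vec_deriv (Y 3) ((\<sigma> x)\<^sup>2 *s ((- (10 * p)) *s Y 2 x - (9 * p\<^sup>2 + 1) *s Y 0 x)) x"
    if x: "x \<in> ?B" for x
  proof -
    have "((\<lambda>x. y0 x $ i) has_field_derivative y1 x $ i) (at x)"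
      "((\<lambda>x. y1 x $ i) has_field_derivative y2 x $ i) (at x)"
      "((\<lambda>x. y2 x $ i) has_field_derivative y3 x $ i) (at x)"
      "((\<lambda>x. y3 x $ i) has_field_derivative - (\<sigma> x ^ 8) * (y0 x $ i)) (at x)" for i
      using y'[OF x] by (auto simp: has_vec_deriv_def)
    note jet = reparametrized_jets[OF d(1)[OF x] d(2)[OF x] d(3)[OF x] this st[OF x]]
    show "has_vec_deriv (Y 0) ((\<sigma> x)\<^sup>2 *s Y 1 x) x"
      unfolding has_vec_deriv_def vector_smult_component vector_minus_component Yc by (intro allI) (rule jet(1))
    show "has_vec_deriv (Y 1) ((\<sigma> x)\<^sup>2 *s Y 2 x) x"
      unfolding has_vec_deriv_def vector_smult_component vector_minus_component Yc by (intro allI) (rule jet(2))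
    show "has_vec_deriv (Y 2) ((\<sigma> x)\<^sup>2 *s Y 3 x) x"
      unfolding has_vec_deriv_def vector_smult_component vector_minus_component Yc by (intro allI) (rule jet(3))
    show "has_vec_deriv (Y 3) ((\<sigma> x)\<^sup>2 *s ((- (10 * p)) *s Y 2 x - (9 * p\<^sup>2 + 1) *s Y 0 x)) x"
      unfolding has_vec_deriv_def vector_smult_component vector_minus_component Yc by (intro allI) (rule jet(4))
  qed
  have Ygram: "\<omega> (Y 0 x) (Y 1 x) = 0" "\<omega> (Y 0 x) (Y 2 x) = 0" "\<omega> (Y 0 x) (Y 3 x) = 6"
     "\<omega> (Y 1 x) (Y 2 x) = - 6" "\<omega> (Y 1 x) (Y 3 x) = 0" "\<omega> (Y 2 x) (Y 3 x) = - 60 * p" if x: "x \<in> ?B" for x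
  proof -
    have xr: "x \<in> ball x0 r" using x Bsub by blast
    have s03: "s0 * s0\<^sup>2 = - 6" "s0\<^sup>2 * s0 = - 6" using s0 by (simp_all add: power2_eq_square power3_eq_cube mult.assoc)
    have g: "\<omega> (y0 x) (y1 x) = 0" "\<omega> (y0 x) (y2 x) = 0" "\<omega> (y0 x) (y3 x) = 6" "\<omega> (y1 x) (y2 x) = - 6"
      "\<omega> (y1 x) (y3 x) = 0" "\<omega> (y2 x) (y3 x) = 0"
      by (simp_all add: y0_def y1_def y2_def y3_def gram[OF xr] s03, simp_all add: \<omega>_def axis_def s03)
    have g': "\<omega> (y1 x) (y0 x) = 0" "\<omega> (y2 x) (y0 x) = 0" "\<omega> (y3 x) (y0 x) = - 6" "\<omega> (y2 x) (y1 x) = 6"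
      "\<omega> (y3 x) (y1 x) = 0" "\<omega> (y3 x) (y2 x) = 0"
      using g \<omega>_commute[of "y1 x" "y0 x"] \<omega>_commute[of "y2 x" "y0 x"] \<omega>_commute[of "y3 x" "y0 x"]
        \<omega>_commute[of "y2 x" "y1 x"] \<omega>_commute[of "y3 x" "y1 x"] \<omega>_commute[of "y3 x" "y2 x"] by simp_all
    have r: "\<sigma> x * (\<tau> x * c) = c" for c using st[OF x] by (simp flip: mult.assoc)
    show "\<omega> (Y 0 x) (Y 1 x) = 0" "\<omega> (Y 0 x) (Y 2 x) = 0" "\<omega> (Y 0 x) (Y 3 x) = 6"
     "\<omega> (Y 1 x) (Y 2 x) = - 6" "\<omega> (Y 1 x) (Y 3 x) = 0" "\<omega> (Y 2 x) (Y 3 x) = - 60 * p"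
      by (simp_all add: Y_def g g' st[OF x] r power2_eq_square power3_eq_cube algebra_simps)
  qed
  have \<sigma>hol: "\<sigma> holomorphic_on ?B" unfolding holomorphic_on_open[OF open_ball] using d(1) by blast
  have s2hol: "(\<lambda>x. (\<sigma> x)\<^sup>2) holomorphic_on ?B" by (intro holomorphic_intros \<sigma>hol)
  obtain \<psi> where \<psi>: "\<And>x. x \<in> ?B \<Longrightarrow> (\<psi> has_field_derivative (\<sigma> x)\<^sup>2) (at x)"
    using bounded_primitive[OF s2hol r1(1)] by blast
  have \<psi>hol: "\<psi> holomorphic_on ?B" unfolding holomorphic_on_open[OF open_ball] using \<psi> by blast
  have \<sigma>0: "\<sigma> x \<noteq> 0" if "x \<in> ?B" for x using st[OF that] by auto
  have x1B: "x1 \<in> ?B" using r1 by simp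
  then have "deriv \<psi> x1 \<noteq> 0" using \<psi>[OF x1B] \<sigma>0[OF x1B] by (simp add: DERIV_imp_deriv)
  then obtain r2 where r2: "r2 > 0" "ball x1 r2 \<subseteq> ?B" "inj_on \<psi> (ball x1 r2)"
    using has_complex_derivative_locally_injective[OF \<psi>hol x1B open_ball] by metis
  have \<psi>hol2: "\<psi> holomorphic_on ball x1 r2" by (rule holomorphic_on_subset[OF \<psi>hol r2(2)])
  obtain k where khol: "k holomorphic_on \<psi> ` ball x1 r2"
    and k': "\<And>x. x \<in> ball x1 r2 \<Longrightarrow> deriv \<psi> x * deriv k (\<psi> x) = 1"
    and k: "\<And>x. x \<in> ball x1 r2 \<Longrightarrow> k (\<psi> x) = x"
    using holomorphic_has_inverse[OF \<psi>hol2 open_ball r2(3)] by metis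
  have op: "open (\<psi> ` ball x1 r2)" by (rule open_mapping_thm3[OF \<psi>hol2 open_ball r2(3)])
  define V0 where "V0 = {q \<in> V. z q \<in> ball x1 r2}"
  have V0: "openin X V0" "V0 \<subseteq> V" unfolding V0_def using open_chart_preimage[OF V(1) open_ball] by blast+
  have "ball x1 r2 \<subseteq> z ` V" using r2(2) Bsub V(2) by blast
  then have zV0: "z ` V0 = ball x1 r2" unfolding V0_def by blast
  have W: "(V0, \<psi> \<circ> z) \<in> \<A>"
    by (rule chart_change[OF V(1) V0]) (simp_all only: zV0 \<psi>hol2 r2(3))
  have imW: "(\<psi> \<circ> z) ` V0 = \<psi> ` ball x1 r2" unfolding image_comp[symmetric] zV0 ..
  have kd: "(k has_field_derivative 1 / (\<sigma> (k \<xi>))\<^sup>2) (at \<xi>)" "k \<xi> \<in> ?B" if \<xi>: "\<xi> \<in> \<psi> ` ball x1 r2" for \<xi>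
  proof -
    obtain x where x: "x \<in> ball x1 r2" "\<xi> = \<psi> x" using \<xi> by blast
    have xB: "x \<in> ?B" using x(1) r2(2) by blast
    have "(\<sigma> x)\<^sup>2 * deriv k \<xi> = 1" using k'[OF x(1)] \<psi>[OF xB] x(2) by (simp add: DERIV_imp_deriv)
    then have "deriv k \<xi> = 1 / (\<sigma> x)\<^sup>2" using \<sigma>0[OF xB] by (simp add: field_simps)
    then show "(k has_field_derivative 1 / (\<sigma> (k \<xi>))\<^sup>2) (at \<xi>)" "k \<xi> \<in> ?B"
      using holomorphic_derivI[OF khol op \<xi>] k[OF x(1)] x(2) xB by simp_all
  qed
  define Y' where "Y' = (\<lambda>n \<xi>. Y n (k \<xi>))"
  have Y'd: "has_vec_deriv (Y' n) D \<xi>" if "\<xi> \<in> \<psi> ` ball x1 r2" "has_vec_deriv (Y n) ((\<sigma> (k \<xi>))\<^sup>2 *s D) (k \<xi>)" for n D \<xi>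
    using has_vec_deriv_compose[OF that(2) kd(1)[OF that(1)]] \<sigma>0[OF kd(2)[OF that(1)]] by (simp add: Y'_def)
  have jets: "jets p (\<psi> ` ball x1 r2) Y'"
    unfolding jets_def
  proof (intro ballI conjI)
    fix \<xi> assume \<xi>: "\<xi> \<in> \<psi> ` ball x1 r2"
    note kB = kd(2)[OF \<xi>]
    show "has_vec_deriv (Y' 0) (Y' 1 \<xi>) \<xi>" "has_vec_deriv (Y' 1) (Y' 2 \<xi>) \<xi>" "has_vec_deriv (Y' 2) (Y' 3 \<xi>) \<xi>"
      "has_vec_deriv (Y' 3) ((- (10 * p)) *s Y' 2 \<xi> - (9 * p\<^sup>2 + 1) *s Y' 0 \<xi>) \<xi>"
      using Y'd[OF \<xi> Yd(1)[OF kB]] Y'd[OF \<xi> Yd(2)[OF kB]] Y'd[OF \<xi> Yd(3)[OF kB]]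
        Y'd[OF \<xi> Yd(4)[OF kB]] by (simp_all only: Y'_def)
    show "\<omega> (Y' 0 \<xi>) (Y' 1 \<xi>) = 0" "\<omega> (Y' 0 \<xi>) (Y' 2 \<xi>) = 0" "\<omega> (Y' 0 \<xi>) (Y' 3 \<xi>) = 6"
      "\<omega> (Y' 1 \<xi>) (Y' 2 \<xi>) = - 6" "\<omega> (Y' 1 \<xi>) (Y' 3 \<xi>) = 0" "\<omega> (Y' 2 \<xi>) (Y' 3 \<xi>) = - 60 * p"
      unfolding Y'_def by (rule Ygram[OF kB])+
  qed
  have fY: "f q = vec.span {Y' 0 ((\<psi> \<circ> z) q), Y' 1 ((\<psi> \<circ> z) q)}" if q: "q \<in> V0" for q
  proof -
    let ?x = "z q"
    have zq: "?x \<in> ball x1 r2" "q \<in> V" using q by (auto simp: V0_def)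
    then have xB: "?x \<in> ?B" using r2(2) by blast
    have "(q, A ?x) \<in> R" using sec zq(2) by (auto simp: local_section_def)
    moreover obtain g where "H1_reduction \<A> (S_star X \<A> f g) f R"
      using R unfolding canonical_reduction_def by blast
    ultimately have fq: "f q = vec.span {a 1 ?x, a 2 ?x}"
      unfolding H1_reduction_def plane_of_def a_def by blast
    have Q3: "f q \<in> Q3" using f_Q3 chartD(2)[OF V(1)] zq(2) by blast
    have "Y 0 ?x = \<sigma> ?x ^ 3 *s a 1 ?x + 0 *s a 2 ?x"
      "Y 1 ?x = (- 3 * \<rho> ?x * (\<sigma> ?x)\<^sup>2) *s a 1 ?x + (\<sigma> ?x * s0) *s a 2 ?x"
      by (simp_all add: Y_def y0_def y1_def add.commute)
    then have "Y 0 ?x \<in> f q" "Y 1 ?x \<in> f q" unfolding fq in_span2 by blast+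
    moreover have "indep2 (Y 0 ?x) (Y 1 ?x)"
      unfolding indep2_def
    proof (intro allI impI)
      fix s t assume "s *s Y 0 ?x + t *s Y 1 ?x = 0"
      then have "\<omega> (s *s Y 0 ?x + t *s Y 1 ?x) (Y 3 ?x) = 0" "\<omega> (s *s Y 0 ?x + t *s Y 1 ?x) (Y 2 ?x) = 0"
        by simp_all
      then show "s = 0 \<and> t = 0" using Ygram[OF xB] by simp
    qed
    ultimately have "f q = vec.span {Y 0 ?x, Y 1 ?x}"
      using Q3 by (intro plane_eq_span) (auto simp: Q3_def)
    then show ?thesis using k[OF zq(1)] by (simp add: Y'_def)
  qed
  have "\<psi> x1 \<in> (\<psi> \<circ> z) ` V0" unfolding imW using r2(1) by auto
  then obtain V1 r3 where V1: "(V1, \<psi> \<circ> z) \<in> \<A>" "V1 \<subseteq> V0" "r3 > 0" "(\<psi> \<circ> z) ` V1 = ball (\<psi> x1) r3"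
    using ball_chart_in[OF W, of "\<psi> x1" "(\<psi> \<circ> z) ` V0"] op imW by (metis order_refl)
  have "ball (\<psi> x1) r3 \<subseteq> \<psi> ` ball x1 r2" using V1(2,4) imW by blast
  then have "jets p (ball (\<psi> x1) r3) Y'" using jets unfolding jets_def by blast
  from that[OF V1(1,4,3) p this] fY V1(2) show thesis by blast
qed

end

section \<open>Meromorphic functions on a Riemann surface\<close>

lemma cross_multiply:
  fixes a b f f' g g' :: "'a :: field"
  assumes "a * g * f' = b * f * g'" "f \<noteq> 0" "g \<noteq> 0"
  shows "a * (f' * inverse f) = b * (g' * inverse g)"
  using assms by (simp add: field_simps)

text \<open>As in the library, the values of a meromorphic function on a sparse set are irrelevant.\<close>

definition in_chart :: "('a \<Rightarrow> complex) \<Rightarrow> 'a chart \<Rightarrow> complex \<Rightarrow> complex" where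
  "in_chart F c x = F (inv_into (fst c) (snd c) x)"

lemma in_chart_abs: "in_chart F c = (\<lambda>x. F (inv_into (fst c) (snd c) x))"
  by (simp add: in_chart_def fun_eq_iff)

context riemann
begin

definition mero :: "('a \<Rightarrow> complex) \<Rightarrow> bool" where
  "mero F \<longleftrightarrow> (\<forall>c\<in>\<A>. in_chart F c meromorphic_on snd c ` fst c)"

lemma meroD: "mero F \<Longrightarrow> (U, z) \<in> \<A> \<Longrightarrow> in_chart F (U, z) meromorphic_on z ` U"
  by (force simp: mero_def)

lemma in_chart_eq [simp]: "(U, z) \<in> \<A> \<Longrightarrow> p \<in> U \<Longrightarrow> in_chart F (U, z) (z p) = F p"
  by (simp add: in_chart_def)

lemma mero_const: "mero (\<lambda>_. c)"
  by (auto simp: mero_def in_chart_abs intro: meromorphic_intros)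

lemma mero_mult: "mero F \<Longrightarrow> mero G \<Longrightarrow> mero (\<lambda>p. F p * G p)"
  unfolding mero_def in_chart_abs by (auto intro!: meromorphic_intros)

lemma mero_powi: "mero F \<Longrightarrow> mero (\<lambda>p. F p powi k)"
  unfolding mero_def in_chart_abs by (auto intro!: meromorphic_intros)

lemma in_chart_transition:
  assumes "(U, z) \<in> \<A>" "(V, w) \<in> \<A>" "x \<in> w ` (U \<inter> V)"
  shows "in_chart F (V, w) x = in_chart F (U, z) (transition (U, z) (V, w) x)"
proof -
  obtain q where "q \<in> U" "q \<in> V" "x = w q" using assms(3) by blast
  then show ?thesis using assms by simp
qed

lemma eventually_overlap:
  assumes "(U, z) \<in> \<A>" "(V, w) \<in> \<A>" "p \<in> U" "p \<in> V"
  shows "eventually (\<lambda>x. x \<in> w ` (U \<inter> V)) (at (w p))"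
proof -
  have "w p \<in> w ` (U \<inter> V)" using assms by auto
  from eventually_at_in_open'[OF open_overlap[OF assms(1,2)] this] show ?thesis .
qed

lemma filterlim_in_chart_transfer:
  assumes "(U, z) \<in> \<A>" "(V, w) \<in> \<A>" "p \<in> U" "p \<in> V" "filterlim (in_chart F (U, z)) L (at (z p))"
  shows "filterlim (in_chart F (V, w)) L (at (w p))"
proof -
  let ?T = "transition (U, z) (V, w)"
  have wp: "w p \<in> w ` (U \<inter> V)" using assms by auto
  have "filterlim ?T (at (z p)) (at (w p))"
    using transition_filterlim[OF assms(1,2) wp] assms by simp
  from filterlim_compose[OF assms(5) this]
  show ?thesis
    by (rule filterlim_cong[OF refl refl, THEN iffD2, rotated])
      (use eventually_overlap[OF assms(1-4)] in
        \<open>eventually_elim, auto simp: in_chart_transition[OF assms(1,2)]\<close>)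
qed

lemma analytic_near:
  assumes "mero F" "(U, z) \<in> \<A>" "p \<in> U"
  shows "eventually (\<lambda>x. in_chart F (U, z) analytic_on {x}) (at (z p))"
  using meromorphic_on_imp_analytic_cosparse[OF meroD[OF assms(1,2)]]
    eventually_cosparse_open_eq[OF chartD(3)[OF assms(2)]] assms(3) by blast

lemma eventually_cosparseI:
  "open A \<Longrightarrow> (\<And>x. x \<in> A \<Longrightarrow> eventually P (at x)) \<Longrightarrow> eventually P (cosparse A)"
  using eventually_cosparse_open_eq by blast

lemma mero_imp_differential:
  assumes "mero F" shows "meromorphic_differential \<A> 0 (in_chart F)"
  unfolding meromorphic_differential_def
proof (intro conjI)
  show "\<forall>(U, z)\<in>\<A>. in_chart F (U, z) meromorphic_on z ` U" using meroD[OF assms] by blast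
  have "\<forall>\<^sub>\<approx>x\<in>w ` (U \<inter> V). in_chart F (V, w) x = in_chart F (U, z) (transition (U, z) (V, w) x)
     * deriv (transition (U, z) (V, w)) x ^ 0" if UV: "(U, z) \<in> \<A>" "(V, w) \<in> \<A>" for U z V w
  proof (rule eventually_cosparseI[OF open_overlap[OF UV]])
    fix x assume "x \<in> w ` (U \<inter> V)"
    from eventually_at_in_open'[OF open_overlap[OF UV] this]
    show "\<forall>\<^sub>F x in at x. in_chart F (V, w) x = in_chart F (U, z) (transition (U, z) (V, w) x)
     * deriv (transition (U, z) (V, w)) x ^ 0"
      by eventually_elim (simp add: in_chart_transition[OF UV])
  qed
  then show "\<forall>(U, z)\<in>\<A>. \<forall>(V, w)\<in>\<A>. \<forall>\<^sub>\<approx>x\<in>w ` (U \<inter> V). in_chart F (V, w) x =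
     in_chart F (U, z) (transition (U, z) (V, w) x) * deriv (transition (U, z) (V, w)) x ^ 0" by blast
qed

text \<open>The form \<open>A dF + B dG\<close>. A differential relation between two functions is
  the vanishing of such a form, which the identity theorem carries over the surface.\<close>

definition one_form :: "('a \<Rightarrow> complex) \<Rightarrow> ('a \<Rightarrow> complex) \<Rightarrow> ('a \<Rightarrow> complex) \<Rightarrow> ('a \<Rightarrow> complex) \<Rightarrow> 'a differential"
  where "one_form A F B G c x = in_chart A c x * deriv (in_chart F c) x + in_chart B c x * deriv (in_chart G c) x"

text \<open>The chain rule, restricted to a punctured neighbourhood because \<open>F\<close> may
  fail to be analytic at isolated points.\<close>

lemma deriv_in_chart_transition:
  assumes F: "mero F" and UV: "(U, z) \<in> \<A>" "(V, w) \<in> \<A>" "x \<in> w ` (U \<inter> V)"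
  shows "\<forall>\<^sub>F x in at x. deriv (in_chart F (V, w)) x =
     deriv (in_chart F (U, z)) (transition (U, z) (V, w) x) * deriv (transition (U, z) (V, w)) x"
proof -
  let ?T = "transition (U, z) (V, w)"
  obtain p where p: "p \<in> U" "p \<in> V" "x = w p" using UV by blast
  have "filterlim ?T (at (z p)) (at x)"
    using transition_filterlim[OF UV] p UV by simp
  then have "eventually (\<lambda>x. in_chart F (U, z) analytic_on {?T x}) (at x)"
    using eventually_compose_filterlim[OF analytic_near[OF F UV(1) p(1)]] by blast
  moreover have "eventually (\<lambda>x. x \<in> w ` (U \<inter> V)) (at x)"
    by (rule eventually_at_in_open'[OF open_overlap[OF UV(1,2)] UV(3)])
  ultimately show ?thesis
  proof eventually_elim
    case (elim y)
    have "(in_chart F (U, z) has_field_derivative deriv (in_chart F (U, z)) (?T y)) (at (?T y))"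
      using analytic_on_imp_differentiable_at[OF elim(1)] by (simp add: DERIV_deriv_iff_field_differentiable)
    from DERIV_chain2[OF this transition_DERIV[OF UV(1,2) elim(2)]]
    have "(in_chart F (V, w) has_field_derivative deriv (in_chart F (U, z)) (?T y) * deriv ?T y) (at y)"
      by (rule has_field_derivative_transform_within_open[OF _ open_overlap[OF UV(1,2)] elim(2)])
        (simp add: in_chart_transition[OF UV(1,2)])
    then show ?case by (rule DERIV_imp_deriv)
  qed
qed

lemma one_form_differential:
  assumes "mero A" "mero F" "mero B" "mero G"
  shows "meromorphic_differential \<A> 1 (one_form A F B G)"
  unfolding meromorphic_differential_def
proof (intro conjI)
  show "\<forall>(U, z)\<in>\<A>. one_form A F B G (U, z) meromorphic_on z ` U"
    using meroD assms unfolding one_form_def[abs_def]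
    by (auto intro!: meromorphic_on_add meromorphic_on_mult meromorphic_on_deriv)
  have "\<forall>\<^sub>\<approx>x\<in>w ` (U \<inter> V). one_form A F B G (V, w) x = one_form A F B G (U, z) (transition (U, z) (V, w) x)
     * deriv (transition (U, z) (V, w)) x ^ 1" if UV: "(U, z) \<in> \<A>" "(V, w) \<in> \<A>" for U z V w
  proof (rule eventually_cosparseI[OF open_overlap[OF UV]])
    fix x assume x: "x \<in> w ` (U \<inter> V)"
    show "\<forall>\<^sub>F x in at x. one_form A F B G (V, w) x = one_form A F B G (U, z) (transition (U, z) (V, w) x)
     * deriv (transition (U, z) (V, w)) x ^ 1"
      using deriv_in_chart_transition[OF assms(2) UV x] deriv_in_chart_transition[OF assms(4) UV x]
        eventually_at_in_open'[OF open_overlap[OF UV] x]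
      by eventually_elim (simp add: in_chart_transition[OF UV] one_form_def algebra_simps)
  qed
  then show "\<forall>(U, z)\<in>\<A>. \<forall>(V, w)\<in>\<A>. \<forall>\<^sub>\<approx>x\<in>w ` (U \<inter> V). one_form A F B G (V, w) x =
     one_form A F B G (U, z) (transition (U, z) (V, w) x) * deriv (transition (U, z) (V, w)) x ^ 1" by blast
qed

text \<open>The chart is picked by choice and the value of \<open>F\<close> at \<open>p\<close> is
  ignored in favour of its limit; \<open>to_sphere_eq\<close> shows that every chart gives the same
  point.\<close>

definition to_sphere :: "('a \<Rightarrow> complex) \<Rightarrow> 'a \<Rightarrow> complex option" where
  "to_sphere F p = (let c = SOME c. c \<in> \<A> \<and> p \<in> fst c in
     if is_pole (in_chart F c) (snd c p) then None else Some (remove_sings (in_chart F c) (snd c p)))"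

lemma mero_limit:
  assumes "mero F" "(U, z) \<in> \<A>" "p \<in> U" "\<not> is_pole (in_chart F (U, z)) (z p)"
  obtains l where "in_chart F (U, z) \<midarrow>z p\<rightarrow> l"
proof -
  have "in_chart F (U, z) meromorphic_on {z p}"
    by (rule meromorphic_on_subset[OF meroD[OF assms(1,2)]]) (use assms(3) in simp)
  then have "not_essential (in_chart F (U, z)) (z p)" by (rule meromorphic_on_not_essential)
  with assms(4) that show ?thesis by (auto simp: not_essential_def)
qed

lemma to_sphere_eq:
  assumes F: "mero F" and U: "(U, z) \<in> \<A>" "p \<in> U"
  shows "to_sphere F p = (if is_pole (in_chart F (U, z)) (z p) then None
     else Some (remove_sings (in_chart F (U, z)) (z p)))"
proof -
  define c where "c = (SOME c. c \<in> \<A> \<and> p \<in> fst c)"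
  have "c \<in> \<A> \<and> p \<in> fst c" unfolding c_def by (rule someI[of _ "(U, z)"]) (use U in simp)
  then obtain V w where c: "c = (V, w)" and V: "(V, w) \<in> \<A>" "p \<in> V" by (cases c) auto
  have pole: "is_pole (in_chart F (V, w)) (w p) \<longleftrightarrow> is_pole (in_chart F (U, z)) (z p)"
    unfolding is_pole_def
    using filterlim_in_chart_transfer[OF U(1) V(1) U(2) V(2)]
      filterlim_in_chart_transfer[OF V(1) U(1) V(2) U(2)] by blast
  have "remove_sings (in_chart F (V, w)) (w p) = remove_sings (in_chart F (U, z)) (z p)"
    if np: "\<not> is_pole (in_chart F (U, z)) (z p)"
  proof -
    obtain l where l: "in_chart F (U, z) \<midarrow>z p\<rightarrow> l" using mero_limit[OF F U np] .
    have "in_chart F (V, w) \<midarrow>w p\<rightarrow> l"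
      by (rule filterlim_in_chart_transfer[OF U(1) V(1) U(2) V(2) l])
    then show ?thesis using l by (simp add: remove_sings_eqI)
  qed
  with pole show ?thesis unfolding to_sphere_def c_def[symmetric] by (simp add: c)
qed

end

section \<open>Poles and residues on a compact surface\<close>

context connected_riemann
begin

text \<open>Without poles, removal of singularities gives a holomorphic function on the whole
  surface. Its modulus attains a maximum by compactness, so it is constant near that point, and then
  its differential vanishes everywhere.\<close>

lemma pole_exists:
  assumes comp: "compact_space X" and F: "mero F"
    and U: "(U, z) \<in> \<A>" "p \<in> U" and nc: "\<not> eventually (\<lambda>x. deriv (in_chart F (U, z)) x = 0) (at (z p))"
  obtains V w q where "(V, w) \<in> \<A>" "q \<in> V" "is_pole (in_chart F (V, w)) (w q)"
proof (rule ccontr)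
  assume "\<not> thesis"
  with that have np: "\<And>V w q. (V, w) \<in> \<A> \<Longrightarrow> q \<in> V \<Longrightarrow> \<not> is_pole (in_chart F (V, w)) (w q)" by blast
  define G where "G = (\<lambda>q. the (to_sphere F q))"
  have G: "G q = remove_sings (in_chart F (V, w)) (w q)" if "(V, w) \<in> \<A>" "q \<in> V" for V w q
    using to_sphere_eq[OF F that] np[OF that] by (simp add: G_def)
  have hol: "remove_sings (in_chart F (V, w)) holomorphic_on w ` V" if V: "(V, w) \<in> \<A>" for V w
  proof -
    have "remove_sings (in_chart F (V, w)) analytic_on {x}" if x: "x \<in> w ` V" for x
    proof -
      obtain q where q: "q \<in> V" "x = w q" using x by blast
      obtain l where "in_chart F (V, w) \<midarrow>w q\<rightarrow> l" using mero_limit[OF F V q(1) np[OF V q(1)]] .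
      then show ?thesis unfolding q(2)
        by (intro remove_sings_analytic_at meromorphic_on_isolated_singularity[OF meromorphic_on_subset[OF meroD[OF F V]]])
          (use q in auto)
    qed
    then have "remove_sings (in_chart F (V, w)) analytic_on w ` V"
      using analytic_on_analytic_at by blast
    then show ?thesis by (rule analytic_imp_holomorphic)
  qed
  have "continuous_map X euclideanreal (\<lambda>q. norm (G q))"
    unfolding continuous_map_def
  proof (intro conjI allI impI)
    fix S :: "real set" assume S: "openin euclideanreal S"
    show "openin X {q \<in> topspace X. norm (G q) \<in> S}"
    proof (subst openin_subopen, rule ballI)
      fix q assume q: "q \<in> {q \<in> topspace X. norm (G q) \<in> S}"
      then obtain V w where V: "(V, w) \<in> \<A>" "q \<in> V" using ex_chart by blast
      let ?g = "\<lambda>x. norm (remove_sings (in_chart F (V, w)) x)"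
      have "continuous_on (w ` V) ?g"
        using hol[OF V(1)] by (intro continuous_intros holomorphic_on_imp_continuous_on)
      then have o: "open (w ` V \<inter> ?g -` S)"
        using S chartD(3)[OF V(1)] by (intro continuous_open_preimage) auto
      let ?W = "{q \<in> V. w q \<in> w ` V \<inter> ?g -` S}"
      have "openin X ?W" by (rule open_chart_preimage[OF V(1) o])
      moreover have "q \<in> ?W" using q V G[OF V] by auto
      moreover have "?W \<subseteq> {q \<in> topspace X. norm (G q) \<in> S}"
        using G[OF V(1)] chartD(2)[OF V(1)] by auto
      ultimately show "\<exists>T. openin X T \<and> q \<in> T \<and> T \<subseteq> {q \<in> topspace X. norm (G q) \<in> S}"
        by (intro exI[of _ ?W] conjI)
    qed
  qed auto
  then have "compactin euclideanreal ((\<lambda>q. norm (G q)) ` topspace X)"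
    using image_compactin comp unfolding compact_space_def by blast
  then have "compact ((\<lambda>q. norm (G q)) ` topspace X)" by simp
  moreover have "(\<lambda>q. norm (G q)) ` topspace X \<noteq> {}" using U chartD(2)[OF U(1)] by blast
  ultimately have "\<exists>s\<in>(\<lambda>q. norm (G q)) ` topspace X. \<forall>t\<in>(\<lambda>q. norm (G q)) ` topspace X. t \<le> s"
    by (rule compact_attains_sup)
  then obtain q where q: "q \<in> topspace X" "\<And>q'. q' \<in> topspace X \<Longrightarrow> norm (G q') \<le> norm (G q)"
    by auto
  obtain V0 w where V0: "(V0, w) \<in> \<A>" "q \<in> V0" using ex_chart[OF q(1)] by blast
  obtain V r where V: "(V, w) \<in> \<A>" "q \<in> V" "r > 0" "w ` V = ball (w q) r"
    using ball_chart[OF V0 chartD(1)[OF V0(1)] V0(2)] by metis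
  let ?g = "remove_sings (in_chart F (V, w))"
  have "?g constant_on w ` V"
  proof (rule maximum_modulus_principle[OF hol[OF V(1)], of "w ` V" "w q"])
    fix x assume "x \<in> w ` V"
    then obtain q' where q': "q' \<in> V" "x = w q'" by blast
    then show "norm (?g x) \<le> norm (?g (w q))"
      using q(2)[of q'] G[OF V(1)] V(2) chartD(2)[OF V(1)] by auto
  qed (use V in auto)
  then obtain c where c: "\<And>x. x \<in> ball (w q) r \<Longrightarrow> ?g x = c"
    unfolding constant_on_def V(4) by blast
  have "eventually (\<lambda>x. in_chart F (V, w) analytic_on {x}) (at (w q))"
    by (rule analytic_near[OF F V(1,2)])
  moreover have "eventually (\<lambda>x. x \<in> ball (w q) r) (at (w q))"
    by (rule eventually_at_in_open') (use V(3) in auto)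
  ultimately have "eventually (\<lambda>x. deriv (in_chart F (V, w)) x = 0) (at (w q))"
  proof eventually_elim
    case (elim x)
    have "(?g has_field_derivative 0) (at x)"
      by (rule has_field_derivative_transform_within_open[OF DERIV_const open_ball elim(2)]) (simp add: c)
    then have "deriv ?g x = 0" by (rule DERIV_imp_deriv)
    then show ?case using elim(1) by simp
  qed
  moreover define \<delta> where "\<delta> = one_form (\<lambda>_. 1) F (\<lambda>_. 0) F"
  have \<delta>c: "\<delta> c x = deriv (in_chart F c) x" for c x by (simp add: \<delta>_def one_form_def in_chart_def)
  have \<delta>: "meromorphic_differential \<A> 1 \<delta>"
    unfolding \<delta>_def by (intro one_form_differential mero_const F)
  ultimately have "zero_differential \<A> \<delta>"
    using zero_differentialI[OF \<delta> V(1,2)] by (simp add: \<delta>c)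
  then have "\<forall>\<^sub>\<approx>x\<in>z ` U. deriv (in_chart F (U, z)) x = 0"
    using U(1) unfolding zero_differential_def \<delta>c by blast
  then show False using nc eventually_cosparse_open_eq[OF chartD(3)[OF U(1)]] U(2) by blast
qed

lemma laurent_chart:
  assumes "mero F" "(V, w) \<in> \<A>" "q \<in> V"
  shows "\<exists>L. (\<lambda>x. in_chart F (V, w) (w q + x)) has_laurent_expansion L"
  using meromorphic_on_imp_has_laurent_expansion[OF meroD[OF assms(1,2)]] assms(3) by blast

lemma laurent_chart_deriv:
  assumes "mero F" "(V, w) \<in> \<A>" "q \<in> V" "(\<lambda>x. in_chart F (V, w) (w q + x)) has_laurent_expansion L"
  shows "(\<lambda>x. deriv (in_chart F (V, w)) (w q + x)) has_laurent_expansion fls_deriv L"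
proof -
  have "deriv (\<lambda>x. in_chart F (V, w) (w q + x)) = (\<lambda>x. deriv (in_chart F (V, w)) (w q + x))"
  proof
    fix x
    show "deriv (\<lambda>x. in_chart F (V, w) (w q + x)) x = deriv (in_chart F (V, w)) (w q + x)"
      using DERIV_shift[of "in_chart F (V, w)" _ x "w q"] unfolding deriv_def by (simp add: add.commute)
  qed
  then show ?thesis using has_laurent_expansion_deriv[OF assms(4)] by simp
qed

text \<open>The relation \<open>\<nu>' G dF = \<mu> F dG\<close> holds on one disc, hence on the
  surface. Divided by \<open>F G\<close> it compares two logarithmic derivatives, whose residues at
  a pole of \<open>F\<close> are the orders of \<open>F\<close> and \<open>G\<close> there. The
  order of \<open>F\<close> is negative, so the quotient of the exponents is a quotient of
  integers.\<close>

lemma commensurable_exponents: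
  assumes comp: "compact_space X" and F: "mero F" and G: "mero G"
    and U: "(U, z) \<in> \<A>" "p \<in> U" and \<mu>: "\<mu> \<noteq> 0"
    and dF: "eventually (\<lambda>x. deriv (in_chart F (U, z)) x = \<mu> * in_chart F (U, z) x) (at (z p))"
    and dG: "eventually (\<lambda>x. deriv (in_chart G (U, z)) x = \<nu>' * in_chart G (U, z) x) (at (z p))"
    and nz: "eventually (\<lambda>x. in_chart F (U, z) x \<noteq> 0 \<and> in_chart G (U, z) x \<noteq> 0) (at (z p))"
  shows "\<nu>' / \<mu> \<in> \<rat>"
proof -
  have "\<not> eventually (\<lambda>x. deriv (in_chart F (U, z)) x = 0) (at (z p))"
  proof
    assume "eventually (\<lambda>x. deriv (in_chart F (U, z)) x = 0) (at (z p))"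
    with dF nz have "eventually (\<lambda>_. False) (at (z p))" by eventually_elim (use \<mu> in auto)
    then show False by simp
  qed
  from pole_exists[OF comp F U this] obtain V w q where V: "(V, w) \<in> \<A>" "q \<in> V"
    and pole: "is_pole (in_chart F (V, w)) (w q)" .
  define \<delta> where "\<delta> = one_form (\<lambda>p. \<nu>' * G p) F (\<lambda>p. (- \<mu>) * F p) G"
  have \<delta>: "meromorphic_differential \<A> 1 \<delta>"
    unfolding \<delta>_def by (intro one_form_differential mero_mult mero_const F G)
  have "eventually (\<lambda>x. \<delta> (U, z) x = 0) (at (z p))"
    using dF dG by eventually_elim (simp add: \<delta>_def one_form_def in_chart_def)
  from zero_differentialI[OF \<delta> U this] have "\<forall>\<^sub>\<approx>x\<in>w ` V. \<delta> (V, w) x = 0"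
    using V(1) unfolding zero_differential_def by blast
  then have z0: "eventually (\<lambda>x. \<delta> (V, w) x = 0) (at (w q))"
    using eventually_cosparse_open_eq[OF chartD(3)[OF V(1)]] V(2) by blast
  obtain LF LG where LF: "(\<lambda>x. in_chart F (V, w) (w q + x)) has_laurent_expansion LF"
    and LG: "(\<lambda>x. in_chart G (V, w) (w q + x)) has_laurent_expansion LG"
    using laurent_chart[OF F V] laurent_chart[OF G V] by blast
  have "(\<lambda>x. \<delta> (V, w) (w q + x)) has_laurent_expansion
     fls_const \<nu>' * LG * fls_deriv LF + fls_const (- \<mu>) * LF * fls_deriv LG"
    unfolding \<delta>_def one_form_def
    using LF LG laurent_chart_deriv[OF F V LF] laurent_chart_deriv[OF G V LG]
    by (auto simp: in_chart_def intro!: laurent_expansion_intros)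
  then have L0: "fls_const \<nu>' * LG * fls_deriv LF + fls_const (- \<mu>) * LF * fls_deriv LG = 0"
    using has_laurent_expansion_eventually_zero_iff z0 by blast
  \<comment> \<open>A vanishing expansion at \<open>q\<close> would propagate back to
    \<open>p\<close>, near which \<open>G\<close> is nonzero.\<close>
  have "LG \<noteq> 0"
  proof
    assume "LG = 0"
    then have "eventually (\<lambda>x. in_chart G (V, w) x = 0) (at (w q))"
      using has_laurent_expansion_eventually_zero_iff[OF LG] by blast
    then have "zero_differential \<A> (in_chart G)"
      by (rule zero_differentialI[OF mero_imp_differential[OF G] V])
    then have "\<forall>\<^sub>\<approx>x\<in>z ` U. in_chart G (U, z) x = 0"
      using U(1) unfolding zero_differential_def by blast
    then have "eventually (\<lambda>x. in_chart G (U, z) x = 0) (at (z p))"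
      using eventually_cosparse_open_eq[OF chartD(3)[OF U(1)]] U(2) by blast
    with nz have "eventually (\<lambda>_. False) (at (z p))" by eventually_elim auto
    then show False by simp
  qed
  have neg: "fls_subdegree LF < 0" using is_pole_fls_subdegree_iff[OF LF] pole by blast
  then have "LF \<noteq> 0" by auto
  have "fls_const \<nu>' * (fls_deriv LF * inverse LF) = fls_const \<mu> * (fls_deriv LG * inverse LG)"
  proof -
    have m: "fls_const (- \<mu>) = - fls_const \<mu>" by (rule fls_eqI) simp
    have "fls_const \<nu>' * LG * fls_deriv LF = fls_const \<mu> * LF * fls_deriv LG"
      using L0 unfolding m by (simp only: mult_minus_left add_uminus_conv_diff right_minus_eq)
    then show ?thesis using \<open>LF \<noteq> 0\<close> \<open>LG \<noteq> 0\<close> by (rule cross_multiply)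
  qed
  then have "fls_residue (fls_const \<nu>' * (fls_deriv LF * inverse LF)) =
      fls_residue (fls_const \<mu> * (fls_deriv LG * inverse LG))" by simp
  then have "\<nu>' * of_int (fls_subdegree LF) = \<mu> * of_int (fls_subdegree LG)"
    by (simp only: fls_residue_fls_const_times fls_residue_deriv_times_inverse_eq_subdegree)
  then have "\<nu>' / \<mu> = of_int (fls_subdegree LG) / of_int (fls_subdegree LF)"
    using neg \<mu> by (simp add: field_simps)
  then show ?thesis by simp
qed

text \<open>Here \<open>dF / F = \<mu> dG\<close>. At a pole of \<open>F\<close> the left side has a
  nonzero integer as residue, while an exact differential has residue zero.\<close>

lemma no_exponential_of_meromorphic:
  assumes comp: "compact_space X" and F: "mero F" and G: "mero G"
    and U: "(U, z) \<in> \<A>" "p \<in> U" and \<mu>: "\<mu> \<noteq> 0"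
    and dF: "eventually (\<lambda>x. deriv (in_chart F (U, z)) x = \<mu> * in_chart F (U, z) x) (at (z p))"
    and dG: "eventually (\<lambda>x. deriv (in_chart G (U, z)) x = 1) (at (z p))"
    and nz: "eventually (\<lambda>x. in_chart F (U, z) x \<noteq> 0) (at (z p))"
  shows False
proof -
  have "\<not> eventually (\<lambda>x. deriv (in_chart F (U, z)) x = 0) (at (z p))"
  proof
    assume "eventually (\<lambda>x. deriv (in_chart F (U, z)) x = 0) (at (z p))"
    with dF nz have "eventually (\<lambda>_. False) (at (z p))" by eventually_elim (use \<mu> in auto)
    then show False by simp
  qed
  from pole_exists[OF comp F U this] obtain V w q where V: "(V, w) \<in> \<A>" "q \<in> V"
    and pole: "is_pole (in_chart F (V, w)) (w q)" .
  define \<delta> where "\<delta> = one_form (\<lambda>_. 1) F (\<lambda>p. (- \<mu>) * F p) G"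
  have \<delta>: "meromorphic_differential \<A> 1 \<delta>"
    unfolding \<delta>_def by (intro one_form_differential mero_mult mero_const F G)
  have "eventually (\<lambda>x. \<delta> (U, z) x = 0) (at (z p))"
    using dF dG by eventually_elim (simp add: \<delta>_def one_form_def in_chart_def)
  from zero_differentialI[OF \<delta> U this] have "\<forall>\<^sub>\<approx>x\<in>w ` V. \<delta> (V, w) x = 0"
    using V(1) unfolding zero_differential_def by blast
  then have z0: "eventually (\<lambda>x. \<delta> (V, w) x = 0) (at (w q))"
    using eventually_cosparse_open_eq[OF chartD(3)[OF V(1)]] V(2) by blast
  obtain LF LG where LF: "(\<lambda>x. in_chart F (V, w) (w q + x)) has_laurent_expansion LF"
    and LG: "(\<lambda>x. in_chart G (V, w) (w q + x)) has_laurent_expansion LG"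
    using laurent_chart[OF F V] laurent_chart[OF G V] by blast
  have "(\<lambda>x. \<delta> (V, w) (w q + x)) has_laurent_expansion
     fls_const 1 * fls_deriv LF + fls_const (- \<mu>) * LF * fls_deriv LG"
    unfolding \<delta>_def one_form_def
    using LF LG laurent_chart_deriv[OF F V LF] laurent_chart_deriv[OF G V LG]
    by (auto simp: in_chart_def intro!: laurent_expansion_intros)
  then have L0: "fls_const 1 * fls_deriv LF + fls_const (- \<mu>) * LF * fls_deriv LG = 0"
    using has_laurent_expansion_eventually_zero_iff z0 by blast
  have neg: "fls_subdegree LF < 0" using is_pole_fls_subdegree_iff[OF LF] pole by blast
  then have "LF \<noteq> 0" by auto
  have "fls_deriv LF * inverse LF = fls_const \<mu> * fls_deriv LG"
  proof -
    have m: "fls_const (- \<mu>) = - fls_const \<mu>" by (rule fls_eqI) simp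
    have "fls_const 1 * 1 * fls_deriv LF = fls_const \<mu> * LF * fls_deriv LG"
      using L0 unfolding m by (simp only: mult_minus_left add_uminus_conv_diff right_minus_eq mult_1_right)
    then have "fls_const 1 * (fls_deriv LF * inverse LF) = fls_const \<mu> * (fls_deriv LG * inverse 1)"
      using \<open>LF \<noteq> 0\<close> by (rule cross_multiply) simp
    then show ?thesis by simp
  qed
  then have "fls_residue (fls_deriv LF * inverse LF) = fls_residue (fls_const \<mu> * fls_deriv LG)" by simp
  then have "of_int (fls_subdegree LF) = (0 :: complex)"
    by (simp only: fls_residue_fls_const_times fls_residue_deriv_times_inverse_eq_subdegree
        fls_residue_deriv mult_zero_right)
  with neg show False by simp
qed

end

section \<open>Exponentials as global meromorphic functions\<close>

declare One_nat_def [simp del]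

text \<open>A Plucker coordinate of the plane of \<open>u\<close>, \<open>v\<close>: the pairing of
  the bivectors of \<open>a\<close>, \<open>b\<close> and of \<open>u\<close>, \<open>v\<close> that
  \<open>\<omega>\<close> induces.\<close>

definition plu :: "complex^4 \<Rightarrow> complex^4 \<Rightarrow> complex^4 \<Rightarrow> complex^4 \<Rightarrow> complex" where
  "plu a b u v = \<omega> a u * \<omega> b v - \<omega> a v * \<omega> b u"

text \<open>Only the quotient of two coordinates is a function of the plane. A spanning pair is
  chosen arbitrarily; by \<open>plu_ratio_eq\<close> any independent pair may be used
  instead.\<close>

definition plu_ratio ::
  "complex^4 \<Rightarrow> complex^4 \<Rightarrow> complex^4 \<Rightarrow> complex^4 \<Rightarrow> (complex^4) set \<Rightarrow> complex" where
  "plu_ratio a b c d P = (let uv = SOME uv. P = vec.span {fst uv, snd uv}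
     in plu a b (fst uv) (snd uv) / plu c d (fst uv) (snd uv))"

lemma plu_ratio_eq:
  assumes P: "P = vec.span {u, v}" and ind: "indep2 u v"
  shows "plu_ratio a b c d P = plu a b u v / plu c d u v"
proof -
  define uv where "uv = (SOME uv. P = vec.span {fst uv, snd uv})"
  have "P = vec.span {fst (u, v), snd (u, v)}" using P by simp
  then have uv: "P = vec.span {fst uv, snd uv}" unfolding uv_def by (rule someI)
  have ind': "indep2 (fst uv) (snd uv)" using uv P ind dim_span2 by metis
  have "fst uv \<in> vec.span {u, v}" "snd uv \<in> vec.span {u, v}"
    unfolding P[symmetric] uv by (simp_all add: vec.span_base)
  then obtain s t s' t' where st: "fst uv = s *s u + t *s v" "snd uv = s' *s u + t' *s v"
    unfolding in_span2 by blast
  have det: "s * t' - t * s' \<noteq> 0"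
  proof
    assume 0: "s * t' - t * s' = 0"
    have "t' *s fst uv + (- t) *s snd uv = (s * t' - t * s') *s u"
      "s' *s fst uv + (- s) *s snd uv = (- (s * t' - t * s')) *s v"
      by (simp_all add: st vec_eq_iff algebra_simps)
    then have "t' *s fst uv + (- t) *s snd uv = 0" "s' *s fst uv + (- s) *s snd uv = 0"
      unfolding 0 by simp_all
    then have "t = 0" "s = 0" using indep2D[OF ind'] by fastforce+
    then have "1 *s fst uv + 0 *s snd uv = 0" using st by simp
    then show False using indep2D[OF ind'] by fastforce
  qed
  \<comment> \<open>A change of frame multiplies every Plucker coordinate by its determinant, which
    cancels in the quotient.\<close>
  have "plu a b (fst uv) (snd uv) = (s * t' - t * s') * plu a b u v" for a b
    by (simp add: plu_def st algebra_simps)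
  then show ?thesis unfolding plu_ratio_def uv_def[symmetric] Let_def using det by simp
qed

lemma plu_holomorphic:
  "vec_holomorphic_on u S \<Longrightarrow> vec_holomorphic_on v S \<Longrightarrow> (\<lambda>x. plu a b (u x) (v x)) holomorphic_on S"
  unfolding plu_def by (intro holomorphic_intros \<omega>_holomorphic vec_holomorphic_const)

lemma vec_deriv_0_const:
  assumes "\<And>x. x \<in> ball x0 r \<Longrightarrow> has_vec_deriv u 0 x" "x \<in> ball x0 r"
  shows "u x = u x0"
proof -
  have "u x $ i = u x0 $ i" for i
  proof -
    have "(\<lambda>x. u x $ i) constant_on ball x0 r"
    proof (rule has_field_derivative_0_imp_constant_on)
      show "((\<lambda>x. u x $ i) has_field_derivative 0) (at y)" if "y \<in> ball x0 r" for y
        using assms(1)[OF that] by (auto simp: has_vec_deriv_def)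
    qed auto
    moreover have "x0 \<in> ball x0 r" 
      using assms(2) zero_le_dist[of x0 x] unfolding mem_ball dist_self by linarith
    ultimately show ?thesis using assms(2) unfolding constant_on_def by metis
  qed
  then show ?thesis by (simp add: vec_eq_iff)
qed

context isotropic
begin

text \<open>All local frames compute one and the same function, as a quotient of holomorphic ones;
  no continuation along paths is involved, and critical points are no obstacle.\<close>

lemma mero_plu_ratio: "mero (\<lambda>p. plu_ratio a b c d (f p))"
  unfolding mero_def
proof
  fix ch assume "ch \<in> \<A>"
  then obtain U z where U: "ch = (U, z)" "(U, z) \<in> \<A>" by (cases ch) auto
  let ?F = "in_chart (\<lambda>p. plu_ratio a b c d (f p)) (U, z)"
  have "?F meromorphic_on {x}" if x: "x \<in> z ` U" for x
  proof -
    obtain p where p: "p \<in> U" "x = z p" using x by blast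
    obtain V r u where V: "(V, z) \<in> \<A>" "p \<in> V" "V \<subseteq> U" "r > 0" "z ` V = ball (z p) r"
      and fr: "frame 2 f (V, z) u"
      using local_frame[OF f_into U(2) p(1) chartD(1)[OF U(2)] p(1)] by metis
    let ?g = "\<lambda>x. plu a b (u 0 x) (u 1 x) / plu c d (u 0 x) (u 1 x)"
    have "?g meromorphic_on z ` V"
      using fr chartD(3)[OF V(1)] unfolding frame_2_iff
      by (intro meromorphic_on_divide analytic_on_imp_meromorphic_on)
        (auto simp: analytic_on_open intro!: plu_holomorphic)
    then have g: "?g meromorphic_on {x}"
      by (rule meromorphic_on_subset) (use V(2) p in auto)
    have eq: "?F y = ?g y" if y: "y \<in> z ` V" for y
    proof -
      obtain q where q: "q \<in> V" "y = z q" using y by blast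
      have fq: "f q = vec.span {u 0 (z q), u 1 (z q)}" "vec.dim (f q) = 2"
        using fr q(1) unfolding frame_2_iff by auto
      then have "indep2 (u 0 (z q)) (u 1 (z q))" using dim_span2 by metis
      then show ?thesis using plu_ratio_eq[OF fq(1)] in_chart_eq[OF U(2)] q V(3) by auto
    qed
    have "eventually (\<lambda>y. y \<in> z ` V) (at x)"
      by (rule eventually_at_in_open'[OF chartD(3)[OF V(1)]]) (use V(2) p in auto)
    then have "eventually (\<lambda>y. ?F y = ?g y) (at x)" by eventually_elim (rule eq)
    then show ?thesis using meromorphic_on_cong[of "{x}" ?F ?g "{x}"] g by simp
  qed
  then show "in_chart (\<lambda>p. plu_ratio a b c d (f p)) ch meromorphic_on snd ch ` fst ch"
    using meromorphic_on_meromorphic_at[of ?F "z ` U"] U(1) by auto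
qed

end

section \<open>Constant vectors attached to the characteristic roots\<close>

locale jet_chart = isotropic X \<A> f
  for X :: "'a topology" and \<A> :: "'a chart set" and f :: "'a \<Rightarrow> (complex^4) set" +
  fixes V :: "'a set" and z :: "'a \<Rightarrow> complex" and r :: real and x0 p :: complex
    and Y :: "nat \<Rightarrow> complex \<Rightarrow> complex^4"
  assumes V: "(V, z) \<in> \<A>" "z ` V = ball x0 r" "r > 0"
    and jets: "jets p (ball x0 r) Y"
    and fY: "\<And>q. q \<in> V \<Longrightarrow> f q = vec.span {Y 0 (z q), Y 1 (z q)}"
begin

lemma gram:
  assumes "x \<in> ball x0 r"
  shows "\<omega> (Y 0 x) (Y 1 x) = 0" "\<omega> (Y 0 x) (Y 2 x) = 0" "\<omega> (Y 0 x) (Y 3 x) = 6"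
     "\<omega> (Y 1 x) (Y 2 x) = - 6" "\<omega> (Y 1 x) (Y 3 x) = 0" "\<omega> (Y 2 x) (Y 3 x) = - 60 * p"
     "\<omega> (Y 1 x) (Y 0 x) = 0" "\<omega> (Y 2 x) (Y 0 x) = 0" "\<omega> (Y 3 x) (Y 0 x) = - 6"
     "\<omega> (Y 2 x) (Y 1 x) = 6" "\<omega> (Y 3 x) (Y 1 x) = 0" "\<omega> (Y 3 x) (Y 2 x) = 60 * p"
proof -
  show 1: "\<omega> (Y 0 x) (Y 1 x) = 0" "\<omega> (Y 0 x) (Y 2 x) = 0" "\<omega> (Y 0 x) (Y 3 x) = 6"
     "\<omega> (Y 1 x) (Y 2 x) = - 6" "\<omega> (Y 1 x) (Y 3 x) = 0" "\<omega> (Y 2 x) (Y 3 x) = - 60 * p"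
    using jets assms unfolding jets_def by blast+
  show "\<omega> (Y 1 x) (Y 0 x) = 0" "\<omega> (Y 2 x) (Y 0 x) = 0" "\<omega> (Y 3 x) (Y 0 x) = - 6"
     "\<omega> (Y 2 x) (Y 1 x) = 6" "\<omega> (Y 3 x) (Y 1 x) = 0" "\<omega> (Y 3 x) (Y 2 x) = 60 * p"
    using 1 \<omega>_commute[of "Y 1 x" "Y 0 x"] \<omega>_commute[of "Y 2 x" "Y 0 x"] \<omega>_commute[of "Y 3 x" "Y 0 x"]
      \<omega>_commute[of "Y 2 x" "Y 1 x"] \<omega>_commute[of "Y 3 x" "Y 1 x"] \<omega>_commute[of "Y 3 x" "Y 2 x"] by simp_all
qed

lemma Yd:
  assumes "x \<in> ball x0 r"
  shows "has_vec_deriv (Y 0) (Y 1 x) x" "has_vec_deriv (Y 1) (Y 2 x) x" "has_vec_deriv (Y 2) (Y 3 x) x"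
    "has_vec_deriv (Y 3) ((- (10 * p)) *s Y 2 x - (9 * p\<^sup>2 + 1) *s Y 0 x) x"
  using jets assms unfolding jets_def by blast+

lemma indep_Y:
  assumes "x \<in> ball x0 r" shows "indep2 (Y 0 x) (Y 1 x)"
  unfolding indep2_def
proof (intro allI impI)
  fix s t assume "s *s Y 0 x + t *s Y 1 x = 0"
  then have "\<omega> (s *s Y 0 x + t *s Y 1 x) (Y 3 x) = 0" "\<omega> (s *s Y 0 x + t *s Y 1 x) (Y 2 x) = 0"
    by simp_all
  then show "s = 0 \<and> t = 0" using gram[OF assms] by simp
qed

text \<open>With \<open>D\<close> for differentiation, the characteristic polynomial is
  \<open>(x\<^sup>2 - \<mu>\<^sup>2) (x\<^sup>2 - n)\<close>, and this is
  \<open>(D + \<mu>) (D\<^sup>2 - n)\<close> applied to \<open>Y 0\<close>, so that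
  \<open>D - \<mu>\<close> annihilates it.\<close>

definition K :: "complex \<Rightarrow> complex \<Rightarrow> complex \<Rightarrow> complex^4" where
  "K \<mu> n x = Y 3 x + \<mu> *s Y 2 x + (- n) *s Y 1 x + (- (\<mu> * n)) *s Y 0 x"

definition kv :: "complex \<Rightarrow> complex \<Rightarrow> complex^4" where
  "kv \<mu> n = exp (- \<mu> * x0) *s K \<mu> n x0"

text \<open>\<open>\<mu>\<close> is a characteristic root and \<open>n\<close> the square of the
  complementary pair of roots. Recording the square rather than a root spares a choice of
  sign.\<close>

definition roots :: "complex \<Rightarrow> complex \<Rightarrow> bool" where
  "roots \<mu> n \<longleftrightarrow> \<mu>\<^sup>2 + n = - 10 * p \<and> \<mu>\<^sup>2 * n = 9 * p\<^sup>2 + 1"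

lemma K_deriv:
  assumes \<mu>: "roots \<mu> n" and x: "x \<in> ball x0 r"
  shows "has_vec_deriv (K \<mu> n) (\<mu> *s K \<mu> n x) x"
proof -
  have scl: "has_vec_deriv (\<lambda>y. c *s u y) (c *s D) x" if "has_vec_deriv u D x" for c u D
    using has_vec_deriv_scale[OF that DERIV_const[of c]] by simp
  have "has_vec_deriv (K \<mu> n) (((- (10 * p)) *s Y 2 x - (9 * p\<^sup>2 + 1) *s Y 0 x) + \<mu> *s Y 3 x
      + (- n) *s Y 2 x + (- (\<mu> * n)) *s Y 1 x) x"
    unfolding K_def[abs_def] by (intro has_vec_deriv_add scl Yd[OF x])
  moreover have "((- (10 * p)) *s Y 2 x - (9 * p\<^sup>2 + 1) *s Y 0 x) + \<mu> *s Y 3 x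
      + (- n) *s Y 2 x + (- (\<mu> * n)) *s Y 1 x = \<mu> *s K \<mu> n x"
  proof -
    have 1: "10 * p = - (\<mu>\<^sup>2 + n)" "9 * p\<^sup>2 + 1 = \<mu>\<^sup>2 * n" using \<mu> by (simp_all add: roots_def)
    show ?thesis unfolding 1 by (simp add: K_def vec_eq_iff algebra_simps power2_eq_square)
  qed
  ultimately show ?thesis by simp
qed

lemma K_eq:
  assumes \<mu>: "roots \<mu> n" and x: "x \<in> ball x0 r"
  shows "K \<mu> n x = exp (\<mu> * x) *s kv \<mu> n" "kv \<mu> n = exp (- \<mu> * x) *s K \<mu> n x"
proof -
  have "exp (- \<mu> * x) *s K \<mu> n x = exp (- \<mu> * x0) *s K \<mu> n x0"
  proof (rule vec_deriv_0_const[OF _ x])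
    fix y assume y: "y \<in> ball x0 r"
    have "((\<lambda>y. exp (- \<mu> * y)) has_field_derivative (- \<mu>) * exp (- \<mu> * y)) (at y)"
      by (auto intro!: derivative_eq_intros)
    from has_vec_deriv_scale[OF K_deriv[OF \<mu> y] this]
    show "has_vec_deriv (\<lambda>y. exp (- \<mu> * y) *s K \<mu> n y) 0 y" by (simp add: mult.commute)
  qed
  then show 2: "kv \<mu> n = exp (- \<mu> * x) *s K \<mu> n x" by (simp add: kv_def)
  have "exp (\<mu> * x) * exp (- \<mu> * x) = 1" by (simp flip: exp_add)
  then show "K \<mu> n x = exp (\<mu> * x) *s kv \<mu> n" unfolding 2 by simp
qed

lemma kv_pairing:
  assumes "roots \<mu> n" "x \<in> ball x0 r"
  shows "\<omega> (kv \<mu> n) (Y 0 x) = - 6 * exp (- \<mu> * x)" "\<omega> (kv \<mu> n) (Y 1 x) = 6 * \<mu> * exp (- \<mu> * x)"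
  unfolding K_eq(2)[OF assms] by (simp_all add: K_def gram[OF assms(2)])

text \<open>Vectors of complementary pairs, where \<open>n' = \<mu>\<^sup>2\<close>, are orthogonal.
  For distinct roots the four vectors thus form, up to scaling, a symplectic basis in which
  \<open>\<mu>\<close> is dual to \<open>- \<mu>\<close>.\<close>

lemma kv_gram:
  assumes "roots \<mu> n" "roots \<mu>' n'"
  shows "\<omega> (kv \<mu> n) (kv \<mu>' n') = 6 * (\<mu>' - \<mu>) * (n' - \<mu>\<^sup>2) * exp (- (\<mu> + \<mu>') * x0)"
proof -
  have x0: "x0 \<in> ball x0 r" using V(3) by simp
  have p: "10 * p = - (\<mu>\<^sup>2 + n)" using assms(1) by (simp add: roots_def)
  have "\<omega> (K \<mu> n x0) (K \<mu>' n' x0) = 6 * (\<mu>' - \<mu>) * (10 * p + n + n')"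
    by (simp add: K_def gram[OF x0] algebra_simps)
  also have "\<dots> = 6 * (\<mu>' - \<mu>) * (n' - \<mu>\<^sup>2)" unfolding p by simp
  finally have c: "\<omega> (K \<mu> n x0) (K \<mu>' n' x0) = 6 * (\<mu>' - \<mu>) * (n' - \<mu>\<^sup>2)" .
  have e: "exp (- (\<mu> + \<mu>') * x0) = exp (- \<mu> * x0) * exp (- \<mu>' * x0)"
    by (simp add: algebra_simps flip: exp_add)
  show ?thesis unfolding kv_def e \<omega>_simps c by (simp add: mult_ac)
qed

lemma in_chart_plu_ratio:
  assumes x: "x \<in> ball x0 r"
  shows "in_chart (\<lambda>q. plu_ratio a b c d (f q)) (V, z) x =
     plu a b (Y 0 x) (Y 1 x) / plu c d (Y 0 x) (Y 1 x)"
proof -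
  obtain q where q: "q \<in> V" "x = z q" using x V(2) by (metis imageE)
  show ?thesis
    using plu_ratio_eq[OF fY[OF q(1)]] indep_Y x q in_chart_eq[OF V(1)] by auto
qed

lemma plu_kv:
  assumes "roots \<mu> n" "roots \<mu>' n'" "x \<in> ball x0 r"
  shows "plu (kv \<mu> n) (kv \<mu>' n') (Y 0 x) (Y 1 x) = 36 * (\<mu> - \<mu>') * exp (- (\<mu> + \<mu>') * x)"
proof -
  have "exp (- (\<mu> + \<mu>') * x) = exp (- \<mu> * x) * exp (- \<mu>' * x)" by (simp add: algebra_simps flip: exp_add)
  then show ?thesis
    unfolding plu_def kv_pairing[OF assms(1,3)] kv_pairing[OF assms(2,3)] by (simp add: algebra_simps)
qed

lemma in_chart_deriv:
  assumes x: "x \<in> ball x0 r" and eq: "\<And>y. y \<in> ball x0 r \<Longrightarrow> in_chart F (V, z) y = g y"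
    and d: "(g has_field_derivative g') (at x)"
  shows "deriv (in_chart F (V, z)) x = g'"
  by (rule DERIV_imp_deriv, rule has_field_derivative_transform_within_open[OF d open_ball x]) (simp add: eq)

lemma ev_ball: "(\<And>x. x \<in> ball x0 r \<Longrightarrow> Q x) \<Longrightarrow> eventually Q (at x0)"
  using eventually_at_in_open'[OF open_ball, of x0 x0 r] V(3) by (auto elim!: eventually_mono)

lemma ex_center: "\<exists>q. q \<in> V \<and> z q = x0"
  using V(2,3) by (metis centre_in_ball imageE)

text \<open>The denominator belongs to the opposite roots \<open>l\<close> and \<open>- l\<close>
  and is therefore constant, so the quotient is a pure exponential. The sign of \<open>k\<close> is
  free, which also gives the exponent \<open>l - k\<close>.\<close>

lemma exp_mero:
  assumes "roots l (k\<^sup>2)" "l\<^sup>2 \<noteq> k\<^sup>2" "l \<noteq> 0"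
  shows "\<exists>H. mero H \<and> (\<forall>x\<in>ball x0 r. in_chart H (V, z) x = exp ((l + k) * x))"
proof -
  have rt: "roots l (k\<^sup>2)" "roots (- l) (k\<^sup>2)" "roots (- k) (l\<^sup>2)"
    using assms(1) by (simp_all add: roots_def algebra_simps)
  have "l - k \<noteq> 0" using assms(2) by auto
  define G where "G = (\<lambda>q. plu_ratio (kv (- l) (k\<^sup>2)) (kv (- k) (l\<^sup>2)) (kv l (k\<^sup>2)) (kv (- l) (k\<^sup>2)) (f q))"
  define c where "c = 72 * l / (36 * (k - l))"
  have "in_chart (\<lambda>q. c * G q) (V, z) x = exp ((l + k) * x)" if x: "x \<in> ball x0 r" for x
  proof -
    have "in_chart G (V, z) x = 36 * (k - l) * exp ((l + k) * x) / (72 * l)"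
      unfolding G_def in_chart_plu_ratio[OF x] plu_kv[OF rt(2,3) x] plu_kv[OF rt(1,2) x]
      by (simp add: algebra_simps)
    then show ?thesis using assms(3) \<open>l - k \<noteq> 0\<close> by (simp add: in_chart_def c_def field_simps)
  qed
  moreover have "mero (\<lambda>q. c * G q)" unfolding G_def by (intro mero_mult mero_const mero_plu_ratio)
  ultimately show ?thesis by blast
qed

text \<open>The exponents \<open>l + k\<close> and \<open>l - k\<close> are commensurable, and
  \<open>l / k\<close> is a fractional linear function of their quotient with rational
  coefficients.\<close>

lemma rational_quotient:
  assumes comp: "compact_space X" and rt: "roots l (k\<^sup>2)" "l\<^sup>2 \<noteq> k\<^sup>2" "l \<noteq> 0" "k \<noteq> 0"
  shows "l / k \<in> \<rat>"
proof -
  obtain F where F: "mero F" "\<And>x. x \<in> ball x0 r \<Longrightarrow> in_chart F (V, z) x = exp ((l + k) * x)"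
    using exp_mero[OF rt(1-3)] by blast
  have "roots l ((- k)\<^sup>2)" "l\<^sup>2 \<noteq> (- k)\<^sup>2" using rt by simp_all
  from exp_mero[OF this rt(3)]
  obtain G where G: "mero G" "\<And>x. x \<in> ball x0 r \<Longrightarrow> in_chart G (V, z) x = exp ((l - k) * x)" by auto
  obtain q where q: "q \<in> V" "z q = x0" using ex_center by blast
  have lk: "l + k \<noteq> 0" "l - k \<noteq> 0" using rt(2) by (auto simp: power2_eq_square add_eq_0_iff)
  have "(l - k) / (l + k) \<in> \<rat>"
  proof (rule commensurable_exponents[OF comp F(1) G(1) V(1) q(1) lk(1)], unfold q(2))
    show "eventually (\<lambda>x. deriv (in_chart F (V, z)) x = (l + k) * in_chart F (V, z) x) (at x0)"
      by (rule ev_ball, subst F(2), assumption, rule in_chart_deriv[OF _ F(2)])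
        (auto intro!: derivative_eq_intros)
    show "eventually (\<lambda>x. deriv (in_chart G (V, z)) x = (l - k) * in_chart G (V, z) x) (at x0)"
      by (rule ev_ball, subst G(2), assumption, rule in_chart_deriv[OF _ G(2)])
        (auto intro!: derivative_eq_intros)
    show "eventually (\<lambda>x. in_chart F (V, z) x \<noteq> 0 \<and> in_chart G (V, z) x \<noteq> 0) (at x0)"
      by (rule ev_ball) (simp add: F(2) G(2))
  qed
  then have "(1 + t) / (1 - t) \<in> \<rat>" if "t = (l - k) / (l + k)" for t
    using that by (intro Rats_divide Rats_add Rats_diff Rats_1) auto
  from this[OF refl] have "(1 + (l - k) / (l + k)) / (1 - (l - k) / (l + k)) \<in> \<rat>" .
  moreover have "(1 + (l - k) / (l + k)) / (1 - (l - k) / (l + k)) = l / k"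
  proof -
    have "1 + (l - k) / (l + k) = 2 * l / (l + k)" "1 - (l - k) / (l + k) = 2 * k / (l + k)"
      using lk by (simp_all add: field_simps)
    then show ?thesis using lk by simp
  qed
  ultimately show ?thesis by simp
qed

lemma no_polynomial_exponential:
  assumes comp: "compact_space X" and F: "mero F" and G: "mero G" and "\<mu> \<noteq> 0" "c \<noteq> 0"
    and Fx: "\<And>x. x \<in> ball x0 r \<Longrightarrow> in_chart F (V, z) x = c * exp (\<mu> * x)"
    and Gx: "\<And>x. x \<in> ball x0 r \<Longrightarrow> in_chart G (V, z) x = x + d"
  shows False
proof -
  obtain q where q: "q \<in> V" "z q = x0" using ex_center by blast
  show False
  proof (rule no_exponential_of_meromorphic[OF comp F G V(1) q(1) \<open>\<mu> \<noteq> 0\<close>], unfold q(2))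
    show "eventually (\<lambda>x. deriv (in_chart F (V, z)) x = \<mu> * in_chart F (V, z) x) (at x0)"
      by (rule ev_ball, subst Fx, assumption, rule in_chart_deriv[OF _ Fx])
        (auto intro!: derivative_eq_intros)
    show "eventually (\<lambda>x. deriv (in_chart G (V, z)) x = 1) (at x0)"
      by (rule ev_ball, rule in_chart_deriv[OF _ Gx]) (auto intro!: derivative_eq_intros)
    show "eventually (\<lambda>x. in_chart F (V, z) x \<noteq> 0) (at x0)"
      by (rule ev_ball) (simp add: Fx \<open>c \<noteq> 0\<close>)
  qed
qed

text \<open>For a double root of the characteristic polynomial the parameter itself is globally meromorphic.\<close>

lemma generalized_vector:
  assumes rt: "roots \<mu> n" and L: "\<And>x. x \<in> ball x0 r \<Longrightarrow> has_vec_deriv L (\<mu> *s L x + K \<mu> n x) x"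
    and LY: "\<And>x. x \<in> ball x0 r \<Longrightarrow> \<omega> (L x) (Y 0 x) = 0" "\<And>x. x \<in> ball x0 r \<Longrightarrow> \<omega> (L x) (Y 1 x) = 6"
  shows "\<exists>m. \<forall>x\<in>ball x0 r. \<omega> m (Y 0 x) = 6 * x * exp (- \<mu> * x) \<and>
      \<omega> m (Y 1 x) = (6 - 6 * \<mu> * x) * exp (- \<mu> * x)"
proof -
  \<comment> \<open>The usual ansatz for a double root: subtracting \<open>x\<close> times
    \<open>K\<close> from \<open>L\<close> and dividing by the exponential leaves a constant
    vector.\<close>
  let ?m = "\<lambda>x. exp (- \<mu> * x) *s (L x + (- x) *s K \<mu> n x)"
  have const: "?m x = ?m x0" if x: "x \<in> ball x0 r" for x
  proof (rule vec_deriv_0_const[OF _ x])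
    fix y assume y: "y \<in> ball x0 r"
    have e: "((\<lambda>y. exp (- \<mu> * y)) has_field_derivative (- \<mu>) * exp (- \<mu> * y)) (at y)"
      by (auto intro!: derivative_eq_intros)
    have i: "((\<lambda>y. - y) has_field_derivative - 1) (at y)" by (auto intro!: derivative_eq_intros)
    have "has_vec_deriv (\<lambda>y. L y + (- y) *s K \<mu> n y)
        ((\<mu> *s L y + K \<mu> n y) + ((- 1) *s K \<mu> n y + (- y) *s (\<mu> *s K \<mu> n y))) y"
      by (intro has_vec_deriv_add L[OF y] has_vec_deriv_scale K_deriv[OF rt y] i)
    from has_vec_deriv_scale[OF this e]
    have d: "has_vec_deriv ?m (((- \<mu>) * exp (- \<mu> * y)) *s (L y + (- y) *s K \<mu> n y) +
       exp (- \<mu> * y) *s ((\<mu> *s L y + K \<mu> n y) + ((- 1) *s K \<mu> n y + (- y) *s (\<mu> *s K \<mu> n y)))) y" .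
    have "((- \<mu>) * exp (- \<mu> * y)) *s (L y + (- y) *s K \<mu> n y) +
       exp (- \<mu> * y) *s ((\<mu> *s L y + K \<mu> n y) + ((- 1) *s K \<mu> n y + (- y) *s (\<mu> *s K \<mu> n y))) = 0"
      by (simp add: vec_eq_iff algebra_simps)
    then show "has_vec_deriv ?m 0 y" using d by simp
  qed
  have KY: "\<omega> (K \<mu> n x) (Y 0 x) = - 6" "\<omega> (K \<mu> n x) (Y 1 x) = 6 * \<mu>" if "x \<in> ball x0 r" for x
    by (simp_all add: K_def gram[OF that])
  show ?thesis
  proof (intro exI[of _ "?m x0"] ballI)
    fix x assume x: "x \<in> ball x0 r"
    show "\<omega> (?m x0) (Y 0 x) = 6 * x * exp (- \<mu> * x) \<and> \<omega> (?m x0) (Y 1 x) = (6 - 6 * \<mu> * x) * exp (- \<mu> * x)"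
      unfolding const[OF x, symmetric] by (simp add: KY[OF x] LY[OF x] algebra_simps)
  qed
qed

text \<open>As a polynomial in \<open>x\<^sup>2\<close> the characteristic polynomial has
  discriminant \<open>64 p\<^sup>2 - 4\<close> and constant term \<open>9 p\<^sup>2 + 1\<close>. If
  the first vanishes there are two double roots \<open>l\<close> and \<open>- l\<close>; if the
  second does, zero is a double root and \<open>l\<close>, \<open>- l\<close> are simple. In both
  cases quotients of Plucker coordinates yield \<open>\<zeta>\<close>, up to an additive constant,
  and a nonconstant exponential.\<close>

lemma not_exceptional:
  assumes comp: "compact_space X"
  shows "16 * p\<^sup>2 \<noteq> 1" "9 * p\<^sup>2 + 1 \<noteq> 0"
proof -
  have scl: "has_vec_deriv (\<lambda>y. c *s u y) (c *s D) x" if "has_vec_deriv u D x" for c u D x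
    using has_vec_deriv_scale[OF that DERIV_const[of c]] by simp
  show "16 * p\<^sup>2 \<noteq> 1"
  proof
    assume p: "16 * p\<^sup>2 = 1"
    define l where "l = csqrt (- 5 * p)"
    have l2: "l\<^sup>2 = - 5 * p" by (simp add: l_def)
    have "p \<noteq> 0" using p by auto
    then have l0: "l \<noteq> 0" using l2 by auto
    have "l\<^sup>2 * l\<^sup>2 = 25 * p\<^sup>2" unfolding l2 by (simp add: power2_eq_square)
    also have "\<dots> = 9 * p\<^sup>2 + 16 * p\<^sup>2" by simp
    finally have "l\<^sup>2 * l\<^sup>2 = 9 * p\<^sup>2 + 1" unfolding p .
    then have rt: "roots l (l\<^sup>2)" "roots (- l) (l\<^sup>2)" using l2 by (simp_all add: roots_def)
    \<comment> \<open>This is \<open>(D + l)\<^sup>2\<close> applied to \<open>Y 0\<close>; applying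
      \<open>D - l\<close> gives \<open>K\<close>.\<close>
    define L where "L = (\<lambda>x. Y 2 x + (2 * l) *s Y 1 x + l\<^sup>2 *s Y 0 x)"
    have "has_vec_deriv L (l *s L x + K l (l\<^sup>2) x) x" if x: "x \<in> ball x0 r" for x
    proof -
      have "has_vec_deriv L (Y 3 x + (2 * l) *s Y 2 x + l\<^sup>2 *s Y 1 x) x"
        unfolding L_def by (intro has_vec_deriv_add scl Yd[OF x])
      moreover have "Y 3 x + (2 * l) *s Y 2 x + l\<^sup>2 *s Y 1 x = l *s L x + K l (l\<^sup>2) x"
        by (simp add: L_def K_def vec_eq_iff algebra_simps power2_eq_square)
      ultimately show ?thesis by simp
    qed
    from generalized_vector[OF rt(1) this]
    have "\<exists>m. \<forall>x\<in>ball x0 r. \<omega> m (Y 0 x) = 6 * x * exp (- l * x) \<and>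
      \<omega> m (Y 1 x) = (6 - 6 * l * x) * exp (- l * x)"
      by (simp add: L_def gram)
    then obtain m where m: "\<And>x. x \<in> ball x0 r \<Longrightarrow> \<omega> m (Y 0 x) = 6 * x * exp (- l * x)"
      "\<And>x. x \<in> ball x0 r \<Longrightarrow> \<omega> m (Y 1 x) = (6 - 6 * l * x) * exp (- l * x)"
      by blast
    let ?k = "kv l (l\<^sup>2)" and ?k' = "kv (- l) (l\<^sup>2)"
    have e: "exp (- l * x) * exp (l * x) = 1" "exp (- l * x) * exp (- l * x) = exp (- 2 * l * x)" for x
      by (simp_all add: mult.assoc flip: exp_add)
    have kk: "plu ?k ?k' (Y 0 x) (Y 1 x) = 72 * l" if x: "x \<in> ball x0 r" for x
      by (simp add: plu_kv[OF rt x])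
    have "in_chart (\<lambda>q. plu_ratio ?k m ?k ?k' (f q)) (V, z) x = (- 1 / (2 * l)) * exp ((- 2 * l) * x)"
      if x: "x \<in> ball x0 r" for x
    proof -
      have "plu ?k m (Y 0 x) (Y 1 x) = - 36 * (exp (- l * x) * exp (- l * x))"
        by (simp add: plu_def kv_pairing[OF rt(1) x] m[OF x] algebra_simps)
      then show ?thesis unfolding in_chart_plu_ratio[OF x] kk[OF x] e using l0 by (simp add: field_simps)
    qed
    moreover have "in_chart (\<lambda>q. plu_ratio ?k' m ?k ?k' (f q)) (V, z) x = x + (- 1 / (2 * l))"
      if x: "x \<in> ball x0 r" for x
    proof -
      have "plu ?k' m (Y 0 x) (Y 1 x) = (72 * l * x - 36) * (exp (- l * x) * exp (l * x))"
        by (simp add: plu_def kv_pairing[OF rt(2) x] m[OF x] algebra_simps)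
      then show ?thesis unfolding in_chart_plu_ratio[OF x] kk[OF x] e using l0 by (simp add: field_simps)
    qed
    ultimately show False
      by (rule no_polynomial_exponential[OF comp mero_plu_ratio mero_plu_ratio, rotated 2]) (use l0 in auto)
  qed
  show "9 * p\<^sup>2 + 1 \<noteq> 0"
  proof
    assume p: "9 * p\<^sup>2 + 1 = 0"
    define l where "l = csqrt (- 10 * p)"
    have l2: "l\<^sup>2 = - 10 * p" by (simp add: l_def)
    have "p \<noteq> 0" using p by auto
    then have l0: "l \<noteq> 0" using l2 by auto
    have rt: "roots l 0" "roots 0 (l\<^sup>2)" using l2 p by (simp_all add: roots_def)
    \<comment> \<open>This is \<open>D\<^sup>2 - l\<^sup>2\<close> applied to \<open>Y 0\<close>;
      one more derivative gives \<open>K\<close> for the root zero.\<close>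
    define L where "L = (\<lambda>x. Y 2 x + (- (l\<^sup>2)) *s Y 0 x)"
    have "has_vec_deriv L (0 *s L x + K 0 (l\<^sup>2) x) x" if x: "x \<in> ball x0 r" for x
    proof -
      have "has_vec_deriv L (Y 3 x + (- (l\<^sup>2)) *s Y 1 x) x"
        unfolding L_def by (intro has_vec_deriv_add scl Yd[OF x])
      moreover have "Y 3 x + (- (l\<^sup>2)) *s Y 1 x = 0 *s L x + K 0 (l\<^sup>2) x"
        by (simp add: K_def vec_eq_iff algebra_simps)
      ultimately show ?thesis by simp
    qed
    from generalized_vector[OF rt(2) this]
    have "\<exists>m. \<forall>x\<in>ball x0 r. \<omega> m (Y 0 x) = 6 * x \<and> \<omega> m (Y 1 x) = 6"
      by (simp add: L_def gram)
    then obtain m where m: "\<And>x. x \<in> ball x0 r \<Longrightarrow> \<omega> m (Y 0 x) = 6 * x"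
      "\<And>x. x \<in> ball x0 r \<Longrightarrow> \<omega> m (Y 1 x) = 6"
      by blast
    let ?k = "kv l 0" and ?k' = "kv 0 (l\<^sup>2)"
    have km: "plu ?k' m (Y 0 x) (Y 1 x) = - 36" if x: "x \<in> ball x0 r" for x
      by (simp add: plu_def kv_pairing[OF rt(2) x] m[OF x])
    have kk: "plu ?k ?k' (Y 0 x) (Y 1 x) = 36 * l * exp (- l * x)" if x: "x \<in> ball x0 r" for x
      by (simp add: plu_kv[OF rt x])
    have "in_chart (\<lambda>q. plu_ratio ?k ?k' ?k' m (f q)) (V, z) x = (- l) * exp ((- l) * x)"
      if x: "x \<in> ball x0 r" for x
      unfolding in_chart_plu_ratio[OF x] kk[OF x] km[OF x] by simp
    moreover have "in_chart (\<lambda>q. plu_ratio m ?k ?k ?k' (f q)) (V, z) x = x + 1 / l"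
      if x: "x \<in> ball x0 r" for x
    proof -
      have "plu m ?k (Y 0 x) (Y 1 x) = 36 * (1 + l * x) * exp (- l * x)"
        by (simp add: plu_def kv_pairing[OF rt(1) x] m[OF x] algebra_simps)
      then show ?thesis unfolding in_chart_plu_ratio[OF x] kk[OF x] using l0 by (simp add: field_simps)
    qed
    ultimately show False
      by (rule no_polynomial_exponential[OF comp mero_plu_ratio mero_plu_ratio, rotated 2]) (use l0 in auto)
  qed
qed

text \<open>By Lagrange interpolation \<open>Y 0\<close> is the sum of the exponentials for the
  roots \<open>l\<close>, \<open>- l\<close>, \<open>k\<close>, \<open>- k\<close>, times constant
  vectors \<open>a\<close>, \<open>b\<close>, \<open>c\<close>, \<open>d\<close>. In the plane of
  \<open>Y 0\<close> and \<open>Y 1\<close> the combination \<open>Y 1 + k Y 0\<close> has no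
  component along \<open>d\<close>, and \<open>Y 1 + l Y 0\<close> none along \<open>b\<close>.
  Multiplied by \<open>- exp (l x)\<close> and \<open>exp (k x)\<close> they become, up to a
  symplectic matrix and scalars, the two vectors of the W-curve.\<close>

lemma normal_form:
  assumes rt: "roots l (k\<^sup>2)" "l\<^sup>2 \<noteq> k\<^sup>2" "l \<noteq> 0" "k \<noteq> 0" and r0: "r0\<^sup>2 = l * k"
  shows "\<exists>M\<in>Sp2. \<forall>q\<in>V.
     M *v ((l - k) *s e 1 - ((l + k) * exp (2 * l * z q)) *s e 3 - (2 * \<i> * r0 * exp ((l + k) * z q)) *s e 4) \<in> f q \<and>
     M *v ((l - k) *s e 2 - (2 * \<i> * r0 * exp ((l + k) * z q)) *s e 3 + ((l + k) * exp (2 * k * z q)) *s e 4) \<in> f q"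
proof -
  have rts: "roots l (k\<^sup>2)" "roots (- l) (k\<^sup>2)" "roots k (l\<^sup>2)" "roots (- k) (l\<^sup>2)"
    using rt(1) by (simp_all add: roots_def algebra_simps)
  define D where "D = l\<^sup>2 - k\<^sup>2"
  have D0: "D \<noteq> 0" using rt(2) by (simp add: D_def)
  \<comment> \<open>Up to sign, the reciprocals of the derivative of the characteristic polynomial
    at the roots: \<open>2 * l * D\<close> at \<open>l\<close> and \<open>- 2 * k * D\<close> at
    \<open>k\<close>.\<close>
  define A B where "A = 1 / (2 * l * D)" and "B = 1 / (2 * k * D)"
  have AB: "2 * l * D * A = 1" "2 * k * D * B = 1" using D0 rt(3,4) by (simp_all add: A_def B_def)
  define a b c d where "a = A *s kv l (k\<^sup>2)" and "b = (- A) *s kv (- l) (k\<^sup>2)"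
    and "c = (- B) *s kv k (l\<^sup>2)" and "d = B *s kv (- k) (l\<^sup>2)"
  have r00: "r0 \<noteq> 0" using r0 rt by auto
  \<comment> \<open>The relative scale of the two symplectic planes:
    \<open>\<theta>\<^sup>2 = - k / l\<close> makes both pairings equal, and the factor
    \<open>s\<close> below makes them 1.\<close>
  define \<theta> where "\<theta> = - \<i> * r0 / l"
  have \<theta>0: "\<theta> \<noteq> 0" using r00 rt by (simp add: \<theta>_def)
  have \<theta>: "2 * \<i> * r0 * \<theta> = 2 * k" "2 * \<i> * r0 = - 2 * l * \<theta>"
    using r0 rt(3) by (simp_all add: \<theta>_def power2_eq_square field_simps)
  have "(- 2 * l * \<theta>) * \<theta> = 2 * k" unfolding \<theta>(2)[symmetric] by (rule \<theta>(1))
  then have \<theta>2: "\<theta> * \<theta> * l = - k" by algebra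
  define s where "s = csqrt (l * D / 3)"
  have s: "s * s = l * D / 3" unfolding s_def by (metis power2_csqrt power2_eq_square)
  have ga: "\<omega> a b = - (3 / (l * D))" "\<omega> c d = 3 / (k * D)" "\<omega> a c = 0" "\<omega> a d = 0" "\<omega> b c = 0" "\<omega> b d = 0"
    using rt(3,4) D0
    by (simp_all add: a_def b_def c_def d_def A_def B_def kv_gram rts) (simp_all add: D_def[symmetric] field_simps, simp_all add: D_def power2_eq_square algebra_simps)
  have ga': "\<omega> b a = 3 / (l * D)" "\<omega> d c = - 3 / (k * D)" "\<omega> d a = 0" "\<omega> c b = 0"
    using ga \<omega>_commute[of b a] \<omega>_commute[of d c] \<omega>_commute[of d a] \<omega>_commute[of c b] by simp_all
  define M where "M = columns4 (s *s b) ((s * \<theta>) *s d) (s *s a) ((s * \<theta>) *s c)"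
  have "M \<in> Sp2"
    unfolding M_def
  proof (rule columns4_Sp2)
    have "\<omega> (s *s b) (s *s a) = (s * s) * (3 / (l * D))" by (simp add: ga')
    then show "\<omega> (s *s b) (s *s a) = 1" unfolding s using D0 rt(3) by simp
    have "\<omega> ((s * \<theta>) *s d) ((s * \<theta>) *s c) = (s * s) * (\<theta> * \<theta>) * (- 3 / (k * D))" by (simp add: ga')
    also have "\<dots> = (\<theta> * \<theta> * l) * (- 1 / k)" unfolding s using D0 rt(4) by (simp add: field_simps)
    also have "\<dots> = 1" unfolding \<theta>2 using rt(4) by simp
    finally show "\<omega> ((s * \<theta>) *s d) ((s * \<theta>) *s c) = 1" .
  qed (simp_all add: ga ga')
  moreover have "M *v ((l - k) *s e 1 - ((l + k) * exp (2 * l * z q)) *s e 3 - (2 * \<i> * r0 * exp ((l + k) * z q)) *s e 4) \<in> f q \<and>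
     M *v ((l - k) *s e 2 - (2 * \<i> * r0 * exp ((l + k) * z q)) *s e 3 + ((l + k) * exp (2 * k * z q)) *s e 4) \<in> f q"
    if q: "q \<in> V" for q
  proof -
    let ?x = "z q"
    have x: "?x \<in> ball x0 r" using V(2) q by blast
    define E F where "E = exp (l * ?x)" and "F = exp (k * ?x)"
    have E0: "E \<noteq> 0" "F \<noteq> 0" by (simp_all add: E_def F_def)
    have ex: "exp (2 * l * ?x) = E * E" "exp (2 * k * ?x) = F * F" "exp ((l + k) * ?x) = E * F"
      by (simp_all add: E_def F_def algebra_simps flip: exp_add)
    define E' F' where "E' = 1 / E" and "F' = 1 / F"
    have EF: "E * E' = 1" "F * F' = 1" using E0 by (simp_all add: E'_def F'_def)
    have kvs: "kv l (k\<^sup>2) = E' *s K l (k\<^sup>2) ?x" "kv (- l) (k\<^sup>2) = E *s K (- l) (k\<^sup>2) ?x"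
      "kv k (l\<^sup>2) = F' *s K k (l\<^sup>2) ?x" "kv (- k) (l\<^sup>2) = F *s K (- k) (l\<^sup>2) ?x"
      using K_eq(2)[OF rts(1) x] K_eq(2)[OF rts(2) x] K_eq(2)[OF rts(3) x] K_eq(2)[OF rts(4) x]
      by (simp_all add: E_def F_def E'_def F'_def exp_minus field_simps)
    define y0 y1 where "y0 = Y 0 ?x" and "y1 = Y 1 ?x"
    have c1: "(l - k) *s b - ((l + k) * (E * E)) *s a - (2 * k * (E * F)) *s c = (- (E * k)) *s y0 + (- E) *s y1"
      unfolding vec_eq_iff a_def b_def c_def kvs K_def y0_def y1_def vector_add_component
        vector_minus_component vector_smult_component
      using AB EF D_def by (intro allI) algebra
    have c2: "(l - k) *s d + (2 * l * (E * F)) *s a + ((l + k) * (F * F)) *s c = (F * l) *s y0 + F *s y1"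
      unfolding vec_eq_iff a_def d_def c_def kvs K_def y0_def y1_def vector_add_component
        vector_minus_component vector_smult_component
      using AB EF D_def by (intro allI) algebra
    have "M *v ((l - k) *s e 1 - ((l + k) * (E * E)) *s e 3 - (2 * \<i> * r0 * (E * F)) *s e 4)
        = s *s ((l - k) *s b - ((l + k) * (E * E)) *s a - (2 * \<i> * r0 * \<theta> * (E * F)) *s c)"
      by (simp add: M_def columns4_mult axis_def vec_eq_iff algebra_simps)
    also have "\<dots> = s *s ((- (E * k)) *s y0 + (- E) *s y1)" unfolding \<theta>(1) c1 ..
    also have "\<dots> = (s * (- (E * k))) *s y0 + (s * (- E)) *s y1" by (simp add: vec_eq_iff algebra_simps)
    finally have m1: "M *v ((l - k) *s e 1 - ((l + k) * (E * E)) *s e 3 - (2 * \<i> * r0 * (E * F)) *s e 4) \<in> f q"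
      unfolding fY[OF q] in_span2 y0_def y1_def by blast
    have "M *v ((l - k) *s e 2 - (2 * \<i> * r0 * (E * F)) *s e 3 + ((l + k) * (F * F)) *s e 4)
        = s *s (((l - k) * \<theta>) *s d - (2 * \<i> * r0 * (E * F)) *s a + ((l + k) * (F * F) * \<theta>) *s c)"
      by (simp add: M_def columns4_mult axis_def vec_eq_iff algebra_simps)
    also have "\<dots> = (s * \<theta>) *s ((l - k) *s d + (2 * l * (E * F)) *s a + ((l + k) * (F * F)) *s c)"
      unfolding \<theta>(2) by (simp add: vec_eq_iff algebra_simps)
    also have "\<dots> = (s * \<theta> * (F * l)) *s y0 + (s * \<theta> * F) *s y1"
      unfolding c2 by (simp add: vec_eq_iff algebra_simps)
    finally have m2: "M *v ((l - k) *s e 2 - (2 * \<i> * r0 * (E * F)) *s e 3 + ((l + k) * (F * F)) *s e 4) \<in> f q"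
      unfolding fY[OF q] in_span2 y0_def y1_def by blast
    show ?thesis unfolding ex using m1 m2 by blast
  qed
  ultimately show ?thesis by blast
qed

end

section \<open>Maps to the Riemann sphere\<close>

lemma openin_sphere: "openin sphere S \<longleftrightarrow>
   (\<exists>U. open U \<and> S = Some ` U) \<or> (\<exists>C. compact C \<and> S = insert None (Some ` (- C)))"
  unfolding sphere_def openin_Alexandroff_compactification
  by (auto simp: Compl_eq_Diff_UNIV compact_imp_closed)

lemma topspace_sphere [simp]: "topspace sphere = UNIV"
proof -
  have "x \<in> insert None (range Some)" for x :: "complex option" by (cases x) auto
  then show ?thesis by (auto simp: sphere_def)
qed

lemma open_punctured_inverse:
  assumes "open (U :: complex set)" shows "open ((- {0}) \<inter> inverse -` U)"
  by (intro continuous_open_preimage continuous_intros assms) auto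

lemma open_inverse_at_infinity:
  assumes "compact (C :: complex set)" shows "open (insert 0 ((- {0}) \<inter> inverse -` (- C)))"
proof -
  obtain b where b: "\<And>x. x \<in> C \<Longrightarrow> norm x \<le> b"
    using compact_imp_bounded[OF assms] by (auto simp: bounded_iff)
  define B where "B = \<bar>b\<bar> + 1"
  have B: "B > 0" "\<And>x. x \<in> C \<Longrightarrow> norm x < B" using b unfolding B_def by (auto, fastforce)
  have "insert 0 ((- {0}) \<inter> inverse -` (- C)) = ((- {0}) \<inter> inverse -` (- C)) \<union> ball 0 (1 / B)"
  proof -
    have "inverse x \<notin> C" if "x \<noteq> 0" "norm x < 1 / B" for x :: complex
    proof
      assume "inverse x \<in> C"
      then have "norm (inverse x) < B" by (rule B(2))
      then have "1 / norm x < B" by (simp add: norm_inverse divide_inverse)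
      then have "1 / B < norm x" using that(1) B(1) by (simp add: field_simps)
      with that(2) show False by simp
    qed
    then show ?thesis using B(1) by auto
  qed
  moreover have "open (- C)" using assms compact_imp_closed by blast
  ultimately show ?thesis using open_punctured_inverse by (metis open_Un open_ball)
qed

definition inv_coord :: "complex option \<Rightarrow> complex" where
  "inv_coord = (\<lambda>p. case p of None \<Rightarrow> 0 | Some z \<Rightarrow> inverse z)"

lemma sphere_charts_eq: "sphere_charts = {(range Some, the), (UNIV - {Some 0}, inv_coord)}"
  by (simp add: sphere_charts_def inv_coord_def)

text \<open>The delicate point is \<open>None\<close>, of coordinate zero in the second chart: its
  neighbourhoods are complements of compact sets, and inversion turns large modulus into small
  modulus.\<close>

lemma complex_chart_sphere: "c \<in> sphere_charts \<Longrightarrow> complex_chart sphere c"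
proof -
  have 1: "complex_chart sphere (range Some, the)"
  proof -
    have im: "the ` range Some = (UNIV :: complex set)" by (auto simp: image_iff intro: exI[of _ "Some _"])
    have "openin sphere (range Some)" unfolding openin_sphere by blast
    moreover have "homeomorphic_map (subtopology sphere (range Some)) euclidean the"
    proof (rule bijective_open_imp_homeomorphic_map)
      show "continuous_map (subtopology sphere (range Some)) euclidean the"
        unfolding continuous_map_def
      proof (intro conjI allI impI)
        fix U :: "complex set" assume "openin euclidean U"
        then have "openin sphere (Some ` U)" unfolding openin_sphere by auto
        moreover have "{x \<in> topspace (subtopology sphere (range Some)). the x \<in> U} = Some ` U \<inter> range Some"
          by auto
        ultimately show "openin (subtopology sphere (range Some)) {x \<in> topspace (subtopology sphere (range Some)). the x \<in> U}"
          unfolding openin_subtopology by blast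
      qed simp
      show "open_map (subtopology sphere (range Some)) euclidean the"
        unfolding open_map_def
      proof (intro allI impI)
        fix S assume "openin (subtopology sphere (range Some)) S"
        then obtain T where T: "openin sphere T" "S = T \<inter> range Some" unfolding openin_subtopology by blast
        from T(1) consider U where "open U" "T = Some ` U" | C where "compact C" "T = insert None (Some ` (- C))"
          unfolding openin_sphere by blast
        then have "open (the ` S)"
        proof cases
          case (1 U)
          then have "S = Some ` U" unfolding T(2) by auto
          then have "the ` S = U" by (simp add: image_image)
          then show ?thesis using 1 by simp
        next
          case (2 C)
          then have "S = Some ` (- C)" unfolding T(2) by auto
          then have "the ` S = - C" by (simp add: image_image)
          then show ?thesis using 2 compact_imp_closed by auto
        qed
        then show "openin euclidean (the ` S)" by simp
      qed
    qed (use im in \<open>auto simp: inj_on_def\<close>)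
    ultimately show ?thesis by (simp add: complex_chart_def im)
  qed
  have 2: "complex_chart sphere (UNIV - {Some 0}, inv_coord)"
  proof -
    let ?V = "UNIV - {Some (0 :: complex)}"
    have im: "inv_coord ` ?V = UNIV"
    proof (intro equalityI subsetI UNIV_I)
      fix x :: complex
      show "x \<in> inv_coord ` ?V"
        by (rule image_eqI[of _ _ "if x = 0 then None else Some (inverse x)"]) (auto simp: inv_coord_def)
    qed
    have "?V = insert None (Some ` (- {0}))" using not_None_eq by (auto simp: image_iff)
    then have "openin sphere ?V" unfolding openin_sphere by (metis compact_sing)
    moreover have "homeomorphic_map (subtopology sphere ?V) euclidean inv_coord"
    proof (rule bijective_open_imp_homeomorphic_map)
      show "continuous_map (subtopology sphere ?V) euclidean inv_coord"
        unfolding continuous_map_def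
      proof (intro conjI allI impI)
        fix U :: "complex set" assume "openin euclidean U"
        then have U: "open U" by simp
        let ?W = "(- {0}) \<inter> inverse -` U"
        have oW: "open ?W" by (rule open_punctured_inverse[OF U])
        have "openin sphere {x \<in> ?V. inv_coord x \<in> U}"
        proof (cases "0 \<in> U")
          case False
          then have "{x \<in> ?V. inv_coord x \<in> U} = Some ` ?W"
            by (auto simp: inv_coord_def split: option.splits)
          then show ?thesis using oW unfolding openin_sphere by blast
        next
          case True
          then obtain \<epsilon> where e: "\<epsilon> > 0" "ball 0 \<epsilon> \<subseteq> U" using U open_contains_ball by blast
          have "norm x \<le> 1 / \<epsilon>" if "x \<notin> ?W" for x
          proof (cases "x = 0")
            case False
            then have "inverse x \<notin> U" using that by auto
            then have "norm (inverse x) \<ge> \<epsilon>" using e(2) by (auto simp: subset_iff not_less)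
            then have "\<epsilon> \<le> 1 / norm x" by (simp add: norm_inverse divide_inverse)
            then show ?thesis using False e(1) by (simp add: field_simps)
          qed (use e(1) in auto)
          then have "bounded (- ?W)" unfolding bounded_iff by (intro exI[of _ "1 / \<epsilon>"] ballI) auto
          then have "compact (- ?W)" using closed_Compl[OF oW] unfolding compact_eq_bounded_closed by blast
          moreover have "{x \<in> ?V. inv_coord x \<in> U} = insert None (Some ` (- (- ?W)))"
          proof (rule set_eqI)
            fix x show "x \<in> {x \<in> ?V. inv_coord x \<in> U} \<longleftrightarrow> x \<in> insert None (Some ` (- (- ?W)))"
              by (cases x) (use True in \<open>auto simp: inv_coord_def\<close>)
          qed
          ultimately show ?thesis unfolding openin_sphere by blast
        qed
        moreover have "{x \<in> topspace (subtopology sphere ?V). inv_coord x \<in> U} = {x \<in> ?V. inv_coord x \<in> U} \<inter> ?V"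
          by auto
        ultimately show "openin (subtopology sphere ?V) {x \<in> topspace (subtopology sphere ?V). inv_coord x \<in> U}"
          unfolding openin_subtopology by blast
      qed simp
      show "open_map (subtopology sphere ?V) euclidean inv_coord"
        unfolding open_map_def
      proof (intro allI impI)
        fix S assume "openin (subtopology sphere ?V) S"
        then obtain T where T: "openin sphere T" "S = T \<inter> ?V" unfolding openin_subtopology by blast
        from T(1) consider U where "open U" "T = Some ` U" | C where "compact C" "T = insert None (Some ` (- C))"
          unfolding openin_sphere by blast
        then have "open (inv_coord ` S)"
        proof cases
          case (1 U)
          have "inv_coord ` S = (- {0}) \<inter> inverse -` U"
          proof (intro equalityI subsetI)
            fix x assume "x \<in> (- {0}) \<inter> inverse -` U"
            then show "x \<in> inv_coord ` S"
              by (intro image_eqI[of _ _ "Some (inverse x)"]) (auto simp: T(2) 1 inv_coord_def)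
          qed (auto simp: T(2) 1 inv_coord_def)
          then show ?thesis using open_punctured_inverse[OF 1(1)] by simp
        next
          case (2 C)
          have "inv_coord ` S = insert 0 ((- {0}) \<inter> inverse -` (- C))"
          proof (intro equalityI subsetI)
            fix x assume "x \<in> insert 0 ((- {0}) \<inter> inverse -` (- C))"
            then show "x \<in> inv_coord ` S"
              by (intro image_eqI[of _ _ "if x = 0 then None else Some (inverse x)"])
                (auto simp: T(2) 2 inv_coord_def)
          qed (auto simp: T(2) 2 inv_coord_def)
          then show ?thesis using open_inverse_at_infinity[OF 2(1)] by simp
        qed
        then show "openin euclidean (inv_coord ` S)" by simp
      qed
      show "inj_on inv_coord (topspace (subtopology sphere ?V))"
        by (auto simp: inj_on_def inv_coord_def split: option.splits)
    qed (use im in auto)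
    ultimately show ?thesis by (simp add: complex_chart_def im)
  qed
  show "c \<in> sphere_charts \<Longrightarrow> complex_chart sphere c" using 1 2 by (auto simp: sphere_charts_eq)
qed

text \<open>The atlas of the sphere consists of all charts compatible with the two standard ones, so
  it contains these once they are compatible with each other; the transition is
  \<open>inverse\<close> in both directions.\<close>

lemma sphere_charts_atlas: "sphere_charts \<subseteq> sphere_atlas"
proof -
  let ?c = "(range Some, the)" and ?d = "(UNIV - {Some (0 :: complex)}, inv_coord)"
  have i1: "inv_into (range Some) the x = Some x" for x :: complex
    by (rule inv_into_f_eq) (auto simp: inj_on_def)
  have inj2: "inj_on inv_coord (UNIV - {Some 0})"
    by (auto simp: inj_on_def inv_coord_def split: option.splits)
  have i2: "inv_into (UNIV - {Some 0}) inv_coord x = Some (inverse x)" if "x \<noteq> 0" for x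
    by (rule inv_into_f_eq[OF inj2]) (use that in \<open>auto simp: inv_coord_def\<close>)
  have i2': "inv_coord (inv_into (UNIV - {Some 0}) inv_coord x) = x" for x
  proof (cases "x = 0")
    case True
    have "inv_into (UNIV - {Some 0}) inv_coord x = None"
      by (rule inv_into_f_eq[OF inj2]) (use True in \<open>auto simp: inv_coord_def\<close>)
    then show ?thesis using True by (simp add: inv_coord_def)
  qed (simp add: i2, simp add: inv_coord_def)
  have cc: "compatible ?c ?c"
    by (auto simp: compatible_def transition_def i1 comp_def)
  have dd: "compatible ?d ?d"
    by (auto simp: compatible_def transition_def i2' comp_def)
  have cd: "transition ?c ?d holomorphic_on inv_coord ` (range Some \<inter> (UNIV - {Some 0}))"
  proof (rule holomorphic_transform[of inverse])
    show "inverse holomorphic_on inv_coord ` (range Some \<inter> (UNIV - {Some 0}))"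
      by (intro holomorphic_intros) (auto simp: inv_coord_def)
    fix x assume "x \<in> inv_coord ` (range Some \<inter> (UNIV - {Some 0}))"
    then have "x \<noteq> 0" by (auto simp: inv_coord_def)
    then show "inverse x = transition ?c ?d x" by (simp add: transition_def i2)
  qed
  have dc: "transition ?d ?c holomorphic_on the ` (range Some \<inter> (UNIV - {Some 0}))"
  proof (rule holomorphic_transform[of inverse])
    show "inverse holomorphic_on the ` (range Some \<inter> (UNIV - {Some 0}))"
      by (intro holomorphic_intros) auto
  qed (auto simp: transition_def i1 inv_coord_def)
  have "compatible ?c ?d" "compatible ?d ?c"
    using cd dc by (simp_all add: compatible_def Int_commute)
  with cc dd complex_chart_sphere show ?thesis
    unfolding sphere_atlas_def sphere_charts_eq by auto
qed

section \<open>Meromorphic functions as holomorphic maps to the sphere\<close>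

context riemann
begin

text \<open>A removable singularity is filled by its limit; at a pole the reciprocal extends by
  zero. The two alternatives correspond to the two standard charts of the sphere.\<close>

lemma to_sphere_local:
  assumes F: "mero F" and p: "p \<in> topspace X"
  obtains U z r where "(U, z) \<in> \<A>" "p \<in> U" "r > 0" "z ` U = ball (z p) r"
    "(\<exists>g. g holomorphic_on z ` U \<and> (\<forall>q\<in>U. to_sphere F q = Some (g (z q)))) \<or>
     (\<exists>t. t holomorphic_on z ` U \<and>
       (\<forall>q\<in>U. to_sphere F q = (if t (z q) = 0 then None else Some (inverse (t (z q))))))"
proof -
  obtain U0 z where U0: "(U0, z) \<in> \<A>" "p \<in> U0" using ex_chart[OF p] by blast
  let ?G = "in_chart F (U0, z)"
  have ana: "eventually (\<lambda>x. ?G analytic_on {x}) (at (z p))" by (rule analytic_near[OF F U0])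
  have val: "to_sphere F q = Some (?G (z q))" if "q \<in> U0" "?G analytic_on {z q}" for q
    using to_sphere_eq[OF F U0(1) that(1)] analytic_at_imp_no_pole[OF that(2)] that(2) by simp
  show thesis
  proof (cases "is_pole ?G (z p)")
    case False
    obtain l where l: "?G \<midarrow>z p\<rightarrow> l" using mero_limit[OF F U0 False] .
    have "?G meromorphic_on {z p}"
      by (rule meromorphic_on_subset[OF meroD[OF F U0(1)]]) (use U0(2) in simp)
    then have "isolated_singularity_at ?G (z p)" by (rule meromorphic_on_isolated_singularity)
    then have "remove_sings ?G analytic_on {z p}" by (rule remove_sings_analytic_at[OF _ l])
    then obtain B where B: "open B" "z p \<in> B" "remove_sings ?G holomorphic_on B" by (auto simp: analytic_at)
    obtain S where S: "open S" "z p \<in> S" "\<And>x. x \<in> S \<Longrightarrow> x \<noteq> z p \<Longrightarrow> ?G analytic_on {x}"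
      using ana unfolding eventually_at_topological by blast
    have o: "openin X {q \<in> U0. z q \<in> B \<inter> S}" using open_chart_preimage[OF U0(1)] B S by blast
    obtain U r where U: "(U, z) \<in> \<A>" "p \<in> U" "U \<subseteq> U0" "U \<subseteq> {q \<in> U0. z q \<in> B \<inter> S}" "r > 0" "z ` U = ball (z p) r"
      using ball_chart[OF U0 o] U0(2) B S by auto
    have "remove_sings ?G holomorphic_on z ` U" by (rule holomorphic_on_subset[OF B(3)]) (use U(4) in auto)
    moreover have "to_sphere F q = Some (remove_sings ?G (z q))" if q: "q \<in> U" for q
    proof (cases "z q = z p")
      case True
      then have "q = p" using U q chartD(4)[OF U(1)] by (auto simp: inj_on_def)
      then show ?thesis using to_sphere_eq[OF F U0] False by simp
    next
      case neq: False
      then have "?G analytic_on {z q}" using S(3) U(4) q by blast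
      then show ?thesis using val[of q] q U(3) by auto
    qed
    ultimately show ?thesis using that[OF U(1,2,5,6)] by blast
  next
    case True
    have "filterlim (\<lambda>x. norm (?G x)) at_top (at (z p))"
      using True unfolding is_pole_def filterlim_at_infinity_conv_norm_at_top .
    then have "eventually (\<lambda>x. 1 < norm (?G x)) (at (z p))" unfolding filterlim_at_top_dense by blast
    with ana have "eventually (\<lambda>x. ?G analytic_on {x} \<and> ?G x \<noteq> 0) (at (z p))"
      by eventually_elim auto
    then obtain S where S: "open S" "z p \<in> S" "\<And>x. x \<in> S \<Longrightarrow> x \<noteq> z p \<Longrightarrow> ?G analytic_on {x} \<and> ?G x \<noteq> 0"
      unfolding eventually_at_topological by blast
    have o: "openin X {q \<in> U0. z q \<in> S}" using open_chart_preimage[OF U0(1)] S by blast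
    obtain U r where U: "(U, z) \<in> \<A>" "p \<in> U" "U \<subseteq> U0" "U \<subseteq> {q \<in> U0. z q \<in> S}" "r > 0" "z ` U = ball (z p) r"
      using ball_chart[OF U0 o] U0(2) S by auto
    have US: "x \<in> S" if "x \<in> z ` U" for x using U(4) that by auto
    define t where "t = (\<lambda>x. if x = z p then 0 else inverse (?G x))"
    have "?G analytic_on z ` U - {z p}"
      by (rule analytic_on_analytic_at[THEN iffD2]) (use S(3) US in auto)
    then have "?G holomorphic_on z ` U - {z p}" by (rule analytic_imp_holomorphic)
    then have "t holomorphic_on z ` U"
      unfolding t_def using S(3) US U True chartD(3)[OF U(1)]
      by (intro is_pole_inverse_holomorphic) auto
    moreover have "to_sphere F q = (if t (z q) = 0 then None else Some (inverse (t (z q))))" if q: "q \<in> U" for q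
    proof (cases "z q = z p")
      case eq: True
      then have "q = p" using U q chartD(4)[OF U(1)] by (auto simp: inj_on_def)
      then show ?thesis using to_sphere_eq[OF F U0] True by (simp add: t_def)
    next
      case neq: False
      then have "?G analytic_on {z q}" "?G (z q) \<noteq> 0" using S(3)[OF US] q by auto
      then show ?thesis using val[of q] q U(3) neq by (auto simp: t_def)
    qed
    ultimately show ?thesis using that[OF U(1,2,5,6)] by blast
  qed
qed

lemma to_sphere_holomorphic:
  assumes F: "mero F" shows "holomorphic_map X \<A> sphere_atlas (to_sphere F)"
  unfolding holomorphic_map_def
proof
  fix p assume "p \<in> topspace X"
  from to_sphere_local[OF F this] obtain U z r where U: "(U, z) \<in> \<A>" "p \<in> U"
    and cs: "(\<exists>g. g holomorphic_on z ` U \<and> (\<forall>q\<in>U. to_sphere F q = Some (g (z q)))) \<or>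
     (\<exists>t. t holomorphic_on z ` U \<and>
       (\<forall>q\<in>U. to_sphere F q = (if t (z q) = 0 then None else Some (inverse (t (z q))))))" by metis
  have "\<exists>(V, w)\<in>sphere_charts. to_sphere F ` U \<subseteq> V \<and> (w \<circ> to_sphere F \<circ> inv_into U z) holomorphic_on z ` U"
    using cs
  proof
    assume "\<exists>g. g holomorphic_on z ` U \<and> (\<forall>q\<in>U. to_sphere F q = Some (g (z q)))"
    then obtain g where g: "g holomorphic_on z ` U" "\<And>q. q \<in> U \<Longrightarrow> to_sphere F q = Some (g (z q))" by blast
    have "(the \<circ> to_sphere F \<circ> inv_into U z) holomorphic_on z ` U"
      by (rule holomorphic_transform[OF g(1)]) (use g(2) U(1) in auto)
    moreover have "to_sphere F ` U \<subseteq> range Some" using g(2) by auto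
    ultimately show ?thesis unfolding sphere_charts_eq by blast
  next
    assume "\<exists>t. t holomorphic_on z ` U \<and>
       (\<forall>q\<in>U. to_sphere F q = (if t (z q) = 0 then None else Some (inverse (t (z q)))))"
    then obtain t where t: "t holomorphic_on z ` U"
      "\<And>q. q \<in> U \<Longrightarrow> to_sphere F q = (if t (z q) = 0 then None else Some (inverse (t (z q))))" by blast
    have "(inv_coord \<circ> to_sphere F \<circ> inv_into U z) holomorphic_on z ` U"
      by (rule holomorphic_transform[OF t(1)]) (use t(2) U(1) in \<open>auto simp: inv_coord_def\<close>)
    moreover have "to_sphere F ` U \<subseteq> UNIV - {Some 0}" using t(2) by auto
    ultimately show ?thesis unfolding sphere_charts_eq by blast
  qed
  then show "\<exists>(U, z)\<in>\<A>. \<exists>(V, w)\<in>sphere_atlas. p \<in> U \<and> to_sphere F ` U \<subseteq> V \<and>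
      (w \<circ> to_sphere F \<circ> inv_into U z) holomorphic_on z ` U"
    using U sphere_charts_atlas by blast
qed

end

section \<open>Isotropic W-curves\<close>

text \<open>The exponent that occurs in both vectors of the W-curve. The division is exact: if
  \<open>m + n\<close> is odd, the other factor is 2.\<close>

definition w_exp :: "nat \<Rightarrow> nat \<Rightarrow> nat" where
  "w_exp m n = (m + n) * (1 + (m + n) mod 2) div 2"

lemma w_exp: "2 * w_exp m n = (1 + (m + n) mod 2) * m + (1 + (m + n) mod 2) * n"
proof -
  have "even ((m + n) * (1 + (m + n) mod 2))" by (cases "even (m + n)") (auto simp: odd_iff_mod_2_eq_one)
  then have "2 * w_exp m n = (m + n) * (1 + (m + n) mod 2)" unfolding w_exp_def by simp
  then show ?thesis by (simp add: algebra_simps)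
qed

text \<open>The frame of the W-curve in the coordinate \<open>1 / z\<close> of the sphere.\<close>

definition v_inf :: "nat \<Rightarrow> nat \<Rightarrow> nat \<Rightarrow> complex \<Rightarrow> complex^4" where
  "v_inf m n \<epsilon> t =
     (of_nat m - of_nat n) *s e 3
     - ((of_nat m + of_nat n) * t ^ ((1 + \<epsilon>) * m)) *s e 1
     - (2 * \<i> * of_real (sqrt (real (m * n))) * t ^ ((m + n) * (1 + \<epsilon>) div 2)) *s e 2"

definition w_inf :: "nat \<Rightarrow> nat \<Rightarrow> nat \<Rightarrow> complex \<Rightarrow> complex^4" where
  "w_inf m n \<epsilon> t =
     (of_nat m - of_nat n) *s e 4
     - (2 * \<i> * of_real (sqrt (real (m * n))) * t ^ ((m + n) * (1 + \<epsilon>) div 2)) *s e 1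
     + ((of_nat m + of_nat n) * t ^ (n * (1 + \<epsilon>))) *s e 2"

lemma vec4_W: "v_vec m n \<epsilon> z = vec4 (of_nat m - of_nat n) 0 (- ((of_nat m + of_nat n) * z ^ ((1 + \<epsilon>) * m)))
     (- (2 * \<i> * of_real (sqrt (real (m * n))) * z ^ ((m + n) * (1 + \<epsilon>) div 2)))"
  "w_vec m n \<epsilon> z = vec4 0 (of_nat m - of_nat n)
     (- (2 * \<i> * of_real (sqrt (real (m * n))) * z ^ ((m + n) * (1 + \<epsilon>) div 2)))
     ((of_nat m + of_nat n) * z ^ (n * (1 + \<epsilon>)))"
  "v_inf m n \<epsilon> z = vec4 (- ((of_nat m + of_nat n) * z ^ ((1 + \<epsilon>) * m)))
     (- (2 * \<i> * of_real (sqrt (real (m * n))) * z ^ ((m + n) * (1 + \<epsilon>) div 2))) (of_nat m - of_nat n) 0"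
  "w_inf m n \<epsilon> z = vec4 (- (2 * \<i> * of_real (sqrt (real (m * n))) * z ^ ((m + n) * (1 + \<epsilon>) div 2)))
     ((of_nat m + of_nat n) * z ^ (n * (1 + \<epsilon>))) 0 (of_nat m - of_nat n)"
  by (simp_all add: vec_eq_iff forall_4 v_vec_def w_vec_def v_inf_def w_inf_def axis_def)

lemma vec4_holomorphic:
  assumes "a holomorphic_on S" "b holomorphic_on S" "c holomorphic_on S" "d holomorphic_on S"
  shows "vec_holomorphic_on (\<lambda>x. vec4 (a x) (b x) (c x) (d x)) S"
  unfolding vec_holomorphic_on_def
proof
  fix i :: 4 show "(\<lambda>x. vec4 (a x) (b x) (c x) (d x) $ i) holomorphic_on S"
    using exhaust_4[of i] assms by (elim disjE) simp_all
qed

lemma W_holomorphic: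
  assumes "g holomorphic_on S"
  shows "vec_holomorphic_on (\<lambda>x. v_vec m n \<epsilon> (g x)) S" "vec_holomorphic_on (\<lambda>x. w_vec m n \<epsilon> (g x)) S"
    "vec_holomorphic_on (\<lambda>x. v_inf m n \<epsilon> (g x)) S" "vec_holomorphic_on (\<lambda>x. w_inf m n \<epsilon> (g x)) S"
  unfolding vec4_W by (intro vec4_holomorphic holomorphic_intros assms)+

context
  fixes m n \<epsilon> :: nat
  assumes mn: "n < m" and \<epsilon>: "\<epsilon> = (m + n) mod 2"
begin

lemma A_nonzero: "(of_nat m - of_nat n :: complex) \<noteq> 0"
  using mn by simp

lemma indep_W: "indep2 (v_vec m n \<epsilon> z) (w_vec m n \<epsilon> z)" "indep2 (v_inf m n \<epsilon> z) (w_inf m n \<epsilon> z)"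
  using A_nonzero unfolding vec4_W by (simp_all add: indep2_def vec_eq_iff forall_4)

lemma \<omega>_W: "\<omega> (v_vec m n \<epsilon> z) (w_vec m n \<epsilon> z) = 0" "\<omega> (v_inf m n \<epsilon> z) (w_inf m n \<epsilon> z) = 0"
  unfolding vec4_W by (simp_all add: \<omega>_def)

lemma W_Q3: "vec.span {v_vec m n \<epsilon> z, w_vec m n \<epsilon> z} \<in> Q3" "vec.span {v_inf m n \<epsilon> z, w_inf m n \<epsilon> z} \<in> Q3"
  using Q3_span indep_W \<omega>_W by auto

text \<open>Positive powers vanish at zero, so only the constant terms survive, multiples of
  \<open>e 3\<close> and \<open>e 4\<close>.\<close>

lemma W_at_infinity: "vec.span {v_inf m n \<epsilon> 0, w_inf m n \<epsilon> 0} = vec.span {e 3, e 4}" if "n > 0"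
proof -
  have "w_exp m n \<noteq> 0"
  proof
    assume "w_exp m n = 0"
    then have "(1 + (m + n) mod 2) * m = 0" using w_exp[of m n] by simp
    then show False using mn by simp
  qed
  then have pos: "(m + n) * (1 + \<epsilon>) div 2 \<noteq> 0" by (simp add: w_exp_def \<epsilon>)
  have v: "v_inf m n \<epsilon> 0 = (of_nat m - of_nat n) *s e 3" "w_inf m n \<epsilon> 0 = (of_nat m - of_nat n) *s e 4"
    using that mn pos by (simp_all add: v_inf_def w_inf_def power_0_left)
  have Q: "vec.span {v_inf m n \<epsilon> 0, w_inf m n \<epsilon> 0} \<in> Q3" by (rule W_Q3)
  have "1 / (of_nat m - of_nat n) * (of_nat m - of_nat n) = (1 :: complex)"
    using A_nonzero by simp
  then have ax: "e 3 = (1 / (of_nat m - of_nat n)) *s v_inf m n \<epsilon> 0 + 0 *s w_inf m n \<epsilon> 0"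
    "e 4 = 0 *s v_inf m n \<epsilon> 0 + (1 / (of_nat m - of_nat n)) *s w_inf m n \<epsilon> 0"
    unfolding v vector_smult_assoc by (simp_all only: vec.scale_one vec.scale_zero_left add_0_left add_0_right mult_zero_left)
  show ?thesis
  proof (rule plane_eq_span)
    show "vec.subspace (vec.span {v_inf m n \<epsilon> 0, w_inf m n \<epsilon> 0})" "vec.dim (vec.span {v_inf m n \<epsilon> 0, w_inf m n \<epsilon> 0}) = 2"
      using Q unfolding Q3_def by blast+
    show "e 3 \<in> vec.span {v_inf m n \<epsilon> 0, w_inf m n \<epsilon> 0}" "e 4 \<in> vec.span {v_inf m n \<epsilon> 0, w_inf m n \<epsilon> 0}"
      unfolding in_span2 using ax by blast+
    show "indep2 (e 3) (e 4)" by (simp add: indep2_def vec_eq_iff forall_4 axis_def)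
  qed
qed

text \<open>The plane is a graph over \<open>[e 1 \<and> e 2]\<close>. With
  \<open>A = m - n\<close>, \<open>B = m + n\<close> and \<open>C\<^sup>2 = - 4 m n\<close> one has
  \<open>B\<^sup>2 + C\<^sup>2 = A\<^sup>2\<close>, so the matrix of this graph has determinant
  \<open>- 1 / (P Q)\<close>. It is therefore also a graph over \<open>[e 3 \<and> e 4]\<close>, and
  the inverse matrix has the same shape in \<open>t\<close>.\<close>

lemma W_inverse:
  assumes t: "t \<noteq> 0"
  shows "vec.span {v_vec m n \<epsilon> (inverse t), w_vec m n \<epsilon> (inverse t)} = vec.span {v_inf m n \<epsilon> t, w_inf m n \<epsilon> t}"
proof (rule plane_eq_span)
  show "vec.subspace (vec.span {v_vec m n \<epsilon> (inverse t), w_vec m n \<epsilon> (inverse t)})"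
    "vec.dim (vec.span {v_vec m n \<epsilon> (inverse t), w_vec m n \<epsilon> (inverse t)}) = 2"
    using W_Q3(1)[of "inverse t"] unfolding Q3_def by blast+
  show "indep2 (v_inf m n \<epsilon> t) (w_inf m n \<epsilon> t)" by (rule indep_W)
  define A B C :: complex where "A = of_nat m - of_nat n" and "B = of_nat m + of_nat n"
    and "C = 2 * \<i> * of_real (sqrt (real (m * n)))"
  have A0: "A \<noteq> 0" using A_nonzero by (simp add: A_def)
  have "(of_real (sqrt (real (m * n))))\<^sup>2 = (of_nat m * of_nat n :: complex)"
    by (simp flip: of_real_power)
  then have C2: "C * C = - 4 * (of_nat m * of_nat n)"
    by (simp add: C_def power2_eq_square algebra_simps)
  have ABC: "B * B + C * C = A * A" unfolding C2 by (simp add: A_def B_def algebra_simps)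
  define P Q R where "P = t ^ ((1 + \<epsilon>) * m)" and "Q = t ^ (n * (1 + \<epsilon>))" and "R = t ^ ((m + n) * (1 + \<epsilon>) div 2)"
  have k: "(m + n) * (1 + \<epsilon>) div 2 + (m + n) * (1 + \<epsilon>) div 2 = (1 + \<epsilon>) * m + n * (1 + \<epsilon>)"
    using w_exp[of m n] by (simp add: w_exp_def \<epsilon> mult.commute)
  have RR: "R * R = P * Q" unfolding P_def Q_def R_def power_add[symmetric] k ..
  have nz: "P \<noteq> 0" "Q \<noteq> 0" "R \<noteq> 0" using t by (simp_all add: P_def Q_def R_def)
  have inv: "inverse t ^ ((1 + \<epsilon>) * m) = inverse P" "inverse t ^ (n * (1 + \<epsilon>)) = inverse Q"
    "inverse t ^ ((m + n) * (1 + \<epsilon>) div 2) = inverse R"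
    by (simp_all only: P_def Q_def R_def power_inverse)
  have v: "v_vec m n \<epsilon> (inverse t) = vec4 A 0 (- (B * inverse P)) (- (C * inverse R))"
    "w_vec m n \<epsilon> (inverse t) = vec4 0 A (- (C * inverse R)) (B * inverse Q)"
    "v_inf m n \<epsilon> t = vec4 (- (B * P)) (- (C * R)) A 0"
    "w_inf m n \<epsilon> t = vec4 (- (C * R)) (B * Q) 0 A"
    unfolding vec4_W inv by (simp_all only: A_def B_def C_def P_def Q_def R_def)
  have PR: "P * inverse R = R * inverse Q" "R * inverse P = Q * inverse R"
    using nz RR by (simp_all add: field_simps)
  have "v_inf m n \<epsilon> t = (- (B * P) / A) *s v_vec m n \<epsilon> (inverse t) + (- (C * R) / A) *s w_vec m n \<epsilon> (inverse t)"
  proof -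
    have 3: "A = (- (B * P) / A) * (- (B * inverse P)) + (- (C * R) / A) * (- (C * inverse R))"
    proof -
      have "(- (B * P) / A) * (- (B * inverse P)) + (- (C * R) / A) * (- (C * inverse R)) = (B * B + C * C) / A"
        using nz A0 by (simp add: field_simps)
      then show ?thesis unfolding ABC using A0 by simp
    qed
    have 4: "0 = (- (B * P) / A) * (- (C * inverse R)) + (- (C * R) / A) * (B * inverse Q)"
    proof -
      have "(- (B * P) / A) * (- (C * inverse R)) + (- (C * R) / A) * (B * inverse Q) =
         B * C / A * (P * inverse R - R * inverse Q)" using A0 by (simp add: field_simps)
      then show ?thesis unfolding PR by simp
    qed
    show ?thesis unfolding v vec_eq_iff forall_4 using A0 3 4 by simp
  qed
  then show "v_inf m n \<epsilon> t \<in> vec.span {v_vec m n \<epsilon> (inverse t), w_vec m n \<epsilon> (inverse t)}"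
    unfolding in_span2 by blast
  have "w_inf m n \<epsilon> t = (- (C * R) / A) *s v_vec m n \<epsilon> (inverse t) + (B * Q / A) *s w_vec m n \<epsilon> (inverse t)"
  proof -
    have 4: "A = (- (C * R) / A) * (- (C * inverse R)) + (B * Q / A) * (B * inverse Q)"
    proof -
      have "(- (C * R) / A) * (- (C * inverse R)) + (B * Q / A) * (B * inverse Q) = (B * B + C * C) / A"
        using nz A0 by (simp add: field_simps)
      then show ?thesis unfolding ABC using A0 by simp
    qed
    have 3: "0 = (- (C * R) / A) * (- (B * inverse P)) + (B * Q / A) * (- (C * inverse R))"
    proof -
      have "(- (C * R) / A) * (- (B * inverse P)) + (B * Q / A) * (- (C * inverse R)) =
         B * C / A * (R * inverse P - Q * inverse R)" using A0 by (simp add: field_simps)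
      then show ?thesis unfolding PR by simp
    qed
    show ?thesis unfolding v vec_eq_iff forall_4 using A0 3 4 by (simp add: add.commute)
  qed
  then show "w_inf m n \<epsilon> t \<in> vec.span {v_vec m n \<epsilon> (inverse t), w_vec m n \<epsilon> (inverse t)}"
    unfolding in_span2 by blast
qed

end

lemma W_curve_eq:
  assumes "quotient_of q = (int m, int n)"
  shows "W_curve q None = vec.span {e 3, e 4}"
    "W_curve q (Some z) = vec.span {v_vec m n ((m + n) mod 2) z, w_vec m n ((m + n) mod 2) z}"
  unfolding W_curve_def by (simp_all add: assms Let_def)

lemma Q3_image:
  assumes "M \<in> Sp2" "indep2 a b" "\<omega> a b = 0"
  shows "vec.span {M *v a, M *v b} \<in> Q3"
  using Q3_span[of "M *v a" "M *v b"] assms indep2_Sp2[OF assms(1)] Sp2_\<omega>[OF assms(1)] by simp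

context riemann
begin

text \<open>Near a finite value of the map the frame \<open>v_vec\<close>, \<open>w_vec\<close>
  serves, near a pole the frame \<open>v_inf\<close>, \<open>w_inf\<close>; each is holomorphic in
  the corresponding coordinate of the sphere.\<close>

lemma W_curve_into:
  assumes H: "mero H" and q: "quotient_of q = (int m, int n)" "0 < n" "n < m" and M: "M \<in> Sp2"
  shows "holomorphic_into Q3 2 X \<A> (\<lambda>p. (*v) M ` W_curve q (to_sphere H p))"
  unfolding holomorphic_into_def
proof
  let ?F = "\<lambda>p. (*v) M ` W_curve q (to_sphere H p)" and ?\<epsilon> = "(m + n) mod 2"
  fix p assume p: "p \<in> topspace X"
  have frame_of: "?F p \<in> Q3 \<and> (\<exists>(U, z)\<in>\<A>. p \<in> U \<and> (\<exists>u. frame 2 ?F (U, z) u))"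
    if U: "(U, z) \<in> \<A>" "p \<in> U" and ab: "vec_holomorphic_on a (z ` U)" "vec_holomorphic_on b (z ` U)"
      "\<And>q'. q' \<in> U \<Longrightarrow> W_curve q (to_sphere H q') = vec.span {a (z q'), b (z q')}"
      "\<And>x. indep2 (a x) (b x)" "\<And>x. \<omega> (a x) (b x) = 0" for U z a b
  proof -
    have F: "?F q' = vec.span {M *v a (z q'), M *v b (z q')}" if "q' \<in> U" for q'
      unfolding ab(3)[OF that] by (rule image_span2)
    have Q: "?F q' \<in> Q3" if "q' \<in> U" for q'
      unfolding F[OF that] by (rule Q3_image[OF M ab(4,5)])
    have "frame 2 ?F (U, z) (\<lambda>i x. if i = 0 then M *v a x else M *v b x)"
      unfolding frame_2_iff
    proof (intro conjI ballI)
      fix q' assume q': "q' \<in> U"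
      show "vec.dim (?F q') = 2" using Q[OF q'] unfolding Q3_def by blast
      show "?F q' = vec.span {if (0::nat) = 0 then M *v a (z q') else M *v b (z q'),
          if (1::nat) = 0 then M *v a (z q') else M *v b (z q')}"
        unfolding F[OF q'] by simp
    qed (use ab(1,2) in \<open>auto intro: vec_holomorphic_matrix\<close>)
    with U Q[OF U(2)] show ?thesis by blast
  qed
  from to_sphere_local[OF H p] obtain U z where U: "(U, z) \<in> \<A>" "p \<in> U"
    and cs: "(\<exists>g. g holomorphic_on z ` U \<and> (\<forall>q\<in>U. to_sphere H q = Some (g (z q)))) \<or>
     (\<exists>t. t holomorphic_on z ` U \<and>
       (\<forall>q\<in>U. to_sphere H q = (if t (z q) = 0 then None else Some (inverse (t (z q))))))" by metis
  from cs show "?F p \<in> Q3 \<and> (\<exists>(U, z)\<in>\<A>. p \<in> U \<and> (\<exists>u. frame 2 ?F (U, z) u))"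
  proof
    assume "\<exists>g. g holomorphic_on z ` U \<and> (\<forall>q\<in>U. to_sphere H q = Some (g (z q)))"
    then obtain g where g: "g holomorphic_on z ` U" "\<And>q. q \<in> U \<Longrightarrow> to_sphere H q = Some (g (z q))" by blast
    show ?thesis
      by (rule frame_of[OF U W_holomorphic(1)[OF g(1), of m n ?\<epsilon>] W_holomorphic(2)[OF g(1), of m n ?\<epsilon>]])
        (simp_all add: g(2) W_curve_eq(2)[OF q(1)] indep_W[OF q(3)] \<omega>_W[OF q(3)])
  next
    assume "\<exists>t. t holomorphic_on z ` U \<and>
       (\<forall>q\<in>U. to_sphere H q = (if t (z q) = 0 then None else Some (inverse (t (z q)))))"
    then obtain t where t: "t holomorphic_on z ` U"
      "\<And>q. q \<in> U \<Longrightarrow> to_sphere H q = (if t (z q) = 0 then None else Some (inverse (t (z q))))" by blast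
    show ?thesis
    proof (rule frame_of[OF U W_holomorphic(3)[OF t(1), of m n ?\<epsilon>] W_holomorphic(4)[OF t(1), of m n ?\<epsilon>]])
      fix q' assume q': "q' \<in> U"
      show "W_curve q (to_sphere H q') = vec.span {v_inf m n ?\<epsilon> (t (z q')), w_inf m n ?\<epsilon> (t (z q'))}"
      proof (cases "t (z q') = 0")
        case True
        then show ?thesis
          using W_at_infinity[OF q(3) refl q(2)] t(2)[OF q'] W_curve_eq(1)[OF q(1)] by simp
      next
        case False
        then show ?thesis
          using W_inverse[OF q(3) refl False] t(2)[OF q'] W_curve_eq(2)[OF q(1)] by simp
      qed
    qed (simp_all add: indep_W[OF q(3)] \<omega>_W[OF q(3)])
  qed
qed

end

text \<open>A common divisor divides \<open>2 m\<close> and \<open>2 n\<close>, hence 2 by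
  coprimality, and the parity of \<open>m + n\<close> decides.\<close>

lemma gcd_sum_diff:
  assumes "coprime m n" "n < (m :: nat)"
  shows "gcd (int m + int n) (int m - int n) = (if odd (m + n) then 1 else 2)"
proof -
  let ?g = "gcd (int m + int n) (int m - int n)"
  have "?g dvd (int m + int n) + (int m - int n)" "?g dvd (int m + int n) - (int m - int n)"
    by (meson dvd_add dvd_diff gcd_dvd1 gcd_dvd2)+
  then have "?g dvd 2 * int m" "?g dvd 2 * int n" by simp_all
  then have "?g dvd gcd (2 * int m) (2 * int n)" by simp
  also have "gcd (2 * int m) (2 * int n) = 2 * gcd (int m) (int n)"
    using gcd_mult_distrib_int[of 2 "int m" "int n"] by (simp only: abs_numeral)
  also have "gcd (int m) (int n) = 1" using assms(1) by simp
  finally have g2: "?g dvd 2" by simp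
  then have "?g \<le> 2" by (rule zdvd_imp_le) simp
  moreover have "?g > 0" using assms(2) by (simp add: gcd_pos_int)
  ultimately have "?g = 1 \<or> ?g = 2" by linarith
  moreover have "2 dvd ?g \<longleftrightarrow> even (m + n)" by (simp only: gcd_greatest_iff) auto
  ultimately show ?thesis
    by (metis dvd_refl odd_one)
qed

section \<open>Domination by a W-curve\<close>

context jet_chart
begin

text \<open>With \<open>l = m c\<close> and \<open>k = n c\<close>, Bezout coefficients combine the
  exponents \<open>l + k\<close> and \<open>l - k\<close> to \<open>g c\<close>, where
  \<open>g\<close> is the greatest common divisor of \<open>m + n\<close> and \<open>m - n\<close>.
  So \<open>h = exp (g c \<zeta>)\<close> is global, and since \<open>(1 + \<epsilon>) g = 2\<close>
  its powers in the W-curve are \<open>exp (2 l \<zeta>)\<close>, \<open>exp (2 k \<zeta>)\<close>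
  and \<open>exp ((l + k) \<zeta>)\<close>.\<close>

lemma dominated_by_W:
  assumes rt: "roots l (k\<^sup>2)" "l\<^sup>2 \<noteq> k\<^sup>2" "k \<noteq> 0" and lk: "l = of_rat q * k" and q: "q > 1"
  shows "dominated X \<A> f sphere_atlas (W_curve q)"
proof -
  obtain a b where ab: "quotient_of q = (a, b)" by fastforce
  have b0: "b > 0" and cop: "coprime a b" and qab: "q = of_int a / of_int b"
    using quotient_of_denom_pos[OF ab] quotient_of_coprime[OF ab] quotient_of_div[OF ab] by auto
  have "a > b" using q b0 unfolding qab by (simp add: field_simps)
  define m n where "m = nat a" and "n = nat b"
  have mn: "a = int m" "b = int n" "0 < n" "n < m" using b0 \<open>a > b\<close> by (auto simp: m_def n_def)
  have qmn: "quotient_of q = (int m, int n)" using ab mn by simp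
  have copmn: "coprime m n" using cop mn by simp
  define c where "c = k / of_nat n"
  have kc: "k = of_nat n * c" using mn(3) by (simp add: c_def)
  have lc: "l = of_nat m * c"
    unfolding lk qab mn(1,2) c_def by (simp add: of_rat_divide)
  have c0: "c \<noteq> 0" using rt(3) kc by auto
  have l0: "l \<noteq> 0" using c0 mn unfolding lc by simp
  define \<epsilon> where "\<epsilon> = (m + n) mod 2"
  define g :: nat where "g = (if odd (m + n) then 1 else 2)"
  have eg: "(1 + \<epsilon>) * g = 2" 
    by (cases "odd (m + n)") (simp_all only: \<epsilon>_def g_def odd_iff_mod_2_eq_one even_iff_mod_2_eq_zero if_True if_False simp_thms, simp_all)
  obtain i j where ij: "i * (int m + int n) + j * (int m - int n) = int g"
    using bezout_int[of "int m + int n" "int m - int n"] gcd_sum_diff[OF copmn mn(4)]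
    by (metis g_def of_nat_1 of_nat_numeral)
  obtain H1 where H1: "mero H1" "\<And>x. x \<in> ball x0 r \<Longrightarrow> in_chart H1 (V, z) x = exp ((l + k) * x)"
    using exp_mero[OF rt(1,2) l0] by blast
  have "roots l ((- k)\<^sup>2)" "l\<^sup>2 \<noteq> (- k)\<^sup>2" using rt by simp_all
  from exp_mero[OF this l0]
  obtain H2 where H2: "mero H2" "\<And>x. x \<in> ball x0 r \<Longrightarrow> in_chart H2 (V, z) x = exp ((l - k) * x)" by auto
  define H where "H = (\<lambda>p. H1 p powi i * H2 p powi j)"
  have Hm: "mero H" unfolding H_def by (intro mero_mult mero_powi H1(1) H2(1))
  have Hx: "in_chart H (V, z) x = exp (of_nat g * c * x)" if x: "x \<in> ball x0 r" for x
  proof -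
    have "in_chart H (V, z) x = in_chart H1 (V, z) x powi i * in_chart H2 (V, z) x powi j"
      by (simp add: in_chart_def H_def)
    also have "\<dots> = exp (of_int i * ((l + k) * x) + of_int j * ((l - k) * x))"
      unfolding H1(2)[OF x] H2(2)[OF x] exp_add by (simp add: exp_power_int)
    also have "of_int i * ((l + k) * x) + of_int j * ((l - k) * x)
        = of_int (i * (int m + int n) + j * (int m - int n)) * c * x"
      unfolding lc kc by (simp add: algebra_simps)
    finally show ?thesis unfolding ij by simp
  qed
  have hol: "in_chart H (V, z) holomorphic_on ball x0 r"
    by (rule holomorphic_transform[of "\<lambda>x. exp (of_nat g * c * x)"]) (auto intro!: holomorphic_intros simp: Hx)
  have sph: "to_sphere H p = Some (exp (of_nat g * c * z p))" if p: "p \<in> V" for p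
  proof -
    have zp: "z p \<in> ball x0 r" using V(2) p by blast
    have "in_chart H (V, z) analytic_on {z p}"
      using hol zp holomorphic_on_imp_analytic_at[OF hol open_ball] by blast
    then show ?thesis
      using to_sphere_eq[OF Hm V(1) p] analytic_at_imp_no_pole Hx[OF zp] by simp
  qed
  \<comment> \<open>The square root of \<open>l * k\<close> which, divided by \<open>c\<close>, is
    the positive root of \<open>m * n\<close> in the W-curve.\<close>
  define r0 where "r0 = c * of_real (sqrt (real (m * n)))"
  have "(of_real (sqrt (real (m * n))))\<^sup>2 = (of_nat m * of_nat n :: complex)"
    by (simp flip: of_real_power)
  then have "r0\<^sup>2 = l * k" unfolding r0_def power_mult_distrib lc kc by (simp add: power2_eq_square)
  from normal_form[OF rt(1,2) l0 rt(3) this] obtain M where M: "M \<in> Sp2"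
    and Mf: "\<And>p. p \<in> V \<Longrightarrow>
     M *v ((l - k) *s e 1 - ((l + k) * exp (2 * l * z p)) *s e 3 - (2 * \<i> * r0 * exp ((l + k) * z p)) *s e 4) \<in> f p \<and>
     M *v ((l - k) *s e 2 - (2 * \<i> * r0 * exp ((l + k) * z p)) *s e 3 + ((l + k) * exp (2 * k * z p)) *s e 4) \<in> f p"
    by blast
  have on_V: "f p = (*v) M ` W_curve q (to_sphere H p)" if p: "p \<in> V" for p
  proof -
    define h where "h = exp (of_nat g * c * z p)"
    have egc: "(1 + of_nat \<epsilon>) * of_nat g = (2 :: complex)"
      using arg_cong[OF eg, of "of_nat :: nat \<Rightarrow> complex"] by simp
    have pw: "h ^ N = exp (of_nat N * (of_nat g * c * z p))" for N by (simp add: h_def exp_of_nat_mult)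
    have e1: "h ^ ((1 + \<epsilon>) * m) = exp (2 * l * z p)"
    proof -
      have "of_nat ((1 + \<epsilon>) * m) * (of_nat g * c * z p) = ((1 + of_nat \<epsilon>) * of_nat g) * (of_nat m * c) * z p"
        by (simp add: algebra_simps)
      then show ?thesis unfolding pw egc lc by (simp only: mult.assoc)
    qed
    have e2: "h ^ (n * (1 + \<epsilon>)) = exp (2 * k * z p)"
    proof -
      have "of_nat (n * (1 + \<epsilon>)) * (of_nat g * c * z p) = ((1 + of_nat \<epsilon>) * of_nat g) * (of_nat n * c) * z p"
        by (simp add: algebra_simps)
      then show ?thesis unfolding pw egc kc by (simp only: mult.assoc)
    qed
    have e3: "h ^ ((m + n) * (1 + \<epsilon>) div 2) = exp ((l + k) * z p)"
    proof -
      have "2 * ((m + n) * (1 + \<epsilon>) div 2) = (1 + \<epsilon>) * m + (1 + \<epsilon>) * n"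
        using w_exp[of m n] by (simp add: w_exp_def \<epsilon>_def)
      from arg_cong[OF this, of "of_nat :: nat \<Rightarrow> complex"]
      have "2 * of_nat ((m + n) * (1 + \<epsilon>) div 2) = (1 + of_nat \<epsilon>) * (of_nat m + of_nat n :: complex)"
        by (simp add: algebra_simps del: of_nat_div)
      then have "2 * (of_nat ((m + n) * (1 + \<epsilon>) div 2) * (of_nat g * c * z p))
         = ((1 + of_nat \<epsilon>) * of_nat g) * (of_nat m * c + of_nat n * c) * z p" by algebra
      then have "2 * (of_nat ((m + n) * (1 + \<epsilon>) div 2) * (of_nat g * c * z p)) = 2 * ((l + k) * z p)"
        unfolding egc lc[symmetric] kc[symmetric] by (simp only: mult.assoc)
      then have "of_nat ((m + n) * (1 + \<epsilon>) div 2) * (of_nat g * c * z p) = (l + k) * z p"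
        by (rule mult_left_cancel[THEN iffD1, rotated]) simp
      then show ?thesis unfolding pw by (rule arg_cong)
    qed
    have v: "(l - k) *s e 1 - ((l + k) * exp (2 * l * z p)) *s e 3 - (2 * \<i> * r0 * exp ((l + k) * z p)) *s e 4
        = c *s v_vec m n \<epsilon> h"
      unfolding v_vec_def e1 e3 r0_def by (simp add: vec_eq_iff lc kc algebra_simps)
    have w: "(l - k) *s e 2 - (2 * \<i> * r0 * exp ((l + k) * z p)) *s e 3 + ((l + k) * exp (2 * k * z p)) *s e 4
        = c *s w_vec m n \<epsilon> h"
      unfolding w_vec_def e2 e3 r0_def by (simp add: vec_eq_iff lc kc algebra_simps)
    have Q3: "f p \<in> Q3" using f_Q3 chartD(2)[OF V(1)] p by blast
    have sub: "M *v u \<in> f p" if "M *v (c *s u) \<in> f p" for u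
    proof -
      have "vec.subspace (f p)" using Q3 unfolding Q3_def by blast
      then have "(1 / c) *s (M *v (c *s u)) \<in> f p" using that vec.subspace_scale by blast
      then show ?thesis using c0 by (simp add: matrix_vector_scale)
    qed
    have "M *v v_vec m n \<epsilon> h \<in> f p" "M *v w_vec m n \<epsilon> h \<in> f p"
      using Mf[OF p] sub unfolding v w by blast+
    then have "f p = vec.span {M *v v_vec m n \<epsilon> h, M *v w_vec m n \<epsilon> h}"
      using Q3 indep2_Sp2[OF M] indep_W(1)[OF mn(4) \<epsilon>_def]
      by (intro plane_eq_span) (auto simp: Q3_def)
    then show ?thesis
      unfolding sph[OF p] W_curve_eq(2)[OF qmn] image_span2 h_def \<epsilon>_def .
  qed
  obtain p0 where "p0 \<in> V" using ex_center by blast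
  then have "V \<noteq> {}" by blast
  \<comment> \<open>Both sides are holomorphic curves of Lagrangian planes on the whole surface, and
    they agree on \<open>V\<close>.\<close>
  have "f p = (*v) M ` W_curve q (to_sphere H p)" if "p \<in> topspace X" for p
    by (rule Q3_identity[OF f_into W_curve_into[OF Hm qmn mn(3,4) M] chartD(1)[OF V(1)] \<open>V \<noteq> {}\<close> on_V that])
  then show ?thesis
    unfolding dominated_def using to_sphere_holomorphic[OF Hm] M by blast
qed

end

section \<open>The invariant r\<close>

lemma D4_class_eq: "D4_class x = {x, - x, inverse x, - inverse x}"
proof -
  have "g x \<in> {x, - x, inverse x, - inverse x}" if "g \<in> D4" for g
    using that by induction auto
  moreover have D: "id \<in> D4" "inverse \<circ> id \<in> D4" "uminus \<circ> id \<in> D4" "uminus \<circ> (inverse \<circ> id) \<in> D4"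
    by (intro D4.intros)+
  have "x \<in> D4_class x" "inverse x \<in> D4_class x" "- x \<in> D4_class x" "- inverse x \<in> D4_class x"
    unfolding D4_class_def
    using imageI[OF D(1), of "\<lambda>g. g x"] imageI[OF D(2), of "\<lambda>g. g x"] imageI[OF D(3), of "\<lambda>g. g x"]
      imageI[OF D(4), of "\<lambda>g. g x"] by simp_all
  ultimately show ?thesis by (auto simp: D4_class_def)
qed

text \<open>The orbit consists of \<open>s\<close>, \<open>- s\<close> and their inverses; away from
  \<open>1\<close> and \<open>- 1\<close> exactly one of the four exceeds 1.\<close>

lemma D4_class_rational:
  assumes s: "s \<noteq> 0" "\<bar>s\<bar> \<noteq> 1" and q: "q = (if \<bar>s\<bar> > 1 then \<bar>s\<bar> else inverse \<bar>s\<bar>)"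
  shows "q > 1" "{x \<in> D4_class (of_rat s). x \<in> \<real> \<and> Re x > 1} = {of_rat q}"
proof -
  show q1: "q > 1" using s q by (auto simp: one_less_inverse_iff)
  have re: "(of_rat t :: complex) \<in> \<real>" "Re (of_rat t) > 1 \<longleftrightarrow> t > 1" for t
  proof -
    have *: "of_rat t = complex_of_real (of_rat t)"
      by (cases t) (simp add: of_rat_rat)
    show "(of_rat t :: complex) \<in> \<real>" unfolding * by (rule Reals_of_real)
    show "Re (of_rat t) > 1 \<longleftrightarrow> t > 1" unfolding * Re_complex_of_real by simp
  qed
  have cl: "D4_class (of_rat s) = of_rat ` {s, - s, inverse s, - inverse s}"
    by (auto simp: D4_class_eq of_rat_minus of_rat_inverse)
  have "{t \<in> {s, - s, inverse s, - inverse s}. t > 1} = {q}"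
  proof -
    consider "s > 1" | "0 < s" "s < 1" | "- 1 < s" "s < 0" | "s < - 1" using s by linarith
    then show ?thesis
    proof cases
      case 1
      then have "inverse s < 1" "0 < inverse s" by (simp_all add: inverse_less_1_iff)
      then have "\<not> inverse s > 1" "\<not> - inverse s > 1" "\<not> - s > 1" using 1 by linarith+
      then show ?thesis using 1 q by auto
    next
      case 2
      then have "inverse s > 1" by (simp add: one_less_inverse_iff)
      then have "inverse s > 1" "\<not> - inverse s > 1" "\<not> - s > 1" using 2 by linarith+
      then show ?thesis using 2 q by auto
    next
      case 3
      then have "inverse (- s) > 1" by (simp add: one_less_inverse_iff del: inverse_minus_eq)
      then have "- inverse s > 1" by simp
      then have "- inverse s > 1" "\<not> inverse s > 1" "\<not> - s > 1" using 3 by linarith+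
      then show ?thesis using 3 q by auto
    next
      case 4
      then have "inverse (- s) < 1" "0 < inverse (- s)" by (simp_all add: inverse_less_1_iff del: inverse_minus_eq)
      then have "- inverse s < 1" "0 < - inverse s" by simp_all
      then have "\<not> inverse s > 1" "\<not> - inverse s > 1" "- s > 1" using 4 by linarith+
      then show ?thesis using 4 q by auto
    qed
  qed
  then show "{x \<in> D4_class (of_rat s). x \<in> \<real> \<and> Re x > 1} = {of_rat q}"
    unfolding cl using re by (auto simp: image_iff)
qed

theorem theorem5:
  fixes X :: "'a topology" and \<A> :: "'a chart set"
    and f :: "'a \<Rightarrow> (complex^4) set" and \<kappa> :: complex
  assumes "riemann_surface X \<A>" and "compact_space X" and "connected_space X"
    and "isotropic_curve X \<A> f"
    and "constant_bending X \<A> f \<kappa>"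
  shows "regular_type \<kappa> \<and>
         r_map \<kappa> \<in> Qdot_classes \<and>
         (\<exists>q :: rat. q > 1 \<and>
            {x \<in> r_map \<kappa>. x \<in> \<real> \<and> Re x > 1} = {of_rat q} \<and>
            dominated X \<A> f sphere_atlas (W_curve q))"
proof -
  interpret isotropic X \<A> f using assms(4) by unfold_locales
  obtain V z r x0 p Y where jc: "(V, z) \<in> \<A>" "z ` V = ball x0 r" "r > 0" "16 * p\<^sup>2 = \<kappa>"
    "jets p (ball x0 r) Y" "\<And>q. q \<in> V \<Longrightarrow> f q = vec.span {Y 0 (z q), Y 1 (z q)}"
  proof (rule constant_coefficient_chart[OF assms(5)])
    fix V z r x0 p Y
    assume "(V, z) \<in> \<A>" "z ` V = ball x0 r" "r > 0" "16 * p\<^sup>2 = \<kappa>"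
      "jets p (ball x0 r) Y" "\<And>q. q \<in> V \<Longrightarrow> f q = vec.span {Y 0 (z q), Y 1 (z q)}"
    then show thesis by (rule that)
  qed
  interpret jet_chart X \<A> f V z r x0 p Y by unfold_locales (fact jc)+
  have ne: "\<kappa> \<noteq> 1" "9 * p\<^sup>2 + 1 \<noteq> 0" using not_exceptional[OF assms(2)] jc(4) by auto
  have "\<kappa> \<noteq> - 16/9"
  proof
    assume "\<kappa> = - 16/9"
    then have "9 * (16 * p\<^sup>2) = - 16" using jc(4) by simp
    then have "9 * p\<^sup>2 + 1 = 0" by algebra
    then show False using ne(2) by simp
  qed
  then have reg: "regular_type \<kappa>" using ne(1) by (simp add: regular_type_def)
  \<comment> \<open>As a polynomial in \<open>x\<^sup>2\<close> the characteristic polynomial has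
    discriminant \<open>4 (16 p\<^sup>2 - 1)\<close>, so \<open>d\<close> is half a square root of
    it; this is the origin of the inner radical in \<open>r_map\<close>.\<close>
  define c d where "c = csqrt \<kappa>" and "d = csqrt (c\<^sup>2 - 1)"
  have cd: "c\<^sup>2 = 16 * p\<^sup>2" "d\<^sup>2 = 16 * p\<^sup>2 - 1" using jc(4) by (simp_all add: c_def d_def)
  have "d \<noteq> 0" using cd(2) ne(1) jc(4) by auto
  \<comment> \<open>up to a common sign, \<open>P\<close> and \<open>Q\<close> are the squares of the characteristic roots \<open>l\<close> and \<open>k\<close>\<close>
  define P Q where "P = (5 * c - 4 * d) / 4" and "Q = (5 * c + 4 * d) / 4"
  have "16 * (P * Q) = 25 * c\<^sup>2 - 16 * d\<^sup>2" by (simp add: P_def Q_def field_simps power2_eq_square)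
  with cd have PQ: "P * Q = 9 * p\<^sup>2 + 1" by algebra
  then have PQ0: "P \<noteq> 0" "Q \<noteq> 0" using ne(2) by auto
  have PQs: "P + Q = 5 * c / 2" by (simp add: P_def Q_def field_simps)
  have "(c - 4 * p) * (c + 4 * p) = 0" using cd(1) by (simp add: algebra_simps power2_eq_square)
  then consider "c = 4 * p" | "c = - 4 * p" by (auto simp: eq_neg_iff_add_eq_0)
  \<comment> \<open>The chosen square root \<open>c\<close> may be \<open>4 * p\<close> or
    \<open>- 4 * p\<close>; \<open>\<sigma>\<close> is the sign by which \<open>P\<close> and
    \<open>Q\<close> differ from the squared roots.\<close>
  then obtain \<sigma> :: complex where \<sigma>: "\<sigma>\<^sup>2 = 1" "\<sigma> * (P + Q) = - 10 * p"
  proof cases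
    case 1 then show thesis using that[of "- 1"] PQs by simp
  next
    case 2 then show thesis using that[of 1] PQs by simp
  qed
  define \<rho> where "\<rho> = csqrt ((5 * c - 4 * d) * inverse (5 * c + 4 * d))"
  have rm: "r_map \<kappa> = D4_class \<rho>" unfolding r_map_def Let_def c_def[symmetric] d_def[symmetric] \<rho>_def ..
  have "\<rho>\<^sup>2 = (5 * c - 4 * d) * inverse (5 * c + 4 * d)" unfolding \<rho>_def by (rule power2_csqrt)
  also have "\<dots> = (4 * P) * inverse (4 * Q)"
    by (simp only: P_def Q_def times_divide_eq_right nonzero_mult_div_cancel_left[of 4, OF zero_neq_numeral[symmetric]])
  also have "\<dots> = P / Q" by (simp add: field_simps)
  finally have \<rho>2: "\<rho>\<^sup>2 = P / Q" .
  \<comment> \<open>The other root is not a separate square root but \<open>\<rho> * k0\<close>, so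
    that its quotient by \<open>k0\<close> is \<open>\<rho>\<close> exactly.\<close>
  define k0 where "k0 = csqrt (\<sigma> * Q)"
  have \<sigma>0: "\<sigma> \<noteq> 0" using \<sigma>(1) by auto
  have k0: "k0\<^sup>2 = \<sigma> * Q" "k0 \<noteq> 0" using PQ0 \<sigma>0 by (auto simp: k0_def)
  have l2: "(\<rho> * k0)\<^sup>2 = \<sigma> * P" using PQ0 by (simp add: power_mult_distrib \<rho>2 k0)
  have rts: "roots l (k\<^sup>2)" if "l\<^sup>2 = \<sigma> * P \<and> k\<^sup>2 = \<sigma> * Q \<or> l\<^sup>2 = \<sigma> * Q \<and> k\<^sup>2 = \<sigma> * P" for l k
  proof -
    have "l\<^sup>2 + k\<^sup>2 = \<sigma> * (P + Q)" "l\<^sup>2 * k\<^sup>2 = \<sigma>\<^sup>2 * (P * Q)"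
      using that by (auto simp: algebra_simps power2_eq_square)
    then show ?thesis unfolding roots_def using \<sigma> PQ by simp
  qed
  have "P \<noteq> Q" using \<open>d \<noteq> 0\<close> by (simp add: P_def Q_def)
  then have PQne: "\<sigma> * P \<noteq> \<sigma> * Q" using \<sigma>0 by simp
  have \<rho>0: "\<rho> \<noteq> 0" using \<rho>2 PQ0 by auto
  have "\<rho> * k0 / k0 \<in> \<rat>"
    by (rule rational_quotient[OF assms(2) rts]) (use l2 k0 PQne \<rho>0 in auto)
  then have "\<rho> \<in> \<rat>" using k0(2) by simp
  then obtain s where s: "\<rho> = of_rat s" by (auto elim: Rats_cases)
  have s0: "s \<noteq> 0" using \<rho>0 s by auto
  have s1: "\<bar>s\<bar> \<noteq> 1"
  proof
    assume "\<bar>s\<bar> = 1"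
    then have "s\<^sup>2 = 1" by (metis one_power2 power2_abs)
    then have "\<rho>\<^sup>2 = 1" unfolding s by (metis of_rat_1 of_rat_power)
    then show False using \<rho>2 \<open>P \<noteq> Q\<close> PQ0 by simp
  qed
  define q where "q = (if \<bar>s\<bar> > 1 then \<bar>s\<bar> else inverse \<bar>s\<bar>)"
  note q = D4_class_rational[OF s0 s1 q_def]
  have abs2: "(of_rat \<bar>s\<bar>)\<^sup>2 = \<rho>\<^sup>2" unfolding s by (metis of_rat_power power2_abs)
  \<comment> \<open>If \<open>\<rho>\<close> has modulus less than 1, the two pairs of roots
    exchange their roles; the sign of \<open>s\<close> is absorbed because only the squares of the
    roots are prescribed.\<close>
  have "dominated X \<A> f sphere_atlas (W_curve q)"
  proof (cases "\<bar>s\<bar> > 1")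
    case True
    have l: "(of_rat q * k0)\<^sup>2 = \<sigma> * P"
      using l2 True by (simp add: power_mult_distrib q_def abs2)
    show ?thesis
      by (rule dominated_by_W[OF rts _ k0(2) refl q(1)]) (use l k0 PQne in auto)
  next
    case False
    have "(of_rat q)\<^sup>2 = inverse (\<rho>\<^sup>2)"
      using False by (simp add: q_def of_rat_inverse power_inverse abs2)
    then have l: "(of_rat q * (\<rho> * k0))\<^sup>2 = \<sigma> * Q"
      using \<rho>0 by (simp add: power_mult_distrib k0(1))
    show ?thesis
      by (rule dominated_by_W[OF rts _ _ refl q(1), of "\<rho> * k0"]) (use l l2 PQne \<rho>0 k0(2) in auto)
  qed
  moreover have "r_map \<kappa> \<in> Qdot_classes"
    unfolding rm Qdot_classes_def using \<open>\<rho> \<in> \<rat>\<close> \<rho>0 by blast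
  ultimately show ?thesis using reg q unfolding rm s by blast
qed

end
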